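(* Let $f:\mathbb{R}^{m_y}\times\mathbb{R}^{m_z}\to\mathbb{R}^{m_y}$ and $r:\mathbb{R}\to\mathbb{R}^{m_z}$ be sufficiently differentiable, let $g\in\mathbb{R}^{m_z\times m_y}$ be a constant matrix, and consider the index 2 differential-algebraic problem $$y'=f(y,z),\qquad gy=r(t),$$ with consistent initial values $(y_0,z_0)$ at $t_0=0$, i.e. $gy_0=r(t_0)$ and $gf(y_0,z_0)=r'(t_0)$. Let $(y(t),z(t))$ be the exact solution with these initial values, and suppose that $(g f_z(y,z))^{-1}$ exists and is bounded in a neighbourhood of the solution. Let $a_{ij},b_i,c_i$ ($i,j=1,\dots,s$) be the coefficients of an $s$-stage implicit Runge-Kutta scheme of classical order $p$ and stage order $q$ with $p\ge q+1$, having an invertible coefficient matrix $A=(a_{ij})$, with inverse $A^{-1}=(\omega_{ij})$, and satisfying $|R(\infty)|<1$, where $R(\infty)=1-b^TA^{-1}\mathbb{1}$. With step size $h$, $t_n=nh$ and $t_{ni}=t_n+c_ih$, let $(y_n,z_n)$ be generated from $(y_0,z_0)$ by $$y_{n+1}=y_n+\sum_{i,j=1}^s b_i\omega_{ij}(Y_{nj}-y_n),\qquad z_{n+1}=z_n+\sum_{i,j=1}^s b_i\omega_{ij}(Z_{nj}-z_n),$$ where the internal stages $(Y_{ni},Z_{ni})$, $i=1,\dots,s$, are given by $$Y_{ni}=y_n+\sum_{\substack{j,k=1\\ j\ne i}}^s a_{ij}\omega_{jk}(Y_{nk}-y_n)+ha_{ii}f(Y_{ni},Z_{ni}),\qquad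 (1)$$ $$gY_{ni}=r(t_n)+h\sum_{j=1}^s a_{ij}\big(r'(t_{nj})+\theta_j\big),\qquad (2)$$ and where the $\theta_i$ are functions of $t_n$ and $h$ satisfying $$r(t_n+h)=r(t_n)+h\sum_{i=1}^s b_i\big(r'(t_{ni})+\theta_i\big).$$ Suppose that the errors in solving (1) are of $O(h^{p+1})$ (that is, each relation in (1) holds up to an additive error of size $O(h^{p+1})$, while (2) holds exactly). Then, for $h\le h_0$ (with $h_0>0$ sufficiently small), $t_n=nh\le C$ and $\theta_i=O(h^p)$, the global errors satisfy $$y_n-y(t_n)=O(h^p),\qquad z_n-z(t_n)=O(h^{q+1}).$$ If in addition $a_{si}=b_i$ for $i=1,\dots,s$, then the estimate for the $z$-component can be sharpened to $$z_n-z(t_n)=O(h^p).$$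
   Context: $\mathbb{1}$ is the vector in $\mathbb{R}^s$ with all entries one; $b=(b_1,\dots,b_s)^T$; $f_z$ is the partial derivative of $f$ with respect to $z$. Classical order: the scheme has classical order $p$ if, for every sufficiently smooth ODE $y'=f(t,y)$, one step started from the exact value $y_n=y(t_n)$ satisfies $\|y(t_n+h)-y_{n+1}\|\le Ch^{p+1}$. Stage order: the largest $q$ such that both $B(q)$ and $C(q)$ hold, where $B(\xi)$: $\sum_{i=1}^s b_ic_i^{k-1}=\frac1k$ for $k=1,\dots,\xi$; and $C(\xi)$: $\sum_{j=1}^s a_{ij}c_j^{k-1}=\frac{c_i^k}{k}$ for $i=1,\dots,s$, $k=1,\dots,\xi$. The internal stages are understood to be the solution of the stage equations near $(y_n,z_n)$ (for small $h$, $Y_{ni}-y_n=O(h)$ and $Z_{ni}-z_n=O(h)$). All $O(\cdot)$ statements are for $h\to0$ and uniform in $n$ with $nh\le C$, where $C$ is a fixed constant.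
   Formalization: The formal theorem assumes a_ii ≠ 0 for all i (otherwise relation (1) is vacuous and stage i is undetermined) and, for the sharpened z-estimate only, c_i = Σ_j a_ij, which is automatic if q ≥ 1; for q = 0 the sharpened estimate can fail without it. *)

theory Defs
  imports "HOL-Analysis.Analysis"
begin

section \<open>Smoothness\<close>

text \<open>
  \<open>C_k k f\<close>: the map \<open>f\<close> between finite-dimensional spaces is \<open>k\<close> times continuously
  differentiable. Taking one directional derivative at a time keeps the recursion within one type.
\<close>

primrec C_k :: "nat \<Rightarrow> ('a::euclidean_space \<Rightarrow> 'b::real_normed_vector) \<Rightarrow> bool" where
  "C_k 0 f \<longleftrightarrow> continuous_on UNIV f"
| "C_k (Suc k) f \<longleftrightarrow>
     (\<forall>x. f differentiable (at x)) \<and> (\<forall>v. C_k k (\<lambda>x. frechet_derivative f (at x) v))"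

text \<open>
  The order of a Runge-Kutta scheme refers to differential equations of every dimension \<open>d\<close>.
  Since a type cannot be quantified inside a formula, these equations live in the library's
  \<open>Euclidean_space d\<close>, i.e. in the sequences \<open>x :: nat \<Rightarrow> real\<close> with \<open>x i = 0\<close> for \<open>i \<ge> d\<close>.
  \<open>C_k_coords m k W \<phi>\<close> says that the real-valued \<open>\<phi>\<close> has continuous partial derivatives
  up to order \<open>k\<close> on the open set \<open>W\<close> of \<open>Euclidean_space m\<close>.
\<close>

primrec C_k_coords :: "nat \<Rightarrow> nat \<Rightarrow> (nat \<Rightarrow> real) set \<Rightarrow> ((nat \<Rightarrow> real) \<Rightarrow> real) \<Rightarrow> bool" where
  "C_k_coords m 0 W \<phi> \<longleftrightarrow> continuous_map (subtopology (Euclidean_space m) W) euclideanreal \<phi>"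
| "C_k_coords m (Suc k) W \<phi> \<longleftrightarrow>
     continuous_map (subtopology (Euclidean_space m) W) euclideanreal \<phi> \<and>
     (\<forall>i<m. \<exists>\<psi>. (\<forall>x\<in>W. ((\<lambda>s. \<phi> (x(i := s))) has_real_derivative \<psi> x) (at (x i))) \<and>
                 C_k_coords m k W \<psi>)"


section \<open>Runge-Kutta schemes\<close>

text \<open>
  An ordinary differential equation \<open>x' = F (t, x)\<close> of dimension \<open>d\<close>, on an open domain \<open>W\<close> of
  \<open>Euclidean_space (Suc d)\<close>: the pair \<open>(t, x)\<close> is encoded as the sequence \<open>case_nat t x\<close>,
  with the time in coordinate 0.
\<close>

definition ode_solution ::
  "nat \<Rightarrow> (nat \<Rightarrow> real) set \<Rightarrow> ((nat \<Rightarrow> real) \<Rightarrow> nat \<Rightarrow> real) \<Rightarrow> real \<Rightarrow> real \<Rightarrow> (real \<Rightarrow> nat \<Rightarrow> real) \<Rightarrow> bool"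
  where
  "ode_solution d W F t0 t1 x \<longleftrightarrow>
     (\<forall>t\<in>{t0..t1}. x t \<in> topspace (Euclidean_space d) \<and> case_nat t (x t) \<in> W \<and>
        (\<forall>l<d. ((\<lambda>t. x t l) has_real_derivative F (case_nat t (x t)) l) (at t within {t0..t1})))"

definition ode_stages ::
  "real^'s^'s \<Rightarrow> real^'s \<Rightarrow> nat \<Rightarrow> (nat \<Rightarrow> real) set \<Rightarrow> ((nat \<Rightarrow> real) \<Rightarrow> nat \<Rightarrow> real) \<Rightarrow>
   real \<Rightarrow> real \<Rightarrow> (nat \<Rightarrow> real) \<Rightarrow> ('s \<Rightarrow> nat \<Rightarrow> real) \<Rightarrow> bool"
  where
  "ode_stages A c d W F h t x X \<longleftrightarrow>
     (\<forall>i. X i \<in> topspace (Euclidean_space d) \<and> case_nat (t + c $ i * h) (X i) \<in> W \<and>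
        (\<forall>l<d. X i l = x l + h * (\<Sum>j\<in>UNIV. A $ i $ j * F (case_nat (t + c $ j * h) (X j)) l)))"

text \<open>
  Classical order. ``Sufficiently smooth'' means \<open>C\<^sup>k\<close> for some \<open>k\<close> depending only on the scheme.
  The constants may depend on the equation and on the solution, but not on the starting
  time \<open>t\<close> or on \<open>h\<close>. For an implicit scheme the step is the one given by the
  stages near the starting value.
\<close>

definition classical_order :: "real^'s^'s \<Rightarrow> real^'s \<Rightarrow> real^'s \<Rightarrow> nat \<Rightarrow> bool" where
  "classical_order A b c p \<longleftrightarrow>
     (\<exists>k. \<forall>d W F t0 t1 x.
        openin (Euclidean_space (Suc d)) W \<and> (\<forall>l<d. C_k_coords (Suc d) k W (\<lambda>u. F u l)) \<and>
        t0 < t1 \<and> ode_solution d W F t0 t1 x \<longrightarrow>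
        (\<exists>M. \<exists>\<epsilon>>0. \<exists>h0>0. \<forall>t h X.
           0 < h \<and> h \<le> h0 \<and> t0 \<le> t \<and> t + h \<le> t1 \<and> ode_stages A c d W F h t (x t) X \<and>
           (\<forall>i. L2_set (\<lambda>l. X i l - x t l) {..<d} \<le> \<epsilon>) \<longrightarrow>
           L2_set (\<lambda>l. x (t + h) l -
               (x t l + h * (\<Sum>i\<in>UNIV. b $ i * F (case_nat (t + c $ i * h) (X i)) l))) {..<d}
             \<le> M * h ^ (p + 1)))"

definition B_cond :: "real^'s \<Rightarrow> real^'s \<Rightarrow> nat \<Rightarrow> bool" where
  "B_cond b c \<xi> \<longleftrightarrow> (\<forall>k\<in>{1..\<xi>}. (\<Sum>i\<in>UNIV. b $ i * c $ i ^ (k - 1)) = 1 / real k)"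

definition C_cond :: "real^'s^'s \<Rightarrow> real^'s \<Rightarrow> nat \<Rightarrow> bool" where
  "C_cond A c \<xi> \<longleftrightarrow>
     (\<forall>i. \<forall>k\<in>{1..\<xi>}. (\<Sum>j\<in>UNIV. A $ i $ j * c $ j ^ (k - 1)) = c $ i ^ k / real k)"

definition stage_order :: "real^'s^'s \<Rightarrow> real^'s \<Rightarrow> real^'s \<Rightarrow> nat \<Rightarrow> bool" where
  "stage_order A b c q \<longleftrightarrow>
     B_cond b c q \<and> C_cond A c q \<and> (\<forall>q'. B_cond b c q' \<and> C_cond A c q' \<longrightarrow> q' \<le> q)"

definition R_inf :: "real^'s^'s \<Rightarrow> real^'s \<Rightarrow> real" where
  "R_inf A b = 1 - b \<bullet> (matrix_inv A *v vec 1)"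


section \<open>The index 2 problem\<close>

definition dae_solution ::
  "(real^'y \<Rightarrow> real^'z \<Rightarrow> real^'y) \<Rightarrow> real^'y^'z \<Rightarrow> (real \<Rightarrow> real^'z) \<Rightarrow> real \<Rightarrow>
   (real \<Rightarrow> real^'y) \<Rightarrow> (real \<Rightarrow> real^'z) \<Rightarrow> bool"
  where
  "dae_solution f g r C y z \<longleftrightarrow>
     continuous_on {0..C} z \<and>
     (\<forall>t\<in>{0..C}. (y has_vector_derivative f (y t) (z t)) (at t within {0..C}) \<and> g *v y t = r t)"

definition f_z :: "(real^'y \<Rightarrow> real^'z \<Rightarrow> real^'y) \<Rightarrow> real^'y \<Rightarrow> real^'z \<Rightarrow> real^'z^'y" where
  "f_z f u v = matrix (frechet_derivative (\<lambda>w. f u w) (at v))"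

definition index2_near ::
  "(real^'y \<Rightarrow> real^'z \<Rightarrow> real^'y) \<Rightarrow> real^'y^'z \<Rightarrow> real \<Rightarrow>
   (real \<Rightarrow> real^'y) \<Rightarrow> (real \<Rightarrow> real^'z) \<Rightarrow> bool"
  where
  "index2_near f g C y z \<longleftrightarrow>
     (\<exists>U. open U \<and> (\<forall>t\<in>{0..C}. (y t, z t) \<in> U) \<and>
        (\<forall>(u, v)\<in>U. invertible (g ** f_z f u v)) \<and>
        bounded ((\<lambda>(u, v). matrix_inv (g ** f_z f u v)) ` U))"


section \<open>The numerical scheme\<close>

text \<open>
  \<open>Y\<close> and \<open>Z\<close> are the stages of one step of size \<open>h\<close> from \<open>(yn, zn)\<close>. Writing \<open>\<omega>\<close> for the
  inverse of \<open>A\<close>, one has \<open>(\<Sum>j k. A $ i $ j * \<omega> $ j $ k) *\<^sub>R (Y k - yn) = Y i - yn\<close> when all \<open>j\<close> are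
  included, so \<open>stage_residual\<close> equals
  \<open>A $ i $ i *\<^sub>R ((\<Sum>k. \<omega> $ i $ k *\<^sub>R (Y k - yn)) - h *\<^sub>R f (Y i) (Z i))\<close>.
  In particular it vanishes identically, and imposes nothing on the stage, if \<open>A $ i $ i = 0\<close>.
\<close>

definition stage_residual ::
  "real^'s^'s \<Rightarrow> (real^'y \<Rightarrow> real^'z \<Rightarrow> real^'y) \<Rightarrow> real \<Rightarrow> real^'y \<Rightarrow>
   ('s \<Rightarrow> real^'y) \<Rightarrow> ('s \<Rightarrow> real^'z) \<Rightarrow> 's \<Rightarrow> real^'y"
  where
  "stage_residual A f h yn Y Z i =
     Y i - (yn + (\<Sum>j\<in>UNIV - {i}. \<Sum>k\<in>UNIV. (A $ i $ j * matrix_inv A $ j $ k) *\<^sub>R (Y k - yn))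
               + (h * A $ i $ i) *\<^sub>R f (Y i) (Z i))"

definition stage_constraint ::
  "real^'s^'s \<Rightarrow> real^'s \<Rightarrow> real^'y^'z \<Rightarrow> (real \<Rightarrow> real^'z) \<Rightarrow> ('s \<Rightarrow> real^'z) \<Rightarrow>
   real \<Rightarrow> real \<Rightarrow> ('s \<Rightarrow> real^'y) \<Rightarrow> bool"
  where
  "stage_constraint A c g r \<theta> h t Y \<longleftrightarrow>
     (\<forall>i. g *v Y i =
        r t + h *\<^sub>R (\<Sum>j\<in>UNIV. A $ i $ j *\<^sub>R (vector_derivative r (at (t + c $ j * h)) + \<theta> j)))"

definition theta_condition ::
  "real^'s \<Rightarrow> real^'s \<Rightarrow> (real \<Rightarrow> real^'z) \<Rightarrow> ('s \<Rightarrow> real^'z) \<Rightarrow> real \<Rightarrow> real \<Rightarrow> bool"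
  where
  "theta_condition b c r \<theta> h t \<longleftrightarrow>
     r (t + h) =
       r t + h *\<^sub>R (\<Sum>i\<in>UNIV. b $ i *\<^sub>R (vector_derivative r (at (t + c $ i * h)) + \<theta> i))"

definition rk_update :: "real^'s^'s \<Rightarrow> real^'s \<Rightarrow> real^'m \<Rightarrow> ('s \<Rightarrow> real^'m) \<Rightarrow> real^'m" where
  "rk_update A b w W = w + (\<Sum>i\<in>UNIV. \<Sum>j\<in>UNIV. (b $ i * matrix_inv A $ i $ j) *\<^sub>R (W j - w))"

text \<open>
  Pairs \<open>(h, n)\<close> such that \<open>t\<^sub>n = n h \<le> C\<close>, respectively such that the whole step
  from \<open>t\<^sub>n\<close> to \<open>t\<^sub>n + h\<close> lies in \<open>{0..C}\<close>.
\<close>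

definition grid_points :: "real \<Rightarrow> real \<Rightarrow> (real \<times> nat) set" where
  "grid_points C hmax = {(h, n). 0 < h \<and> h \<le> hmax \<and> real n * h \<le> C}"

definition grid_steps :: "real \<Rightarrow> real \<Rightarrow> (real \<times> nat) set" where
  "grid_steps C hmax = {(h, n). 0 < h \<and> h \<le> hmax \<and> real (Suc n) * h \<le> C}"

text \<open>\<open>e h n = O(h\<^sup>k)\<close> for \<open>h \<rightarrow> 0\<close>, uniformly in the \<open>n\<close> with \<open>(h, n) \<in> S\<close>.\<close>

definition unif_bigo ::
  "(real \<times> nat) set \<Rightarrow> nat \<Rightarrow> (real \<Rightarrow> nat \<Rightarrow> 'a::real_normed_vector) \<Rightarrow> bool"
  where
  "unif_bigo S k e \<longleftrightarrow> (\<exists>M. \<exists>h0>0. \<forall>(h, n)\<in>S. h \<le> h0 \<longrightarrow> norm (e h n) \<le> M * h ^ k)"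

end

theory Submission imports Defs begin

text \<open>
  Since \<open>g\<close> is constant, the constraint (2) and the invertibility of \<open>A\<close> force
  \<open>g f(Y\<^sub>i, Z\<^sub>i) = r'(t\<^sub>n\<^sub>i) + O(h\<^sup>p)\<close> at every stage. As \<open>g f\<^sub>z\<close> is invertible near the solution,
  the equation \<open>g f(u, v) = r'(t) + \<epsilon>\<close> can be solved for \<open>v = \<Psi>(t, u, \<epsilon>)\<close> with \<open>\<Psi>\<close> smooth. Hence the
  \<open>y\<close>-component is the Runge-Kutta method, perturbed by \<open>O(h\<^sup>p)\<close>, applied to the ordinary differential
  equation \<open>y' = f(y, \<Psi>(t, y, 0))\<close>, for which the classical order gives convergence of order \<open>p\<close>.
  The stages satisfy \<open>Z\<^sub>n\<^sub>i = z(t\<^sub>n\<^sub>i) + O(h\<^sup>q\<^sup>+\<^sup>1)\<close> by \<open>C(q)\<close>, and the recursion for \<open>z\<^sub>n\<close>, whose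
  consistency error is \<open>O(h\<^sup>q\<^sup>+\<^sup>1)\<close> by \<open>B(q)\<close> and \<open>C(q)\<close>, contracts with factor \<open>|R(\<infinity>)| < 1\<close>. Both
  estimates are carried along simultaneously, which keeps the numerical solution in the neighbourhood
  where \<open>\<Psi>\<close> is defined. If \<open>a\<^sub>s\<^sub>i = b\<^sub>i\<close>, then \<open>z\<^sub>n\<^sub>+\<^sub>1 = Z\<^sub>n\<^sub>s = \<Psi>(t\<^sub>n\<^sub>+\<^sub>1, y\<^sub>n\<^sub>+\<^sub>1, O(h\<^sup>p))\<close>.
\<close>


section \<open>Local smoothness\<close>

text \<open>\<open>\<Psi>\<close> exists only near the solution, so smoothness is needed on open
  sets, and the local inverses must be glued along the whole compact solution curve; injectivity on
  the curve itself is immediate because its points carry the time. The powers of h balance as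
  follows: the residual of (1) is \<open>A $ i $ i\<close> times the gap between a stage increment
  and \<open>h\<close> times \<open>f\<close>. Dividing O(h^(p+1)) by \<open>h\<close> and by the
  nonzero diagonal entry leaves a perturbation of \<open>f\<close> of size O(h^p); the step
  multiplies it by \<open>h\<close> again, so the local error keeps order p+1. The condition on the
  \<theta>_i preserves g y_n = r(t_n), which is what turns (2) into a statement about the
  increments. Finally, classical order speaks only of exact stages started on the solution. Such
  stages are first constructed by a fixed-point argument and then compared with the perturbed
  ones.\<close>

primrec Ck_on :: "nat \<Rightarrow> 'a::euclidean_space set \<Rightarrow> ('a \<Rightarrow> 'b::real_normed_vector) \<Rightarrow> bool" where
  "Ck_on 0 S f \<longleftrightarrow> continuous_on S f"
| "Ck_on (Suc k) S f \<longleftrightarrow>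
     (\<exists>f'. (\<forall>x\<in>S. (f has_derivative f' x) (at x)) \<and> (\<forall>v. Ck_on k S (\<lambda>x. f' x v)))"

lemma Ck_on_SucI:
  assumes "\<And>x. x \<in> S \<Longrightarrow> (f has_derivative f' x) (at x)" "\<And>v. Ck_on k S (\<lambda>x. f' x v)"
  shows "Ck_on (Suc k) S f"
  unfolding Ck_on.simps using assms by blast

lemma Ck_on_SucE:
  assumes "Ck_on (Suc k) S f"
  obtains f' where "\<And>x. x \<in> S \<Longrightarrow> (f has_derivative f' x) (at x)" "\<And>v. Ck_on k S (\<lambda>x. f' x v)"
  using assms unfolding Ck_on.simps by blast

lemma C_k_imp_Ck_on: "C_k k f \<Longrightarrow> Ck_on k UNIV f"
proof (induction k arbitrary: f)
  case (Suc k)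
  then show ?case
    by (intro Ck_on_SucI[of _ _ "\<lambda>x. frechet_derivative f (at x)"])
      (auto simp: frechet_derivative_works)
qed auto

lemma Ck_on_SucD: "Ck_on (Suc k) S f \<Longrightarrow> Ck_on k S f"
proof (induction k arbitrary: f)
  case 0
  then show ?case
    by (metis Ck_on.simps has_derivative_at_withinI has_derivative_continuous_on)
next
  case (Suc k)
  then show ?case by (metis Ck_on.simps(2))
qed

lemma Ck_on_le: "Ck_on k S f \<Longrightarrow> m \<le> k \<Longrightarrow> Ck_on m S f"
proof (induction k)
  case (Suc k)
  then show ?case using Ck_on_SucD le_Suc_eq by blast
qed auto

lemma Ck_on_continuous: "Ck_on k S f \<Longrightarrow> continuous_on S f"
  using Ck_on_le[of k S f 0] by simp

lemma Ck_on_subset: "Ck_on k S f \<Longrightarrow> T \<subseteq> S \<Longrightarrow> Ck_on k T f"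
proof (induction k arbitrary: f)
  case 0 then show ?case by (simp add: continuous_on_subset)
next
  case (Suc k)
  from Suc.prems obtain f' where "\<And>x. x \<in> S \<Longrightarrow> (f has_derivative f' x) (at x)"
    "\<And>v. Ck_on k S (\<lambda>x. f' x v)" by (elim Ck_on_SucE) (rule that; assumption)
  with Suc show ?case by (intro Ck_on_SucI[of _ _ f']) auto
qed

text \<open>Derivatives are taken at a point, not within \<open>S\<close>; agreement on
  \<open>S\<close> passes to them only because \<open>S\<close> is a neighbourhood of each of its
  points.\<close>

lemma Ck_on_cong:
  assumes "open S" "\<And>x. x \<in> S \<Longrightarrow> f x = g x" "Ck_on k S f"
  shows "Ck_on k S g"
proof (cases k)
  case 0
  then show ?thesis using assms(3) continuous_on_cong[of S S f g] assms(2) by simp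
next
  case (Suc m)
  with assms(3) obtain f' where f': "\<And>x. x \<in> S \<Longrightarrow> (f has_derivative f' x) (at x)"
    "\<And>v. Ck_on m S (\<lambda>x. f' x v)" unfolding Suc by (elim Ck_on_SucE) (rule that; assumption)
  have "(g has_derivative f' x) (at x)" if "x \<in> S" for x
    using has_derivative_transform_within_open[OF f'(1)[OF that] assms(1) that] assms(2) by blast
  then show ?thesis unfolding Suc using f'(2) by (rule Ck_on_SucI)
qed

lemma Ck_on_const: "Ck_on k S (\<lambda>x. c)"
proof (induction k arbitrary: c)
  case (Suc k)
  then show ?case by (intro Ck_on_SucI[of _ _ "\<lambda>x v. 0"]) auto
qed auto

lemma Ck_on_add: "Ck_on k S f \<Longrightarrow> Ck_on k S g \<Longrightarrow> Ck_on k S (\<lambda>x. f x + g x)"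
proof (induction k arbitrary: f g)
  case 0 then show ?case by (simp add: continuous_on_add)
next
  case (Suc k)
  from Suc.prems obtain f' g' where f': "\<And>x. x \<in> S \<Longrightarrow> (f has_derivative f' x) (at x)"
    "\<And>v. Ck_on k S (\<lambda>x. f' x v)" and g': "\<And>x. x \<in> S \<Longrightarrow> (g has_derivative g' x) (at x)"
    "\<And>v. Ck_on k S (\<lambda>x. g' x v)" by (elim Ck_on_SucE) (rule that; assumption)
  show ?case
    by (rule Ck_on_SucI[of _ _ "\<lambda>x v. f' x v + g' x v"])
      (auto intro!: has_derivative_add f' g' Suc.IH)
qed

lemma Ck_on_sum: "(\<And>i. i \<in> I \<Longrightarrow> Ck_on k S (f i)) \<Longrightarrow> Ck_on k S (\<lambda>x. \<Sum>i\<in>I. f i x)"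
  by (induction I rule: infinite_finite_induct) (auto intro: Ck_on_const Ck_on_add)

lemma Ck_on_linear:
  assumes "bounded_linear l" "Ck_on k S f"
  shows "Ck_on k S (\<lambda>x. l (f x))"
  using assms(2)
proof (induction k arbitrary: f)
  case 0 then show ?case by (simp add: bounded_linear.continuous_on[OF assms(1)])
next
  case (Suc k)
  then obtain f' where f': "\<And>x. x \<in> S \<Longrightarrow> (f has_derivative f' x) (at x)"
    "\<And>v. Ck_on k S (\<lambda>x. f' x v)" by (elim Ck_on_SucE) (rule that; assumption)
  show ?case
    by (rule Ck_on_SucI[of _ _ "\<lambda>x v. l (f' x v)"])
      (auto intro!: bounded_linear.has_derivative[OF assms(1)] f' Suc.IH)
qed

lemma Ck_on_id: "Ck_on k S (\<lambda>x. x)"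
proof (cases k)
  case (Suc m)
  have "Ck_on (Suc m) S (\<lambda>x. x)"
    by (rule Ck_on_SucI[of _ _ "\<lambda>x v. v"]) (auto intro: Ck_on_const)
  then show ?thesis using Suc by simp
qed auto

lemma Ck_on_bounded_linear: "bounded_linear l \<Longrightarrow> Ck_on k S l"
  using Ck_on_linear[OF _ Ck_on_id] .

lemma Ck_on_minus: "Ck_on k S f \<Longrightarrow> Ck_on k S (\<lambda>x. - f x)"
  by (rule Ck_on_linear[OF bounded_linear_minus[OF bounded_linear_ident]])

lemma Ck_on_diff: "Ck_on k S f \<Longrightarrow> Ck_on k S g \<Longrightarrow> Ck_on k S (\<lambda>x. f x - g x)"
  using Ck_on_add[OF _ Ck_on_minus, of k S f g] by simp

lemma Ck_on_bilinear:
  assumes "bounded_bilinear B" "Ck_on k S f" "Ck_on k S g"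
  shows "Ck_on k S (\<lambda>x. B (f x) (g x))"
  using assms(2,3)
proof (induction k arbitrary: f g)
  case 0 then show ?case by (simp add: bounded_bilinear.continuous_on[OF assms(1)])
next
  case (Suc k)
  from Suc.prems obtain f' g' where f': "\<And>x. x \<in> S \<Longrightarrow> (f has_derivative f' x) (at x)"
    "\<And>v. Ck_on k S (\<lambda>x. f' x v)" and g': "\<And>x. x \<in> S \<Longrightarrow> (g has_derivative g' x) (at x)"
    "\<And>v. Ck_on k S (\<lambda>x. g' x v)" by (elim Ck_on_SucE) (rule that; assumption)
  show ?case
    by (rule Ck_on_SucI[of _ _ "\<lambda>x v. B (f x) (g' x v) + B (f' x v) (g x)"])
      (auto intro!: bounded_bilinear.FDERIV[OF assms(1)] f' g' Suc.IH Ck_on_add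
        Ck_on_SucD[OF Suc.prems(1)] Ck_on_SucD[OF Suc.prems(2)])
qed

lemmas Ck_on_mult = Ck_on_bilinear[OF bounded_bilinear_mult]
lemmas Ck_on_scaleR = Ck_on_bilinear[OF bounded_bilinear_scaleR]

lemma Ck_on_prod:
  fixes f :: "'i \<Rightarrow> 'a::euclidean_space \<Rightarrow> real"
  shows "(\<And>i. i \<in> I \<Longrightarrow> Ck_on k S (f i)) \<Longrightarrow> Ck_on k S (\<lambda>x. \<Prod>i\<in>I. f i x)"
  by (induction I rule: infinite_finite_induct) (auto intro: Ck_on_const Ck_on_mult)

lemma Ck_on_Pair: "Ck_on k S f \<Longrightarrow> Ck_on k S g \<Longrightarrow> Ck_on k S (\<lambda>x. (f x, g x))"
proof (induction k arbitrary: f g)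
  case 0 then show ?case by (simp add: continuous_on_Pair)
next
  case (Suc k)
  from Suc.prems obtain f' g' where f': "\<And>x. x \<in> S \<Longrightarrow> (f has_derivative f' x) (at x)"
    "\<And>v. Ck_on k S (\<lambda>x. f' x v)" and g': "\<And>x. x \<in> S \<Longrightarrow> (g has_derivative g' x) (at x)"
    "\<And>v. Ck_on k S (\<lambda>x. g' x v)" by (elim Ck_on_SucE) (rule that; assumption)
  show ?case
    by (rule Ck_on_SucI[of _ _ "\<lambda>x v. (f' x v, g' x v)"])
      (auto intro!: has_derivative_Pair f' g' Suc.IH)
qed

text \<open>In the chain rule the direction \<open>f' x v\<close> moves with \<open>x\<close>,
  whereas the regularity of \<open>g'\<close> is known for fixed directions only. Expanding the
  direction in \<open>Basis\<close> gives a finite sum of products to which the induction hypothesis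
  applies.\<close>

lemma Ck_on_compose:
  fixes g :: "'b::euclidean_space \<Rightarrow> 'c::real_normed_vector"
  assumes "Ck_on k T g" "Ck_on k S f" "f ` S \<subseteq> T"
  shows "Ck_on k S (\<lambda>x. g (f x))"
  using assms
proof (induction k arbitrary: f g)
  case 0 then show ?case unfolding Ck_on.simps by (rule continuous_on_compose2)
next
  case (Suc k)
  from Suc.prems obtain f' g' where f': "\<And>x. x \<in> S \<Longrightarrow> (f has_derivative f' x) (at x)"
    "\<And>v. Ck_on k S (\<lambda>x. f' x v)" and g': "\<And>x. x \<in> T \<Longrightarrow> (g has_derivative g' x) (at x)"
    "\<And>v. Ck_on k T (\<lambda>x. g' x v)" by (elim Ck_on_SucE) (rule that; assumption)
  show ?case
  proof (rule Ck_on_SucI[of _ _ "\<lambda>x v. \<Sum>b\<in>Basis. (f' x v \<bullet> b) *\<^sub>R g' (f x) b"])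
    fix x assume x: "x \<in> S"
    then have fx: "f x \<in> T" using Suc.prems by auto
    have D: "((\<lambda>x. g (f x)) has_derivative (\<lambda>v. g' (f x) (f' x v))) (at x)"
      using has_derivative_compose[OF f'(1)[OF x] g'(1)[OF fx]] .
    have rep: "g' (f x) w = (\<Sum>b\<in>Basis. (w \<bullet> b) *\<^sub>R g' (f x) b)" for w
    proof -
      interpret linear "g' (f x)" using has_derivative_linear[OF g'(1)[OF fx]] .
      have "g' (f x) w = g' (f x) (\<Sum>b\<in>Basis. (w \<bullet> b) *\<^sub>R b)" by (simp add: euclidean_representation)
      also have "\<dots> = (\<Sum>b\<in>Basis. (w \<bullet> b) *\<^sub>R g' (f x) b)" by (simp add: sum scale)
      finally show ?thesis .
    qed
    have "(\<lambda>v. g' (f x) (f' x v)) = (\<lambda>v. \<Sum>b\<in>Basis. (f' x v \<bullet> b) *\<^sub>R g' (f x) b)"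
      by (intro ext rep)
    from D[unfolded this] show "((\<lambda>x. g (f x)) has_derivative
        (\<lambda>v. \<Sum>b\<in>Basis. (f' x v \<bullet> b) *\<^sub>R g' (f x) b)) (at x)" .
  next
    fix v
    show "Ck_on k S (\<lambda>x. \<Sum>b\<in>Basis. (f' x v \<bullet> b) *\<^sub>R g' (f x) b)"
      by (intro Ck_on_sum Ck_on_scaleR Ck_on_linear[OF bounded_linear_inner_left] f'(2)
          Suc.IH g'(2) Ck_on_SucD[OF Suc.prems(2)] Suc.prems(3))
  qed
qed

text \<open>The derivative of \<open>inverse\<close> is a product of copies of
  \<open>inverse\<close> and a constant, so each order follows from the one before.\<close>

lemma Ck_on_inverse: "Ck_on k (- {0::real}) inverse"
proof (induction k)
  case 0 then show ?case by (simp add: continuous_on_inverse continuous_on_id)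
next
  case (Suc k)
  show ?case
  proof (rule Ck_on_SucI[of _ _ "\<lambda>x v. - (inverse x * v * inverse x)"])
    fix x :: real assume "x \<in> - {0}"
    then show "(inverse has_derivative (\<lambda>v. - (inverse x * v * inverse x))) (at x)"
      by (intro has_derivative_inverse') auto
  next
    fix v show "Ck_on k (- {0}) (\<lambda>x::real. - (inverse x * v * inverse x))"
      by (intro Ck_on_minus Ck_on_mult Suc Ck_on_const)
  qed
qed

lemma Ck_on_vec:
  fixes f :: "'a::euclidean_space \<Rightarrow> real ^ 'n"
  assumes "\<And>i. Ck_on k S (\<lambda>x. f x $ i)"
  shows "Ck_on k S f"
proof -
  have "f = (\<lambda>x. \<Sum>i\<in>UNIV. f x $ i *\<^sub>R axis i 1)"
    by (auto simp: vec_eq_iff axis_def if_distrib cong: if_cong)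
  moreover have "Ck_on k S (\<lambda>x. \<Sum>i\<in>UNIV. f x $ i *\<^sub>R (axis i 1 :: real^'n))"
    by (intro Ck_on_sum Ck_on_scaleR assms Ck_on_const)
  ultimately show ?thesis by simp
qed

lemma Ck_on_vec_nth: "Ck_on k S f \<Longrightarrow> Ck_on k S (\<lambda>x. f x $ i)"
  by (rule Ck_on_linear[OF bounded_linear_vec_nth])

lemma Ck_on_det:
  fixes M :: "'a::euclidean_space \<Rightarrow> real ^ 'n ^ 'n"
  assumes "\<And>i j. Ck_on k S (\<lambda>x. M x $ i $ j)"
  shows "Ck_on k S (\<lambda>x. det (M x))"
  unfolding det_def by (intro Ck_on_sum Ck_on_mult Ck_on_const Ck_on_prod assms)

section \<open>Matrix inverses and Cramer's rule\<close>

lemma matrix_inv_right: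
  fixes A :: "real^'n^'n" assumes "invertible A" shows "A ** matrix_inv A = mat 1"
  using assms unfolding invertible_def matrix_inv_def by (rule someI2_ex) blast

lemma matrix_inv_left:
  fixes A :: "real^'n^'n" assumes "invertible A" shows "matrix_inv A ** A = mat 1"
  using assms unfolding invertible_def matrix_inv_def by (rule someI2_ex) blast

text \<open>\<open>matrix_inv\<close> is given by a choice operator, which says nothing about its
  dependence on the matrix. Cramer's rule replaces it by quotients of determinants, hence by
  polynomials in the entries and one reciprocal.\<close>

lemma Ck_on_matrix_inv_mult:
  fixes M :: "'a::euclidean_space \<Rightarrow> real ^ 'n ^ 'n"
  assumes M: "\<And>i j. Ck_on k S (\<lambda>x. M x $ i $ j)" and w: "Ck_on k S w"
    and inv: "\<And>x. x \<in> S \<Longrightarrow> invertible (M x)" and S: "open S"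
  shows "Ck_on k S (\<lambda>x. matrix_inv (M x) *v w x)"
proof (rule Ck_on_cong[OF S])
  let ?u = "\<lambda>x. \<chi> l. det (\<chi> i j. if j = l then w x $ i else M x $ i $ j) * inverse (det (M x))"
  fix x assume x: "x \<in> S"
  have "M x *v (matrix_inv (M x) *v w x) = w x"
    by (simp add: matrix_vector_mul_assoc matrix_inv_right inv x)
  then show "?u x = matrix_inv (M x) *v w x"
    using cramer[of "M x" _ "w x"] inv[OF x] by (simp add: invertible_det_nz divide_inverse)
next
  have "Ck_on k S (\<lambda>x. inverse (det (M x)))"
    by (rule Ck_on_compose[OF Ck_on_inverse Ck_on_det[OF M]]) (use inv in \<open>auto simp: invertible_det_nz\<close>)
  moreover have "Ck_on k S (\<lambda>x. if j = l then w x $ i else M x $ i $ j)" for i j l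
    using M[of i j] Ck_on_vec_nth[OF w, of i] by (cases "j = l") auto
  ultimately show "Ck_on k S (\<lambda>x. \<chi> l. det (\<chi> i j. if j = l then w x $ i else M x $ i $ j)
      * inverse (det (M x)))"
    by (intro Ck_on_vec) (simp add: Ck_on_mult Ck_on_det)
qed


section \<open>Implicit functions near a compact set\<close>

text \<open>The mean value inequality needs convexity, so the Lipschitz bound is claimed inside each
  ball around a point of \<open>K\<close>; compactness makes the radius and the constant common to
  all these balls.\<close>

lemma Ck_on_Lipschitz_near_compact:
  fixes \<phi> :: "'a::euclidean_space \<Rightarrow> 'b::real_normed_vector"
  assumes S: "open S" and \<phi>: "Ck_on (Suc 0) S \<phi>" and K: "compact K" "K \<subseteq> S"
  obtains d M where "d > 0" "M \<ge> 0" "\<And>x. x \<in> K \<Longrightarrow> cball x d \<subseteq> S"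
    "\<And>x a b. x \<in> K \<Longrightarrow> a \<in> cball x d \<Longrightarrow> b \<in> cball x d \<Longrightarrow> norm (\<phi> a - \<phi> b) \<le> M * norm (a - b)"
proof -
  obtain d where d: "d > 0" "(\<Union>x\<in>K. cball x d) \<subseteq> S"
    using compact_subset_open_imp_cball_epsilon_subset[OF K(1) S K(2)] by auto
  define K' where "K' = (\<Union>x\<in>K. cball x d)"
  have K': "compact K'" unfolding K'_def by (rule compact_minkowski_sum_cball[OF K(1)])
  obtain f' where f': "\<And>x. x \<in> S \<Longrightarrow> (\<phi> has_derivative f' x) (at x)"
    "\<And>v. Ck_on 0 S (\<lambda>x. f' x v)" using \<phi> by (rule Ck_on_SucE) blast
  have K'S: "K' \<subseteq> S" using d(2) K'_def by simp
  have "continuous_on K' (\<lambda>x. \<Sum>b\<in>Basis. norm (f' x b))"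
    using f'(2) by (intro continuous_on_sum continuous_on_norm continuous_on_subset[OF _ K'S]) simp
  then have "bounded ((\<lambda>x. \<Sum>b\<in>Basis. norm (f' x b)) ` K')"
    by (intro compact_imp_bounded compact_continuous_image K')
  then obtain M where M: "M > 0" "\<And>x. x \<in> K' \<Longrightarrow> norm (\<Sum>b\<in>Basis. norm (f' x b)) \<le> M"
    unfolding bounded_pos by auto
  have "norm (\<phi> a - \<phi> b) \<le> M * norm (a - b)" if x: "x \<in> K" "a \<in> cball x d" "b \<in> cball x d" for x a b
  proof (rule differentiable_bound[OF convex_cball _ _ x(2,3)])
    fix u assume "u \<in> cball x d"
    then have u: "u \<in> K'" using x(1) K'_def by auto
    then have D: "(\<phi> has_derivative f' u) (at u)" using f'(1) K'S by auto
    then show "(\<phi> has_derivative f' u) (at u within cball x d)" by (rule has_derivative_at_withinI)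
    \<comment> \<open>\<open>Ck_on\<close> gives continuity of each directional derivative
      separately, so the operator norm is controlled through the basis directions.\<close>
    have "onorm (f' u) \<le> (\<Sum>b\<in>Basis. norm (f' u b))"
      by (rule onorm_componentwise[OF has_derivative_bounded_linear[OF D]])
    also have "\<dots> \<le> M" using M(2)[OF u] by simp
    finally show "onorm (f' u) \<le> M" .
  qed
  then show thesis using that[of d M] d M(1) by (auto simp: SUP_le_iff)
qed

text \<open>A pair of nearby points is separated by local injectivity, a pair far apart by
  continuity and injectivity on \<open>K\<close>. Compactness of \<open>K \<times> K\<close> makes
  both cases uniform.\<close>

lemma inj_on_near_compact:
  fixes \<Phi> :: "'a::euclidean_space \<Rightarrow> 'b::real_normed_vector"
  assumes V: "open V" "continuous_on V \<Phi>" and K: "compact K" "K \<subseteq> V" "inj_on \<Phi> K"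
    and loc: "\<And>x. x \<in> K \<Longrightarrow> \<exists>r>0. ball x r \<subseteq> V \<and> inj_on \<Phi> (ball x r)"
  obtains W where "open W" "K \<subseteq> W" "W \<subseteq> V" "inj_on \<Phi> W"
proof -
  \<comment> \<open>The members of \<open>G\<close> are open sets of pairs on which
    \<open>\<Phi>\<close> takes equal values only on the diagonal; they cover
    \<open>K \<times> K\<close>.\<close>
  define G where "G = {G. open G \<and> G \<subseteq> V \<times> V \<and> (\<forall>a b. (a, b) \<in> G \<longrightarrow> \<Phi> a = \<Phi> b \<longrightarrow> a = b)}"
  have "\<exists>X\<in>G. (\<alpha>, \<beta>) \<in> X" if ab: "\<alpha> \<in> K" "\<beta> \<in> K" for \<alpha> \<beta>
  proof (cases "\<alpha> = \<beta>")
    case True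
    obtain r where r: "r > 0" "ball \<alpha> r \<subseteq> V" "inj_on \<Phi> (ball \<alpha> r)" using loc ab by blast
    have "ball \<alpha> r \<times> ball \<alpha> r \<in> G"
      unfolding G_def using r(2) inj_onD[OF r(3)] by (auto intro: open_Times)
    then show ?thesis using r(1) True by (intro bexI[of _ "ball \<alpha> r \<times> ball \<alpha> r"]) auto
  next
    case False
    let ?X = "V \<times> V \<inter> (\<lambda>x. \<Phi> (fst x) - \<Phi> (snd x)) -` (- {0})"
    have "continuous_on (V \<times> V) (\<lambda>x. \<Phi> (fst x) - \<Phi> (snd x))"
      by (intro continuous_on_diff continuous_on_compose2[OF V(2)] continuous_on_fst
          continuous_on_snd continuous_on_id) auto
    then have "open ?X" by (rule continuous_open_preimage) (auto intro: open_Times V)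
    then have "?X \<in> G" unfolding G_def by auto
    moreover have "(\<alpha>, \<beta>) \<in> ?X" using ab K(2) inj_onD[OF K(3)] False by auto
    ultimately show ?thesis by (rule bexI[rotated])
  qed
  then have "K \<times> K \<subseteq> \<Union> G" by blast
  then obtain e where e: "e > 0" "\<And>x. x \<in> K \<times> K \<Longrightarrow> \<exists>X\<in>G. ball x e \<subseteq> X"
    using Heine_Borel_lemma[OF compact_Times[OF K(1) K(1)]] unfolding G_def by blast
  \<comment> \<open>\<open>e\<close> is a Lebesgue number of the cover. Two coordinates each within
    \<open>e / 2\<close> of \<open>K\<close> form a pair within \<open>e\<close> of
    \<open>K \<times> K\<close>, hence inside one member of \<open>G\<close>.\<close>
  define W where "W = (\<Union>x\<in>K. ball x (e / 2)) \<inter> V"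
  show thesis
  proof
    show "open W" unfolding W_def using V by auto
    show "K \<subseteq> W" using e(1) K(2) by (auto simp: W_def intro!: bexI)
    show "W \<subseteq> V" by (auto simp: W_def)
    show "inj_on \<Phi> W"
    proof (rule inj_onI)
      fix a b assume "a \<in> W" "b \<in> W" and eq: "\<Phi> a = \<Phi> b"
      then obtain \<alpha> \<beta> where ab: "\<alpha> \<in> K" "\<beta> \<in> K" "dist \<alpha> a < e / 2" "dist \<beta> b < e / 2"
        by (auto simp: W_def)
      have "dist (\<alpha>, \<beta>) (a, b) \<le> dist \<alpha> a + dist \<beta> b"
        by (simp add: dist_Pair_Pair sqrt_sum_squares_le_sum)
      then have "(a, b) \<in> ball (\<alpha>, \<beta>) e" using ab by simp
      then show "a = b" using e(2)[of "(\<alpha>, \<beta>)"] ab eq unfolding G_def by blast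
    qed
  qed
qed

text \<open>Keeping the parameter as first component turns the implicit equation into inversion of a
  map between spaces of equal dimension. The inverse is wanted on one neighbourhood of all of
  \<open>K\<close>, so local inversion is combined with \<open>inj_on_near_compact\<close>.\<close>

lemma Ck_on_implicit_function:
  fixes H :: "'p::euclidean_space \<times> (real^'z) \<Rightarrow> real^'z"
  assumes V: "open V" and der: "\<And>x. x \<in> V \<Longrightarrow> (H has_derivative H' x) (at x)"
    and smooth: "\<And>v. Ck_on k V (\<lambda>x. H' x v)"
    and inv: "\<And>x. x \<in> V \<Longrightarrow> invertible (matrix (\<lambda>w. H' x (0, w)))"
    and K: "compact K" "K \<subseteq> V" "inj_on (\<lambda>x. (fst x, H x)) K"
  obtains W \<Psi> where "open W" "K \<subseteq> W" "W \<subseteq> V" "open ((\<lambda>x. (fst x, H x)) ` W)"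
    "Ck_on (Suc k) ((\<lambda>x. (fst x, H x)) ` W) \<Psi>" "\<And>x. x \<in> W \<Longrightarrow> \<Psi> (fst x, H x) = x"
proof -
  define \<Phi> where "\<Phi> = (\<lambda>x. (fst x, H x))"
  define \<Phi>' where "\<Phi>' = (\<lambda>x v. (fst v, H' x v))"
  define J where "J = (\<lambda>x. matrix (\<lambda>w. H' x (0, w)))"
  \<comment> \<open>The derivative \<open>\<Phi>'\<close> is block triangular; \<open>L\<close> is
    its explicit inverse, obtained by solving the second block for the last component.\<close>
  define L where "L = (\<lambda>x (v :: 'p \<times> (real^'z)). (fst v, matrix_inv (J x) *v (snd v - H' x (fst v, 0))))"
  have lin: "linear (H' x)" if "x \<in> V" for x using der[OF that] has_derivative_linear by blast
  have split: "H' x (u, w) = H' x (u, 0) + H' x (0, w)" if "x \<in> V" for x u w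
    using linear_add[OF lin[OF that], of "(u, 0)" "(0, w)"] by simp
  have J: "J x *v w = H' x (0, w)" if "x \<in> V" for x w
  proof -
    have "linear (\<lambda>w. H' x (0, w))"
      using linear_compose[OF _ lin[OF that], of "\<lambda>w. (0, w)"]
      by (simp add: o_def linear_iff)
    then show ?thesis unfolding J_def by (simp add: matrix_works)
  qed
  have invJ: "invertible (J x)" if "x \<in> V" for x using inv[OF that] by (simp add: J_def)
  have der\<Phi>: "(\<Phi> has_derivative \<Phi>' x) (at x)" if "x \<in> V" for x
    unfolding \<Phi>_def \<Phi>'_def by (intro has_derivative_Pair has_derivative_fst has_derivative_ident der that)
  have "\<Phi>' x (L x v) = v" if "x \<in> V" for x v
  proof -
    have "H' x (fst v, matrix_inv (J x) *v (snd v - H' x (fst v, 0)))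
        = H' x (fst v, 0) + J x *v (matrix_inv (J x) *v (snd v - H' x (fst v, 0)))"
      unfolding J[OF that] by (rule split[OF that])
    also have "\<dots> = snd v"
      using invJ[OF that]
      by (simp add: matrix_vector_mul_assoc matrix_inv_right)
    finally show ?thesis by (simp add: \<Phi>'_def L_def)
  qed
  then have \<Phi>L: "\<Phi>' x \<circ> L x = id" if "x \<in> V" for x using that by (auto simp: o_def)
  have "L x (\<Phi>' x v) = v" if "x \<in> V" for x v
  proof -
    have "H' x v - H' x (fst v, 0) = J x *v snd v"
      using split[OF that, of "fst v" "snd v"] J[OF that] by simp
    then show ?thesis
      using invJ[OF that]
      by (simp add: \<Phi>'_def L_def matrix_vector_mul_assoc matrix_inv_left)
  qed
  then have L\<Phi>: "L x \<circ> \<Phi>' x = id" if "x \<in> V" for x using that by (auto simp: o_def)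
  have L_smooth: "Ck_on k V (\<lambda>x. L x v)" for v
    unfolding L_def
  proof (intro Ck_on_Pair Ck_on_const Ck_on_matrix_inv_mult Ck_on_diff smooth V)
    show "Ck_on k V (\<lambda>x. J x $ i $ j)" for i j
      unfolding J_def matrix_def using Ck_on_vec_nth[OF smooth] by simp
    show "invertible (J x)" if "x \<in> V" for x using invJ[OF that] .
  qed
  have \<Phi>'_cont: "continuous_on V (\<lambda>x. \<Phi>' x v)" for v
    unfolding \<Phi>'_def by (intro continuous_on_Pair continuous_on_const Ck_on_continuous[OF smooth])
  have cont: "continuous_on V \<Phi>"
    by (rule has_derivative_continuous_on[OF has_derivative_at_withinI[OF der\<Phi>]])
  have loc: "\<exists>r>0. ball a r \<subseteq> V \<and> inj_on \<Phi> (ball a r)" if a: "a \<in> V" for a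
  proof -
    \<comment> \<open>The criterion for local injectivity asks for continuity of the derivative in
      operator norm, which follows from continuity in the finitely many basis directions.\<close>
    have onorm_lt: "\<exists>d>0. \<forall>x. dist a x < d \<longrightarrow> onorm (\<lambda>v. \<Phi>' x v - \<Phi>' a v) < e" if e: "e > 0" for e
    proof -
      have "continuous_on V (\<lambda>x. \<Sum>b\<in>Basis. norm (\<Phi>' x b - \<Phi>' a b))"
        by (intro continuous_intros \<Phi>'_cont)
      then have "isCont (\<lambda>x. \<Sum>b\<in>Basis. norm (\<Phi>' x b - \<Phi>' a b)) a"
        using V a continuous_on_eq_continuous_at by blast
      then obtain d1 where d1: "d1 > 0"
        "\<And>x. dist x a < d1 \<Longrightarrow> (\<Sum>b\<in>Basis. norm (\<Phi>' x b - \<Phi>' a b)) < e"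
        using e unfolding continuous_at_eps_delta by (fastforce simp: dist_real_def sum_nonneg)
      obtain d2 where d2: "d2 > 0" "ball a d2 \<subseteq> V" using V a open_contains_ball by blast
      have "onorm (\<lambda>v. \<Phi>' x v - \<Phi>' a v) < e" if x: "dist a x < min d1 d2" for x
      proof -
        have "x \<in> V" using x d2 by auto
        then have "bounded_linear (\<lambda>v. \<Phi>' x v - \<Phi>' a v)"
          by (intro bounded_linear_sub has_derivative_bounded_linear[OF der\<Phi>] a)
        then show ?thesis using onorm_componentwise[of "\<lambda>v. \<Phi>' x v - \<Phi>' a v"] d1(2)[of x] x
          by (simp add: dist_commute)
      qed
      then show ?thesis using d1(1) d2(1) by (intro exI[of _ "min d1 d2"]) auto
    qed
    have blL: "bounded_linear (L a)"
      using left_inverse_linear right_inverse_linear[OF has_derivative_linear[OF der\<Phi>[OF a]] \<Phi>L[OF a]]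
        linear_conv_bounded_linear by blast
    show ?thesis
      using has_derivative_locally_injective[OF a V blL L\<Phi>[OF a] der\<Phi> onorm_lt] by metis
  qed
  obtain W where W: "open W" "K \<subseteq> W" "W \<subseteq> V" "inj_on \<Phi> W"
  proof (rule inj_on_near_compact[OF V cont K(1,2)])
    show "inj_on \<Phi> K" using K(3) by (simp add: \<Phi>_def)
    show "\<exists>r>0. ball x r \<subseteq> V \<and> inj_on \<Phi> (ball x r)" if "x \<in> K" for x
      by (rule loc[OF subsetD[OF K(2) that]])
  qed
  have contW: "continuous_on W \<Phi>" using cont W(3) continuous_on_subset by blast
  define \<Psi> where "\<Psi> = inv_into W \<Phi>"
  have \<Psi>: "\<Psi> (\<Phi> x) = x" if "x \<in> W" for x using inv_into_f_f[OF W(4) that] by (simp add: \<Psi>_def)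
  have der\<Psi>: "(\<Psi> has_derivative L (\<Psi> y)) (at y)" if "y \<in> \<Phi> ` W" for y
  proof -
    obtain x where x: "x \<in> W" "y = \<Phi> x" using \<open>y \<in> \<Phi> ` W\<close> by (elim imageE) (rule that; assumption)
    have "(\<Psi> has_derivative L x) (at (\<Phi> x))"
      by (rule has_derivative_inverse_strong[OF W(1) x(1) contW \<Psi> der\<Phi> \<Phi>L]) (use x W(3) in auto)
    then show ?thesis using x \<Psi> by simp
  qed
  \<comment> \<open>Bootstrapping: the derivative of \<open>\<Psi>\<close> at \<open>y\<close> is
    \<open>L (\<Psi> y)\<close>, so smoothness of order \<open>j\<close> of \<open>\<Psi>\<close>
    yields order \<open>j + 1\<close>, as long as \<open>L\<close> is smooth enough.\<close>
  have "Ck_on j (\<Phi> ` W) \<Psi>" if "j \<le> Suc k" for j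
    using that
  proof (induction j)
    case 0
    then show ?case
      using has_derivative_continuous_on[OF has_derivative_at_withinI[OF der\<Psi>]] by simp
  next
    case (Suc j)
    show ?case
    proof (rule Ck_on_SucI[OF der\<Psi>])
      show "Ck_on j (\<Phi> ` W) (\<lambda>x. L (\<Psi> x) v)" for v
        by (rule Ck_on_compose[where T = W])
          (use Suc W(3) \<Psi> in \<open>auto intro!: Ck_on_subset[OF _ W(3)] Ck_on_le[OF L_smooth]\<close>)
    qed
  qed
  \<comment> \<open>\<open>\<Phi>\<close> is continuous and injective on \<open>W\<close>, and its
    source and target are the same space, so invariance of domain applies.\<close>
  moreover have "open (\<Phi> ` W)" by (rule invariance_of_domain[OF contW W(1,4)])
  ultimately show thesis using that[of W \<Psi>] W(1-3) \<Psi> unfolding \<Phi>_def by blast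
qed


section \<open>Taylor expansion and extension of solutions\<close>

text \<open>Subtracting the integrated polynomial leaves a function whose derivative is the given
  remainder; the mean value inequality supplies the extra power. The closed segment allows
  \<open>t' < t\<close>, as negative nodes require.\<close>

lemma Taylor_integrate:
  fixes u :: "real \<Rightarrow> 'a::real_normed_vector"
  assumes der: "\<And>\<tau>. \<tau> \<in> closed_segment t t' \<Longrightarrow> (u has_vector_derivative u' \<tau>) (at \<tau>)"
    and bd: "\<And>\<tau>. \<tau> \<in> closed_segment t t' \<Longrightarrow>
      norm (u' \<tau> - (\<Sum>j<n. (\<tau> - t) ^ j *\<^sub>R a j)) \<le> M * \<bar>\<tau> - t\<bar> ^ k" and M: "M \<ge> 0"
  shows "norm (u t' - u t - (\<Sum>j<n. ((t' - t) ^ Suc j / real (Suc j)) *\<^sub>R a j)) \<le> M * \<bar>t' - t\<bar> ^ Suc k"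
proof -
  let ?\<phi> = "\<lambda>\<tau>. u \<tau> - (\<Sum>j<n. ((\<tau> - t) ^ Suc j / real (Suc j)) *\<^sub>R a j)"
  let ?\<phi>' = "\<lambda>\<tau>. u' \<tau> - (\<Sum>j<n. (\<tau> - t) ^ j *\<^sub>R a j)"
  have "norm (?\<phi> t' - ?\<phi> t) \<le> (M * \<bar>t' - t\<bar> ^ k) * norm (t' - t)"
  proof (rule differentiable_bound[of "closed_segment t t'" ?\<phi> "\<lambda>\<tau> h. h *\<^sub>R ?\<phi>' \<tau>"])
    fix \<tau> assume \<tau>: "\<tau> \<in> closed_segment t t'"
    have pow: "((\<lambda>\<tau>. (\<tau> - t) ^ Suc j / real (Suc j)) has_field_derivative (\<tau> - t) ^ j) (at \<tau>)" for j
      by (rule derivative_eq_intros refl | simp)+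
    have sc: "((\<lambda>\<tau>. ((\<tau> - t) ^ Suc j / real (Suc j)) *\<^sub>R a j) has_vector_derivative
        (\<tau> - t) ^ j *\<^sub>R a j) (at \<tau>)" for j
      using has_vector_derivative_scaleR[OF pow[of j] has_vector_derivative_const[of "a j"]] by simp
    have "(?\<phi> has_vector_derivative ?\<phi>' \<tau>) (at \<tau>)"
      by (intro has_vector_derivative_diff der[OF \<tau>] has_vector_derivative_sum sc)
    then show "(?\<phi> has_derivative (\<lambda>h. h *\<^sub>R ?\<phi>' \<tau>)) (at \<tau> within closed_segment t t')"
      unfolding has_vector_derivative_def by (rule has_derivative_at_withinI)
    have "norm (?\<phi>' \<tau>) \<le> M * \<bar>t' - t\<bar> ^ k"
    proof (rule order_trans[OF bd[OF \<tau>]])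
      have "\<bar>\<tau> - t\<bar> \<le> \<bar>t' - t\<bar>" using \<tau> by (auto simp: closed_segment_eq_real_ivl split: if_splits)
      then show "M * \<bar>\<tau> - t\<bar> ^ k \<le> M * \<bar>t' - t\<bar> ^ k" by (intro mult_left_mono power_mono M) auto
    qed
    then show "onorm (\<lambda>h. h *\<^sub>R ?\<phi>' \<tau>) \<le> M * \<bar>t' - t\<bar> ^ k"
      by (intro onorm_bound) (auto simp: M mult.commute intro!: mult_left_mono)
  qed auto
  then show ?thesis by (simp add: algebra_simps)
qed

lemma Ck_on_real_SucE:
  fixes u :: "real \<Rightarrow> 'a::real_normed_vector"
  assumes "Ck_on (Suc k) S u"
  obtains u' where "\<And>x. x \<in> S \<Longrightarrow> (u has_vector_derivative u' x) (at x)" "Ck_on k S u'"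
proof -
  obtain f' where f': "\<And>x. x \<in> S \<Longrightarrow> (u has_derivative f' x) (at x)" "\<And>v. Ck_on k S (\<lambda>x. f' x v)"
    using assms by (elim Ck_on_SucE) (rule that; assumption)
  have "f' x = (\<lambda>h. h *\<^sub>R f' x 1)" if "x \<in> S" for x
  proof
    fix h
    show "f' x h = h *\<^sub>R f' x 1"
      using linear_cmul[OF has_derivative_linear[OF f'(1)[OF that]], of h 1] by simp
  qed
  then show thesis using that[of "\<lambda>x. f' x 1"] f' unfolding has_vector_derivative_def by metis
qed

lemma Ck_on_real_SucI:
  fixes u :: "real \<Rightarrow> 'a::real_normed_vector"
  assumes "\<And>x. x \<in> S \<Longrightarrow> (u has_vector_derivative u' x) (at x)" "Ck_on k S u'"
  shows "Ck_on (Suc k) S u"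
  by (rule Ck_on_SucI[of _ _ "\<lambda>x h. h *\<^sub>R u' x"])
    (use assms in \<open>auto simp: has_vector_derivative_def intro!: Ck_on_scaleR Ck_on_const\<close>)

text \<open>The coefficients stay anonymous because the order conditions cancel them whatever they
  are. What matters is that \<open>M\<close> does not depend on the base point, for which the
  compact interval has to lie strictly inside.\<close>

lemma Ck_on_Taylor:
  fixes u :: "real \<Rightarrow> 'a::real_normed_vector"
  assumes "Ck_on k {l<..<r} u" and lr: "l < \<alpha>" "\<beta> < r"
  shows "\<exists>M a. M \<ge> 0 \<and> (\<forall>t\<in>{\<alpha>..\<beta>}. \<forall>t'\<in>{\<alpha>..\<beta>}.
    norm (u t' - (\<Sum>j<k. (t' - t) ^ j *\<^sub>R a t j)) \<le> M * \<bar>t' - t\<bar> ^ k)"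
  using assms(1)
proof (induction k arbitrary: u)
  case 0
  have "continuous_on {\<alpha>..\<beta>} u"
    by (rule continuous_on_subset[of "{l<..<r}"]) (use 0 lr in auto)
  then have "bounded (u ` {\<alpha>..\<beta>})" by (intro compact_imp_bounded compact_continuous_image) auto
  then obtain M where "M > 0" "\<forall>x\<in>u ` {\<alpha>..\<beta>}. norm x \<le> M" unfolding bounded_pos by auto
  then show ?case by (auto intro!: exI[of _ M])
next
  case (Suc k)
  obtain u' where u': "\<And>x. x \<in> {l<..<r} \<Longrightarrow> (u has_vector_derivative u' x) (at x)" "Ck_on k {l<..<r} u'"
    using Suc.prems by (elim Ck_on_real_SucE) (rule that; assumption)
  obtain M a where M: "M \<ge> 0" and a: "\<And>t t'. t \<in> {\<alpha>..\<beta>} \<Longrightarrow> t' \<in> {\<alpha>..\<beta>} \<Longrightarrow>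
      norm (u' t' - (\<Sum>j<k. (t' - t) ^ j *\<^sub>R a t j)) \<le> M * \<bar>t' - t\<bar> ^ k"
    using Suc.IH[OF u'(2)] by blast
  \<comment> \<open>Coefficients of the antiderivative: the value at the base point, then those of
    \<open>u'\<close> shifted by one and divided by the new exponent.\<close>
  define a' where "a' = (\<lambda>t j. case j of 0 \<Rightarrow> u t | Suc i \<Rightarrow> (1 / real (Suc i)) *\<^sub>R a t i)"
  have "norm (u t' - (\<Sum>j<Suc k. (t' - t) ^ j *\<^sub>R a' t j)) \<le> M * \<bar>t' - t\<bar> ^ Suc k"
    if t: "t \<in> {\<alpha>..\<beta>}" "t' \<in> {\<alpha>..\<beta>}" for t t'
  proof -
    have seg: "closed_segment t t' \<subseteq> {\<alpha>..\<beta>}" using t by (auto simp: closed_segment_eq_real_ivl)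
    have "norm (u t' - u t - (\<Sum>j<k. ((t' - t) ^ Suc j / real (Suc j)) *\<^sub>R a t j)) \<le> M * \<bar>t' - t\<bar> ^ Suc k"
    proof (rule Taylor_integrate[OF u'(1) a M])
      show "\<tau> \<in> {l<..<r}" if "\<tau> \<in> closed_segment t t'" for \<tau> using seg that lr by fastforce
      show "\<tau> \<in> {\<alpha>..\<beta>}" if "\<tau> \<in> closed_segment t t'" for \<tau> using seg that by blast
    qed (use t in auto)
    then show ?thesis by (simp add: sum.lessThan_Suc_shift a'_def diff_diff_eq del: sum.lessThan_Suc)
  qed
  then show ?case using M by blast
qed

text \<open>All derivatives up to order \<open>k\<close> vanish on the interval as well, so outside
  it only a remainder of order \<open>k\<close> is left. Integrating from any \<open>t\<close> in
  the interval avoids a distinction between the two ends.\<close>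

lemma Ck_on_vanishing_bound:
  fixes u :: "real \<Rightarrow> 'a::real_normed_vector"
  assumes "Ck_on k {l<..<r} u" and "\<And>t. t \<in> {0..C} \<Longrightarrow> u t = 0"
    and lr: "l < \<alpha>" "\<beta> < r" "\<alpha> \<le> 0" "C \<le> \<beta>" "0 < C"
  shows "\<exists>M\<ge>0. \<forall>t\<in>{0..C}. \<forall>t'\<in>{\<alpha>..\<beta>}. norm (u t') \<le> M * \<bar>t' - t\<bar> ^ k"
  using assms(1,2)
proof (induction k arbitrary: u)
  case 0
  then obtain M a where "M \<ge> 0" "\<forall>t\<in>{\<alpha>..\<beta>}. \<forall>t'\<in>{\<alpha>..\<beta>}. norm (u t') \<le> M"
    using Ck_on_Taylor[of 0, OF 0(1) lr(1,2)] by auto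
  then show ?case using lr by (intro exI[of _ M]) auto
next
  case (Suc k)
  obtain u' where u': "\<And>x. x \<in> {l<..<r} \<Longrightarrow> (u has_vector_derivative u' x) (at x)" "Ck_on k {l<..<r} u'"
    using Suc.prems(1) by (elim Ck_on_real_SucE) (rule that; assumption)
  \<comment> \<open>At an end point the one-sided derivative already determines \<open>u'\<close>,
    because the interval is not degenerate.\<close>
  have u'0: "u' t = 0" if t: "t \<in> {0..C}" for t
  proof -
    have "(u has_vector_derivative u' t) (at t within cbox 0 C)"
      using u'(1)[of t] t lr by (auto intro: has_vector_derivative_at_within)
    moreover have "(u has_vector_derivative 0) (at t within cbox 0 C)"
      by (rule has_vector_derivative_transform[OF _ _ has_vector_derivative_const[of 0]])
        (use t Suc.prems(2) in auto)
    ultimately show ?thesis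
      using vector_derivative_unique_within_closed_interval[of 0 C t u] t lr by auto
  qed
  obtain M where M: "M \<ge> 0" and a: "\<And>t t'. t \<in> {0..C} \<Longrightarrow> t' \<in> {\<alpha>..\<beta>} \<Longrightarrow> norm (u' t') \<le> M * \<bar>t' - t\<bar> ^ k"
    using Suc.IH[OF u'(2) u'0] by blast
  have "norm (u t') \<le> M * \<bar>t' - t\<bar> ^ Suc k" if t: "t \<in> {0..C}" "t' \<in> {\<alpha>..\<beta>}" for t t'
  proof -
    have seg: "closed_segment t t' \<subseteq> {\<alpha>..\<beta>}" using t lr by (auto simp: closed_segment_eq_real_ivl)
    have "norm (u t' - u t - (\<Sum>j<0. ((t' - t) ^ Suc j / real (Suc j)) *\<^sub>R 0)) \<le> M * \<bar>t' - t\<bar> ^ Suc k"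
    proof (rule Taylor_integrate[where u' = u'])
      fix \<tau> assume \<tau>: "\<tau> \<in> closed_segment t t'"
      then have "\<tau> \<in> {l<..<r}" using seg lr by fastforce
      then show "(u has_vector_derivative u' \<tau>) (at \<tau>)" by (rule u'(1))
      show "norm (u' \<tau> - (\<Sum>j<0. (\<tau> - t) ^ j *\<^sub>R 0)) \<le> M * \<bar>\<tau> - t\<bar> ^ k"
        using a[OF t(1)] seg \<tau> by auto
    qed (rule M)
    then show ?thesis using Suc.prems(2)[OF t(1)] by simp
  qed
  then show ?case using M by blast
qed

lemma open_contains_Icc_enlargement:
  fixes C :: real
  assumes "open T" "{0..C} \<subseteq> T" "C > 0"
  obtains e where "e > 0" "{-e..C + e} \<subseteq> T"
proof -
  obtain e where e: "e > 0" "(\<Union>x\<in>{0..C}. cball x e) \<subseteq> T"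
    using compact_subset_open_imp_cball_epsilon_subset[OF compact_Icc assms(1,2)] by metis
  have "t \<in> T" if "t \<in> {-e..C + e}" for t
  proof -
    from that have "t \<in> cball (max 0 (min C t)) e" "max 0 (min C t) \<in> {0..C}"
      using assms(3) e(1) by (auto simp: dist_real_def max_def min_def)
    then show "t \<in> T" using e(2) by blast
  qed
  then show thesis using e(1) that by blast
qed

text \<open>
  The nodes \<open>t\<^sub>n + c\<^sub>i h\<close> may lie outside the interval of existence, because \<open>c\<^sub>i\<close> need not belong to
  \<open>[0, 1]\<close>. The extension \<open>w\<close> is smooth but need not solve the differential equation outside \<open>[0, C]\<close>;
  by \<open>Ck_on_vanishing_bound\<close> its defect there is of order \<open>h\<^sup>k\<close>, so no existence theorem is needed.
\<close>

lemma solution_Ck_extension: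
  fixes y :: "real \<Rightarrow> 'a::euclidean_space"
  assumes C: "C > 0" and S: "open S" and F: "Ck_on k S F"
    and y: "\<And>t. t \<in> {0..C} \<Longrightarrow> (t, y t) \<in> S"
      "\<And>t. t \<in> {0..C} \<Longrightarrow> (y has_vector_derivative F (t, y t)) (at t within {0..C})"
  shows "j \<le> Suc k \<Longrightarrow> \<exists>\<delta>>0. \<exists>w. Ck_on j {-\<delta><..<C + \<delta>} w \<and> (\<forall>t\<in>{0..C}. w t = y t)"
proof (induction j)
  case 0
  have "continuous_on {0..C} y"
    using has_derivative_continuous_on[OF y(2)[unfolded has_vector_derivative_def]] by blast
  \<comment> \<open>Clamping the time extends \<open>y\<close> by constants; order 0 asks for
    continuity only.\<close>
  then have "continuous_on UNIV (\<lambda>t. y (max 0 (min C t)))"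
    by (rule continuous_on_compose2) (use C in \<open>auto intro!: continuous_intros\<close>)
  then have "Ck_on 0 {-1<..<C + 1} (\<lambda>t. y (max 0 (min C t)))"
    using continuous_on_subset[of UNIV _ "{-1<..<C + 1}"] by simp
  then show ?case by (intro exI[of _ 1] conjI exI[of _ "\<lambda>t. y (max 0 (min C t))"]) auto
next
  case (Suc j)
  then obtain \<delta> w where \<delta>: "\<delta> > 0" and w: "Ck_on j {-\<delta><..<C + \<delta>} w" "\<And>t. t \<in> {0..C} \<Longrightarrow> w t = y t"
    by auto
  let ?I = "{-\<delta><..<C + \<delta>}"
  let ?T = "?I \<inter> (\<lambda>t. (t, w t)) -` S"
  have "open ?T"
    by (intro continuous_open_preimage S continuous_on_Pair continuous_on_id Ck_on_continuous[OF w(1)]) auto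
  moreover have "{0..C} \<subseteq> ?T" using w(2) y(1) \<delta> by auto
  ultimately obtain e where e: "e > 0" and sub: "{-e..C + e} \<subseteq> ?T"
    using open_contains_Icc_enlargement[OF _ _ C] by blast
  have v: "Ck_on j ?T (\<lambda>t. F (t, w t))"
    by (rule Ck_on_compose[of _ S]) (use Suc.prems in
        \<open>auto intro!: Ck_on_Pair Ck_on_id Ck_on_le[OF F] Ck_on_subset[OF w(1)]\<close>)
  have "continuous_on {-e..C + e} (\<lambda>t. F (t, w t))"
    using Ck_on_continuous[OF v] sub by (rule continuous_on_subset)
  then obtain G where G: "\<And>x. x \<in> {-e..C + e} \<Longrightarrow> (G has_vector_derivative F (x, w x)) (at x within {-e..C + e})"
    by (elim antiderivative_continuous) (rule that)
  \<comment> \<open>Replacing \<open>w\<close> by the integral of \<open>F (t, w t)\<close> gains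
    one derivative. On \<open>{0..C}\<close> the integrand is unchanged, so agreement with
    \<open>y\<close> survives; the margin may shrink in each round to keep the graph inside
    \<open>S\<close>.\<close>
  define w' where "w' = (\<lambda>t. y 0 + (G t - G 0))"
  have "(w' has_vector_derivative F (x, w x)) (at x)" if x: "x \<in> {-e<..<C + e}" for x
  proof -
    have "(G has_vector_derivative F (x, w x)) (at x)"
      using G[of x] x at_within_Icc_at[of "-e" x "C + e"] by auto
    then show ?thesis unfolding w'_def
      by (auto intro!: derivative_eq_intros)
  qed
  then have "Ck_on (Suc j) {-e<..<C + e} w'"
    by (rule Ck_on_real_SucI) (use sub in \<open>auto intro!: Ck_on_subset[OF v]\<close>)
  moreover have "w' t = y t" if t: "t \<in> {0..C}" for t
  proof -
    have "((\<lambda>t. w' t - y t) has_vector_derivative 0) (at x within {0..C})" if x: "x \<in> {0..C}" for x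
    proof -
      have "(G has_vector_derivative F (x, w x)) (at x within {0..C})"
        by (rule has_vector_derivative_within_subset[OF G]) (use x e in auto)
      then show ?thesis unfolding w'_def using y(2)[OF x] w(2)[OF x]
        by (auto intro!: derivative_eq_intros)
    qed
    then obtain c where c: "\<And>x. x \<in> {0..C} \<Longrightarrow> w' x - y x = c"
      using has_vector_derivative_zero_constant[of "{0..C}" "\<lambda>t. w' t - y t"] convex_real_interval(5)
      by metis
    have "c = 0" using c[of 0] C by (simp add: w'_def)
    then show ?thesis using c[OF t] by simp
  qed
  ultimately show ?case using e by blast
qed


section \<open>Local error of a scheme of classical order p\<close>

text \<open>An arbitrary numbering of the coordinates. \<open>classical_order\<close> speaks of
  sequences, while the differential equations here live in \<open>real^'n\<close>.\<close>

definition coord_enum :: "nat \<Rightarrow> 'n::finite" where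
  "coord_enum = (SOME e. bij_betw e {..<CARD('n)} UNIV)"

lemma bij_betw_coord_enum: "bij_betw (coord_enum :: nat \<Rightarrow> 'n::finite) {..<CARD('n)} UNIV"
proof -
  have "\<exists>e. bij_betw e {..<CARD('n)} (UNIV :: 'n set)"
    using ex_bij_betw_nat_finite[of "UNIV :: 'n set"] by (simp add: atLeast0LessThan)
  then show ?thesis unfolding coord_enum_def by (rule someI_ex)
qed

definition to_seq :: "real^'n \<Rightarrow> nat \<Rightarrow> real" where
  "to_seq v l = (if l < CARD('n) then v $ coord_enum l else 0)"

definition of_seq :: "(nat \<Rightarrow> real) \<Rightarrow> real^'n" where
  "of_seq u = (\<chi> i. u (inv_into {..<CARD('n)} coord_enum i))"

lemma coord_enum_inv [simp]: "coord_enum (inv_into {..<CARD('n)} coord_enum (i::'n::finite)) = i"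
  using bij_betw_inv_into_right[OF bij_betw_coord_enum] by blast

lemma coord_enum_inv_less [simp]: "inv_into {..<CARD('n)} coord_enum (i::'n::finite) < CARD('n)"
  using bij_betw_inv_into[OF bij_betw_coord_enum] bij_betwE by blast

lemma of_seq_to_seq [simp]: "of_seq (to_seq v) = v"
  by (simp add: of_seq_def to_seq_def vec_eq_iff)

lemma to_seq_nth: "l < CARD('n) \<Longrightarrow> to_seq (v :: real^'n) l = v $ coord_enum l"
  by (simp add: to_seq_def)

lemma to_seq_Euclidean_space: "to_seq (v :: real^'n) \<in> topspace (Euclidean_space CARD('n))"
  by (simp add: topspace_Euclidean_space to_seq_def)

lemma L2_set_to_seq: "L2_set (to_seq v) {..<CARD('n)} = norm (v :: real^'n)"
proof -
  have "(\<Sum>l<CARD('n). (to_seq v l)\<^sup>2) = (\<Sum>i\<in>UNIV. (v $ i)\<^sup>2)"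
    using sum.reindex_bij_betw[OF bij_betw_coord_enum, of "\<lambda>i. (v $ i)\<^sup>2"] by (simp add: to_seq_def)
  then show ?thesis by (simp add: L2_set_def norm_vec_def)
qed

definition of_tseq :: "(nat \<Rightarrow> real) \<Rightarrow> real \<times> (real^'n)" where
  "of_tseq u = (u 0, of_seq (\<lambda>l. u (Suc l)))"

lemma of_tseq_case_nat [simp]: "of_tseq (case_nat t x) = (t, of_seq x)"
  by (simp add: of_tseq_def)

text \<open>Decoding is affine in every single entry, so a partial derivative on sequences is a
  directional derivative on vectors.\<close>

lemma of_tseq_upd: "of_tseq (x(i := s)) = of_tseq x + (s - x i) *\<^sub>R of_tseq (\<lambda>l. if l = i then 1 else 0)"
  by (auto simp: of_tseq_def of_seq_def vec_eq_iff)

lemma continuous_on_of_tseq: "continuous_on UNIV (of_tseq :: _ \<Rightarrow> real \<times> (real^'n))"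
  unfolding of_tseq_def of_seq_def
  by (intro continuous_on_Pair continuous_on_vec_lambda continuous_on_product_coordinates)

abbreviation tseq_dom :: "(real \<times> (real^'n)) set \<Rightarrow> (nat \<Rightarrow> real) set" where
  "tseq_dom S \<equiv> topspace (Euclidean_space (Suc CARD('n))) \<inter> of_tseq -` S"

lemma Euclidean_space_eq: "Euclidean_space m = top_of_set {x. \<forall>i\<ge>m. x i = 0}"
  by (simp add: Euclidean_space_def euclidean_product_topology)

lemma openin_tseq_dom: "open S \<Longrightarrow> openin (Euclidean_space (Suc CARD('n))) (tseq_dom (S :: (real \<times> (real^'n)) set))"
  unfolding Euclidean_space_eq
  using open_vimage[OF _ continuous_on_of_tseq] by (auto simp: openin_open)

text \<open>A partial derivative of \<open>\<phi>\<close> after decoding is a directional derivative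
  of \<open>\<phi>\<close> after decoding, hence of the same shape with one order less, and the
  induction closes.\<close>

lemma Ck_on_imp_C_k_coords:
  fixes S :: "(real \<times> (real^'n)) set" and \<phi> :: "real \<times> (real^'n) \<Rightarrow> real"
  assumes "Ck_on k S \<phi>"
  shows "C_k_coords (Suc CARD('n)) k (tseq_dom S) (\<lambda>u. \<phi> (of_tseq u))"
proof -
  have cont: "continuous_map (subtopology (Euclidean_space (Suc CARD('n))) (tseq_dom S)) euclideanreal
      (\<lambda>u. \<phi> (of_tseq u))" if "continuous_on S \<phi>" for \<phi> :: "real \<times> (real^'n) \<Rightarrow> real"
  proof -
    have "continuous_on (tseq_dom S) (\<lambda>u. \<phi> (of_tseq u))"
      by (rule continuous_on_compose2[OF that continuous_on_subset[OF continuous_on_of_tseq]]) auto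
    then show ?thesis
      by (simp add: Euclidean_space_eq subtopology_subtopology Int_absorb1 Int_assoc[symmetric])
  qed
  show ?thesis using assms
  proof (induction k arbitrary: \<phi>)
    case 0
    then show ?case using cont by simp
  next
    case (Suc k)
    obtain \<phi>' where \<phi>': "\<And>x. x \<in> S \<Longrightarrow> (\<phi> has_derivative \<phi>' x) (at x)" "\<And>v. Ck_on k S (\<lambda>x. \<phi>' x v)"
      using Suc.prems by (elim Ck_on_SucE) (rule that; assumption)
    have "\<exists>\<psi>. (\<forall>x\<in>tseq_dom S. ((\<lambda>s. \<phi> (of_tseq (x(i := s)))) has_real_derivative \<psi> x) (at (x i))) \<and>
        C_k_coords (Suc CARD('n)) k (tseq_dom S) \<psi>" for i
    proof (intro exI conjI ballI)
      let ?e = "of_tseq (\<lambda>l. if l = i then 1 else 0) :: real \<times> (real^'n)"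
      show "C_k_coords (Suc CARD('n)) k (tseq_dom S) (\<lambda>u. \<phi>' (of_tseq u) ?e)"
        by (rule Suc.IH[OF \<phi>'(2)])
      fix x assume x: "x \<in> tseq_dom S"
      then have D: "(\<phi> has_derivative \<phi>' (of_tseq x)) (at (of_tseq x))" using \<phi>'(1) by auto
      have "((\<lambda>s. of_tseq x + (s - x i) *\<^sub>R ?e) has_derivative (\<lambda>h. h *\<^sub>R ?e)) (at (x i))"
        by (auto intro!: derivative_eq_intros)
      from has_derivative_compose[OF this, of \<phi> "\<phi>' (of_tseq x)"] D
      have "((\<lambda>s. \<phi> (of_tseq (x(i := s)))) has_derivative (\<lambda>h. \<phi>' (of_tseq x) (h *\<^sub>R ?e))) (at (x i))"
        by (simp add: of_tseq_upd)
      then show "((\<lambda>s. \<phi> (of_tseq (x(i := s)))) has_real_derivative \<phi>' (of_tseq x) ?e) (at (x i))"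
        using linear_cmul[OF has_derivative_linear[OF D]]
        by (simp add: has_field_derivative_def mult_commute_abs)
    qed
    then show ?case using cont[OF Ck_on_continuous[OF Suc.prems]] by simp
  qed
qed

text \<open>Restates the order for vectors. The smoothness \<open>k\<close> is chosen before the
  equation, and \<open>F\<close> need be smooth only on an open \<open>S\<close> around the
  solution; the reduced equation is available only there.\<close>

lemma classical_order_local_error:
  fixes A :: "real^'s^'s"
  assumes "classical_order A b c p"
  shows "\<exists>k. \<forall>(F :: real \<times> (real^'n) \<Rightarrow> real^'n) S C y. open S \<and> Ck_on k S F \<and> 0 < C \<and>
     (\<forall>t\<in>{0..C}. (t, y t) \<in> S \<and> (y has_vector_derivative F (t, y t)) (at t within {0..C})) \<longrightarrow>
     (\<exists>M. \<exists>\<epsilon>>0. \<exists>h0>0. \<forall>t h X. 0 < h \<and> h \<le> h0 \<and> 0 \<le> t \<and> t + h \<le> C \<and>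
       (\<forall>i. (t + c $ i * h, X i) \<in> S \<and>
          X i = y t + h *\<^sub>R (\<Sum>j\<in>UNIV. A $ i $ j *\<^sub>R F (t + c $ j * h, X j)) \<and> norm (X i - y t) \<le> \<epsilon>) \<longrightarrow>
       norm (y (t + h) - (y t + h *\<^sub>R (\<Sum>i\<in>UNIV. b $ i *\<^sub>R F (t + c $ i * h, X i)))) \<le> M * h ^ (p + 1))"
proof -
  from assms[unfolded classical_order_def] obtain k where k: "\<forall>d W F t0 t1 x.
        openin (Euclidean_space (Suc d)) W \<and> (\<forall>l<d. C_k_coords (Suc d) k W (\<lambda>u. F u l)) \<and>
        t0 < t1 \<and> ode_solution d W F t0 t1 x \<longrightarrow>
        (\<exists>M. \<exists>\<epsilon>>0. \<exists>h0>0. \<forall>t h X.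
           0 < h \<and> h \<le> h0 \<and> t0 \<le> t \<and> t + h \<le> t1 \<and> ode_stages A c d W F h t (x t) X \<and>
           (\<forall>i. L2_set (\<lambda>l. X i l - x t l) {..<d} \<le> \<epsilon>) \<longrightarrow>
           L2_set (\<lambda>l. x (t + h) l -
               (x t l + h * (\<Sum>i\<in>UNIV. b $ i * F (case_nat (t + c $ i * h) (X i)) l))) {..<d}
             \<le> M * h ^ (p + 1))" by (rule exE)
  show ?thesis
  proof (intro exI[of _ k] allI impI)
    fix F :: "real \<times> (real^'n) \<Rightarrow> real^'n" and S C y
    assume "open S \<and> Ck_on k S F \<and> 0 < C \<and>
     (\<forall>t\<in>{0..C}. (t, y t) \<in> S \<and> (y has_vector_derivative F (t, y t)) (at t within {0..C}))"
    then have S: "open S" and F: "Ck_on k S F" and C: "0 < C"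
      and y: "\<And>t. t \<in> {0..C} \<Longrightarrow> (t, y t) \<in> S"
      "\<And>t. t \<in> {0..C} \<Longrightarrow> (y has_vector_derivative F (t, y t)) (at t within {0..C})" by auto
    let ?d = "CARD('n)" and ?W = "tseq_dom S"
    define F' where "F' = (\<lambda>u. to_seq (F (of_tseq u)))"
    have "C_k_coords (Suc ?d) k ?W (\<lambda>u. F' u l)" if "l < ?d" for l
      using Ck_on_imp_C_k_coords[OF Ck_on_vec_nth[OF F, of "coord_enum l"]] that
      by (simp add: F'_def to_seq_nth)
    moreover have dom: "case_nat t (to_seq v) \<in> ?W" if "(t, v) \<in> S" for t v
      using that to_seq_Euclidean_space[of v]
      by (auto simp: topspace_Euclidean_space split: nat.splits)
    have "ode_solution ?d ?W F' 0 C (\<lambda>t. to_seq (y t))"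
      unfolding ode_solution_def
    proof (intro ballI conjI allI impI to_seq_Euclidean_space)
      fix t assume t: "t \<in> {0..C}"
      show "case_nat t (to_seq (y t)) \<in> ?W" by (rule dom[OF y(1)[OF t]])
      fix l assume l: "l < ?d"
      have "((\<lambda>t. y t $ coord_enum l) has_vector_derivative F (t, y t) $ coord_enum l) (at t within {0..C})"
        using bounded_linear.has_vector_derivative[OF bounded_linear_vec_nth y(2)[OF t]] .
      then show "((\<lambda>t. to_seq (y t) l) has_real_derivative F' (case_nat t (to_seq (y t))) l) (at t within {0..C})"
        using l by (simp add: F'_def to_seq_nth has_real_derivative_iff_has_vector_derivative)
    qed
    ultimately have "\<exists>M. \<exists>\<epsilon>>0. \<exists>h0>0. \<forall>t h X. 0 < h \<and> h \<le> h0 \<and> 0 \<le> t \<and> t + h \<le> C \<and>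
          ode_stages A c ?d ?W F' h t (to_seq (y t)) X \<and>
           (\<forall>i. L2_set (\<lambda>l. X i l - to_seq (y t) l) {..<?d} \<le> \<epsilon>) \<longrightarrow>
           L2_set (\<lambda>l. to_seq (y (t + h)) l -
               (to_seq (y t) l + h * (\<Sum>i\<in>UNIV. b $ i * F' (case_nat (t + c $ i * h) (X i)) l))) {..<?d}
             \<le> M * h ^ (p + 1)"
      using k[rule_format, of ?d ?W F' 0 C "\<lambda>t. to_seq (y t)"] openin_tseq_dom[OF S] C by blast
    then obtain M \<epsilon> h0 where e: "\<epsilon> > 0" "h0 > 0" and main: "\<forall>t h X. 0 < h \<and> h \<le> h0 \<and> 0 \<le> t \<and> t + h \<le> C \<and>
          ode_stages A c ?d ?W F' h t (to_seq (y t)) X \<and>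
           (\<forall>i. L2_set (\<lambda>l. X i l - to_seq (y t) l) {..<?d} \<le> \<epsilon>) \<longrightarrow>
           L2_set (\<lambda>l. to_seq (y (t + h)) l -
               (to_seq (y t) l + h * (\<Sum>i\<in>UNIV. b $ i * F' (case_nat (t + c $ i * h) (X i)) l))) {..<?d}
             \<le> M * h ^ (p + 1)"
      by (elim exE conjE) (rule that)
    have *: "norm (y (t + h) - (y t + h *\<^sub>R (\<Sum>i\<in>UNIV. b $ i *\<^sub>R F (t + c $ i * h, X i)))) \<le> M * h ^ (p + 1)"
      if h: "0 < h" "h \<le> h0" "0 \<le> t" "t + h \<le> C" and X: "\<And>i. (t + c $ i * h, X i) \<in> S"
        "\<And>i. X i = y t + h *\<^sub>R (\<Sum>j\<in>UNIV. A $ i $ j *\<^sub>R F (t + c $ j * h, X j))"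
        "\<And>i. norm (X i - y t) \<le> \<epsilon>" for t h X
    proof -
      have lin: "L2_set (\<lambda>l. to_seq u l - to_seq v l) {..<?d} = norm (u - v)" for u v :: "real^'n"
        unfolding L2_set_to_seq[symmetric] by (rule L2_set_cong) (auto simp: to_seq_def)
      have st: "ode_stages A c ?d ?W F' h t (to_seq (y t)) (\<lambda>i. to_seq (X i))"
        unfolding ode_stages_def
      proof (intro allI conjI impI to_seq_Euclidean_space dom X(1))
        fix i l assume l: "l < ?d"
        show "to_seq (X i) l = to_seq (y t) l
            + h * (\<Sum>j\<in>UNIV. A $ i $ j * F' (case_nat (t + c $ j * h) (to_seq (X j))) l)"
          using arg_cong[OF X(2), of "\<lambda>v. v $ coord_enum l" i] l by (simp add: F'_def to_seq_nth)
      qed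
      have "L2_set (\<lambda>l. to_seq (y (t + h)) l - (to_seq (y t) l + h *
          (\<Sum>i\<in>UNIV. b $ i * F' (case_nat (t + c $ i * h) (to_seq (X i))) l))) {..<?d} \<le> M * h ^ (p + 1)"
        by (rule main[rule_format]) (use h st in \<open>simp add: lin X(3)\<close>)
      also have "L2_set (\<lambda>l. to_seq (y (t + h)) l - (to_seq (y t) l + h *
          (\<Sum>i\<in>UNIV. b $ i * F' (case_nat (t + c $ i * h) (to_seq (X i))) l))) {..<?d}
        = L2_set (\<lambda>l. to_seq (y (t + h)) l - to_seq (y t + h *\<^sub>R (\<Sum>i\<in>UNIV. b $ i *\<^sub>R F (t + c $ i * h, X i))) l) {..<?d}"
        by (rule L2_set_cong) (auto simp: F'_def to_seq_nth)
      finally show ?thesis by (simp only: lin)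
    qed
    show "\<exists>M. \<exists>\<epsilon>>0. \<exists>h0>0. \<forall>t h X. 0 < h \<and> h \<le> h0 \<and> 0 \<le> t \<and> t + h \<le> C \<and>
       (\<forall>i. (t + c $ i * h, X i) \<in> S \<and>
          X i = y t + h *\<^sub>R (\<Sum>j\<in>UNIV. A $ i $ j *\<^sub>R F (t + c $ j * h, X j)) \<and> norm (X i - y t) \<le> \<epsilon>) \<longrightarrow>
       norm (y (t + h) - (y t + h *\<^sub>R (\<Sum>i\<in>UNIV. b $ i *\<^sub>R F (t + c $ i * h, X i)))) \<le> M * h ^ (p + 1)"
    proof (rule exI[of _ M], rule exI[of _ \<epsilon>], rule conjI[OF e(1)], rule exI[of _ h0],
        rule conjI[OF e(2)], intro allI impI)
      fix t h X
      assume "0 < h \<and> h \<le> h0 \<and> 0 \<le> t \<and> t + h \<le> C \<and> (\<forall>i. (t + c $ i * h, X i) \<in> S \<and>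
          X i = y t + h *\<^sub>R (\<Sum>j\<in>UNIV. A $ i $ j *\<^sub>R F (t + c $ j * h, X j)) \<and> norm (X i - y t) \<le> \<epsilon>)"
      then show "norm (y (t + h) - (y t + h *\<^sub>R (\<Sum>i\<in>UNIV. b $ i *\<^sub>R F (t + c $ i * h, X i))))
          \<le> M * h ^ (p + 1)"
        by (intro *) blast+
    qed
  qed
qed

text \<open>On the equation y' = 1 a step has error \<open>h\<close> times the defect of the sum of
  the weights, which can be O(h^2) only if the defect is zero. With abscissae equal to row sums this
  places the last node of a stiffly accurate scheme at the end of the step.\<close>

lemma classical_order_consistent:
  fixes A :: "real^'s^'s"
  assumes ord: "classical_order A b c p" and p: "p \<ge> 1"
  shows "(\<Sum>i\<in>UNIV. b $ i) = 1"
proof (rule ccontr)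
  assume neq: "(\<Sum>i\<in>UNIV. b $ i) \<noteq> 1"
  let ?D = "\<bar>1 - (\<Sum>i\<in>UNIV. b $ i)\<bar>" and ?one = "axis 1 1 :: real^1"
  define \<alpha> where "\<alpha> = (\<Sum>i\<in>UNIV. \<bar>\<Sum>j\<in>UNIV. A $ i $ j\<bar>)"
  have \<alpha>: "\<bar>\<Sum>j\<in>UNIV. A $ i $ j\<bar> \<le> \<alpha>" for i
    unfolding \<alpha>_def by (rule member_le_sum[of i UNIV "\<lambda>i. \<bar>\<Sum>j\<in>UNIV. A $ i $ j\<bar>"]) auto
  have \<alpha>0: "\<alpha> \<ge> 0" unfolding \<alpha>_def by (intro sum_nonneg) auto
  obtain k where k: "\<forall>(F :: real \<times> (real^1) \<Rightarrow> real^1) S C y. open S \<and> Ck_on k S F \<and> 0 < C \<and>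
     (\<forall>t\<in>{0..C}. (t, y t) \<in> S \<and> (y has_vector_derivative F (t, y t)) (at t within {0..C})) \<longrightarrow>
     (\<exists>M. \<exists>\<epsilon>>0. \<exists>h0>0. \<forall>t h X. 0 < h \<and> h \<le> h0 \<and> 0 \<le> t \<and> t + h \<le> C \<and>
       (\<forall>i. (t + c $ i * h, X i) \<in> S \<and>
          X i = y t + h *\<^sub>R (\<Sum>j\<in>UNIV. A $ i $ j *\<^sub>R F (t + c $ j * h, X j)) \<and> norm (X i - y t) \<le> \<epsilon>) \<longrightarrow>
       norm (y (t + h) - (y t + h *\<^sub>R (\<Sum>i\<in>UNIV. b $ i *\<^sub>R F (t + c $ i * h, X i)))) \<le> M * h ^ (p + 1))"
    using classical_order_local_error[OF ord, where 'n = 1] by (rule exE)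
  have "((\<lambda>t. t *\<^sub>R ?one) has_vector_derivative ?one) (at t within {0..1})" for t
    by (auto intro!: derivative_eq_intros simp: has_vector_derivative_def)
  then have "\<exists>M. \<exists>\<epsilon>>0. \<exists>h0>0. \<forall>t h X. 0 < h \<and> h \<le> h0 \<and> 0 \<le> t \<and> t + h \<le> 1 \<and>
       (\<forall>i. (t + c $ i * h, X i) \<in> UNIV \<and>
          X i = t *\<^sub>R ?one + h *\<^sub>R (\<Sum>j\<in>UNIV. A $ i $ j *\<^sub>R ?one) \<and> norm (X i - t *\<^sub>R ?one) \<le> \<epsilon>) \<longrightarrow>
       norm ((t + h) *\<^sub>R ?one - (t *\<^sub>R ?one + h *\<^sub>R (\<Sum>i\<in>UNIV. b $ i *\<^sub>R ?one))) \<le> M * h ^ (p + 1)"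
    by (intro k[rule_format, of UNIV "\<lambda>_. ?one" 1 "\<lambda>t. t *\<^sub>R ?one"]) (auto simp: Ck_on_const)
  then obtain M \<epsilon> h0 where e: "\<epsilon> > 0" "h0 > 0" and main: "\<forall>t h X. 0 < h \<and> h \<le> h0 \<and> 0 \<le> t \<and> t + h \<le> 1 \<and>
       (\<forall>i. (t + c $ i * h, X i) \<in> UNIV \<and>
          X i = t *\<^sub>R ?one + h *\<^sub>R (\<Sum>j\<in>UNIV. A $ i $ j *\<^sub>R ?one) \<and> norm (X i - t *\<^sub>R ?one) \<le> \<epsilon>) \<longrightarrow>
       norm ((t + h) *\<^sub>R ?one - (t *\<^sub>R ?one + h *\<^sub>R (\<Sum>i\<in>UNIV. b $ i *\<^sub>R ?one))) \<le> M * h ^ (p + 1)"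
    by (elim exE conjE) (rule that)
  define h where "h = min (min 1 h0) (min (\<epsilon> / (\<alpha> + 1)) (?D / (2 * (\<bar>M\<bar> + 1))))"
  have "\<epsilon> / (\<alpha> + 1) > 0" "?D / (2 * (\<bar>M\<bar> + 1)) > 0" using e(1) \<alpha>0 neq by auto
  then have h: "h > 0" "h \<le> 1" "h \<le> h0" "h \<le> \<epsilon> / (\<alpha> + 1)" "h \<le> ?D / (2 * (\<bar>M\<bar> + 1))"
    unfolding h_def using e(2) by (simp_all add: min_le_iff_disj)
  have "norm (h *\<^sub>R (\<Sum>j\<in>UNIV. A $ i $ j *\<^sub>R ?one)) \<le> \<epsilon>" for i
  proof -
    have "norm (h *\<^sub>R (\<Sum>j\<in>UNIV. A $ i $ j *\<^sub>R ?one)) = h * \<bar>\<Sum>j\<in>UNIV. A $ i $ j\<bar>"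
      using h(1) by (simp add: scaleR_left.sum[symmetric] norm_axis_1 abs_mult)
    also have "\<dots> \<le> h * (\<alpha> + 1)" using \<alpha>[of i] h(1) by (intro mult_left_mono) auto
    also have "\<dots> \<le> \<epsilon>" using h(4) \<alpha>0 by (simp add: pos_le_divide_eq)
    finally show ?thesis .
  qed
  then have "norm ((0 + h) *\<^sub>R ?one - (0 *\<^sub>R ?one + h *\<^sub>R (\<Sum>i\<in>UNIV. b $ i *\<^sub>R ?one))) \<le> M * h ^ (p + 1)"
    by (intro main[rule_format, of h 0 "\<lambda>i. 0 *\<^sub>R ?one + h *\<^sub>R (\<Sum>j\<in>UNIV. A $ i $ j *\<^sub>R ?one)"]) (use h in auto)
  moreover have "(0 + h) *\<^sub>R ?one - (0 *\<^sub>R ?one + h *\<^sub>R (\<Sum>i\<in>UNIV. b $ i *\<^sub>R ?one))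
      = (h * (1 - (\<Sum>i\<in>UNIV. b $ i))) *\<^sub>R ?one"
    by (simp add: scaleR_left.sum[symmetric] algebra_simps)
  ultimately have "h * ?D \<le> M * h ^ (p + 1)"
    using h(1) by (simp add: norm_axis_1 abs_mult)
  then have "?D \<le> M * h ^ p" using h(1) by (simp add: mult.assoc[symmetric] mult.commute[of h])
  also have "\<dots> \<le> (\<bar>M\<bar> + 1) * h"
    using h(1,2) power_decreasing[OF p, of h] by (intro mult_mono) auto
  also have "\<dots> \<le> ?D / 2" using h(5) by (simp add: pos_le_divide_eq field_simps)
  finally show False using neq by simp
qed


section \<open>Runge-Kutta stages\<close>

lemma abs_matrix_entry_le_sum:
  fixes A :: "real^'n^'m"
  shows "\<bar>A $ i $ j\<bar> \<le> (\<Sum>i\<in>UNIV. \<Sum>j\<in>UNIV. \<bar>A $ i $ j\<bar>)"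
proof -
  have "\<bar>A $ i $ j\<bar> \<le> (\<Sum>j\<in>UNIV. \<bar>A $ i $ j\<bar>)"
    by (rule member_le_sum[of j UNIV "\<lambda>j. \<bar>A $ i $ j\<bar>"]) auto
  also have "\<dots> \<le> (\<Sum>i\<in>UNIV. \<Sum>j\<in>UNIV. \<bar>A $ i $ j\<bar>)"
    by (rule member_le_sum[of i UNIV "\<lambda>i. \<Sum>j\<in>UNIV. \<bar>A $ i $ j\<bar>"]) (auto intro: sum_nonneg)
  finally show ?thesis .
qed

text \<open>Summing over the stages gives the total stage difference on both sides; for small
  \<open>h\<close> the right-hand copy has factor at most 1/2 and is absorbed, whence the factor 2.
  The increments \<open>P\<close> are compared only at the stages themselves, so no global Lipschitz
  bound is needed.\<close>

lemma stage_stability: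
  fixes A :: "real^'s^'s" and X X' \<eta> \<eta>' P P' :: "'s \<Rightarrow> 'a::real_normed_vector"
  assumes A: "\<And>i j. \<bar>A $ i $ j\<bar> \<le> \<alpha>"
    and X: "\<And>i. X i = v + h *\<^sub>R (\<Sum>j\<in>UNIV. A $ i $ j *\<^sub>R P j) + \<eta> i"
    and X': "\<And>i. X' i = v' + h *\<^sub>R (\<Sum>j\<in>UNIV. A $ i $ j *\<^sub>R P' j) + \<eta>' i"
    and L: "\<And>j. norm (P j - P' j) \<le> L * norm (X j - X' j)" "L \<ge> 0"
    and h: "h \<ge> 0" "h * (real CARD('s) * \<alpha> * L) \<le> 1 / 2"
  shows "(\<Sum>i\<in>UNIV. norm (X i - X' i)) \<le> 2 * (real CARD('s) * norm (v - v') + (\<Sum>i\<in>UNIV. norm (\<eta> i - \<eta>' i)))"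
proof -
  let ?S = "\<Sum>i\<in>UNIV. norm (X i - X' i)"
  have \<alpha>: "\<alpha> \<ge> 0" using A[of undefined undefined] by linarith
  have "norm (X i - X' i) \<le> norm (v - v') + h * (\<alpha> * L * ?S) + norm (\<eta> i - \<eta>' i)" for i
  proof -
    have "X i - X' i = (v - v') + h *\<^sub>R (\<Sum>j\<in>UNIV. A $ i $ j *\<^sub>R (P j - P' j)) + (\<eta> i - \<eta>' i)"
      by (subst X, subst X') (simp add: algebra_simps sum_subtractf)
    then have "norm (X i - X' i) \<le> norm (v - v') + norm (h *\<^sub>R (\<Sum>j\<in>UNIV. A $ i $ j *\<^sub>R (P j - P' j)))
        + norm (\<eta> i - \<eta>' i)" using norm_triangle_le norm_triangle_ineq by (metis add_right_mono order_trans)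
    moreover have "norm (\<Sum>j\<in>UNIV. A $ i $ j *\<^sub>R (P j - P' j)) \<le> (\<Sum>j\<in>UNIV. \<alpha> * (L * norm (X j - X' j)))"
    proof (rule sum_norm_le)
      fix j
      show "norm (A $ i $ j *\<^sub>R (P j - P' j)) \<le> \<alpha> * (L * norm (X j - X' j))"
        using mult_mono[OF A[of i j] L(1)[of j]] \<alpha> by simp
    qed
    from mult_left_mono[OF this h(1)]
    have "norm (h *\<^sub>R (\<Sum>j\<in>UNIV. A $ i $ j *\<^sub>R (P j - P' j))) \<le> h * (\<alpha> * L * ?S)"
      using h(1) by (simp add: sum_distrib_left mult.assoc)
    ultimately show ?thesis by linarith
  qed
  then have "?S \<le> (\<Sum>i\<in>(UNIV::'s set). norm (v - v') + h * (\<alpha> * L * ?S) + norm (\<eta> i - \<eta>' i))"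
    by (rule sum_mono)
  also have "\<dots> = real CARD('s) * norm (v - v') + (h * (real CARD('s) * \<alpha> * L)) * ?S + (\<Sum>i\<in>UNIV. norm (\<eta> i - \<eta>' i))"
    by (simp add: sum.distrib algebra_simps)
  also have "(h * (real CARD('s) * \<alpha> * L)) * ?S \<le> (1 / 2) * ?S"
    by (intro mult_right_mono h(2) sum_nonneg) auto
  finally show ?thesis by simp
qed

text \<open>A Banach fixed point in a product of balls. The bound with \<open>B\<close> makes the
  stage map preserve the product, the bound with \<open>L\<close> makes it contract.\<close>

lemma stages_exist:
  fixes A :: "real^'s^'s" and G :: "'s \<Rightarrow> 'a::euclidean_space \<Rightarrow> 'a"
  assumes A: "\<And>i j. \<bar>A $ i $ j\<bar> \<le> \<alpha>"
    and B: "\<And>j x. x \<in> cball v \<rho> \<Longrightarrow> norm (G j x) \<le> B"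
    and L: "\<And>j x x'. x \<in> cball v \<rho> \<Longrightarrow> x' \<in> cball v \<rho> \<Longrightarrow> norm (G j x - G j x') \<le> L * norm (x - x')"
    and \<rho>: "\<rho> > 0" and L0: "L \<ge> 0" and h: "h \<ge> 0" "h * (real CARD('s) * \<alpha> * B) \<le> \<rho>"
      "h * (real CARD('s) * (real CARD('s) * \<alpha> * L)) \<le> 1 / 2"
  obtains X where "\<And>i. X i = v + h *\<^sub>R (\<Sum>j\<in>UNIV. A $ i $ j *\<^sub>R G j (X j))" "\<And>i. X i \<in> cball v \<rho>"
    "\<And>i. norm (X i - v) \<le> h * (real CARD('s) * \<alpha> * B)"
proof -
  define D where "D = {X :: 'a^'s. \<forall>i. X $ i \<in> cball v \<rho>}"
  define T where "T = (\<lambda>X :: 'a^'s. \<chi> i. v + h *\<^sub>R (\<Sum>j\<in>UNIV. A $ i $ j *\<^sub>R G j (X $ j)))"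
  have \<alpha>: "\<alpha> \<ge> 0" using A[of undefined undefined] by linarith
  have bd: "norm (T X $ i - v) \<le> h * (real CARD('s) * \<alpha> * B)" if "X \<in> D" for X i
  proof -
    have "norm (\<Sum>j\<in>UNIV. A $ i $ j *\<^sub>R G j (X $ j)) \<le> (\<Sum>j\<in>(UNIV :: 's set). \<alpha> * B)"
    proof (rule sum_norm_le)
      fix j
      have "X $ j \<in> cball v \<rho>" using that by (simp add: D_def)
      then show "norm (A $ i $ j *\<^sub>R G j (X $ j)) \<le> \<alpha> * B"
        using mult_mono[OF A[of i j] B] \<alpha> by simp
    qed
    then show ?thesis using h(1) by (simp add: T_def mult_left_mono mult.assoc)
  qed
  have "closed D"
  proof -
    have "D = (\<Inter>i. (\<lambda>X. X $ i) -` cball v \<rho>)" by (auto simp: D_def)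
    moreover have "closed ((\<lambda>X :: 'a^'s. X $ i) -` cball v \<rho>)" for i
      by (intro closed_vimage closed_cball bounded_linear.continuous_on[OF bounded_linear_vec_nth] continuous_on_id)
    ultimately show ?thesis by auto
  qed
  then have "complete D" by (simp add: complete_eq_closed)
  moreover have "(\<chi> i. v) \<in> D" using \<rho> by (simp add: D_def)
  then have "D \<noteq> {}" by blast
  moreover have "T ` D \<subseteq> D"
  proof -
    have "T X $ i \<in> cball v \<rho>" if "X \<in> D" for X i
      using bd[OF that, of i] h(2) by (simp add: dist_norm norm_minus_commute)
    then show ?thesis by (auto simp: D_def)
  qed
  moreover have "dist (T X) (T X') \<le> 1 / 2 * dist X X'" if D: "X \<in> D" "X' \<in> D" for X X'
  proof -
    have nth: "norm (X $ j - X' $ j) \<le> dist X X'" for j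
      using Finite_Cartesian_Product.norm_nth_le[of "X - X'" j] by (simp add: dist_norm)
    have "norm ((T X - T X') $ i) \<le> h * (real CARD('s) * \<alpha> * L) * dist X X'" for i
    proof -
      have "(T X - T X') $ i = h *\<^sub>R (\<Sum>j\<in>UNIV. A $ i $ j *\<^sub>R (G j (X $ j) - G j (X' $ j)))"
        by (simp add: T_def algebra_simps sum_subtractf)
      moreover have "norm (\<Sum>j\<in>UNIV. A $ i $ j *\<^sub>R (G j (X $ j) - G j (X' $ j)))
          \<le> (\<Sum>j\<in>(UNIV :: 's set). \<alpha> * (L * dist X X'))"
      proof (rule sum_norm_le)
        fix j
        have "norm (G j (X $ j) - G j (X' $ j)) \<le> L * norm (X $ j - X' $ j)"
          using D by (intro L) (auto simp: D_def)
        also have "\<dots> \<le> L * dist X X'" by (intro mult_left_mono nth L0)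
        finally show "norm (A $ i $ j *\<^sub>R (G j (X $ j) - G j (X' $ j))) \<le> \<alpha> * (L * dist X X')"
          using mult_mono[OF A[of i j]] \<alpha> by simp
      qed
      ultimately show ?thesis using h(1) by (simp add: mult_left_mono mult.assoc)
    qed
    \<comment> \<open>The second factor \<open>CARD('s)\<close> in the step size bound comes from
      estimating the norm of the stage vector by the sum of its components.\<close>
    then have "(\<Sum>i\<in>UNIV. norm ((T X - T X') $ i)) \<le> (\<Sum>i\<in>(UNIV::'s set). h * (real CARD('s) * \<alpha> * L) * dist X X')"
      by (rule sum_mono)
    also have "\<dots> = h * (real CARD('s) * (real CARD('s) * \<alpha> * L)) * dist X X'" by simp
    also have "\<dots> \<le> 1 / 2 * dist X X'" by (intro mult_right_mono h(3)) auto
    finally have "(\<Sum>i\<in>UNIV. norm ((T X - T X') $ i)) \<le> 1 / 2 * dist X X'" .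
    moreover have "norm (T X - T X') \<le> (\<Sum>i\<in>UNIV. norm ((T X - T X') $ i))"
      unfolding norm_vec_def by (rule L2_set_le_sum) simp
    ultimately show ?thesis by (simp add: dist_norm)
  qed
  ultimately obtain X where X: "X \<in> D" "T X = X"
    using Banach_fix[of D "1 / 2" T] by auto
  show thesis
  proof (rule that[of "\<lambda>i. X $ i"])
    show "X $ i = v + h *\<^sub>R (\<Sum>j\<in>UNIV. A $ i $ j *\<^sub>R G j (X $ j))" for i
      using arg_cong[OF X(2), of "\<lambda>X. X $ i"] by (simp add: T_def)
    show "X $ i \<in> cball v \<rho>" for i using X(1) by (simp add: D_def)
    show "norm (X $ i - v) \<le> h * (real CARD('s) * \<alpha> * B)" for i using bd[OF X(1), of i] X(2) by simp
  qed
qed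

section \<open>The row vector b^T A^-1 and stage increments\<close>

definition rk_weights :: "real^'s^'s \<Rightarrow> real^'s \<Rightarrow> 's \<Rightarrow> real" where
  "rk_weights A b j = (\<Sum>i\<in>UNIV. b $ i * matrix_inv A $ i $ j)"

lemma matrix_inv_left_sum:
  fixes A :: "real^'s^'s" assumes "invertible A"
  shows "(\<Sum>k\<in>UNIV. matrix_inv A $ i $ k * A $ k $ j) = (if i = j then 1 else 0)"
  using arg_cong[OF matrix_inv_left[OF assms], of "\<lambda>M. M $ i $ j"]
  by (simp add: matrix_matrix_mult_def mat_def)

lemma matrix_inv_right_sum:
  fixes A :: "real^'s^'s" assumes "invertible A"
  shows "(\<Sum>k\<in>UNIV. A $ i $ k * matrix_inv A $ k $ j) = (if i = j then 1 else 0)"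
  using arg_cong[OF matrix_inv_right[OF assms], of "\<lambda>M. M $ i $ j"]
  by (simp add: matrix_matrix_mult_def mat_def)

lemma rk_weights_mult:
  fixes A :: "real^'s^'s" assumes "invertible A"
  shows "(\<Sum>j\<in>UNIV. rk_weights A b j * A $ j $ l) = b $ l"
proof -
  have "(\<Sum>j\<in>UNIV. rk_weights A b j * A $ j $ l)
      = (\<Sum>j\<in>UNIV. \<Sum>i\<in>UNIV. b $ i * (matrix_inv A $ i $ j * A $ j $ l))"
    by (simp add: rk_weights_def sum_distrib_right mult.assoc)
  also have "\<dots> = (\<Sum>i\<in>UNIV. b $ i * (\<Sum>j\<in>UNIV. matrix_inv A $ i $ j * A $ j $ l))"
    by (subst sum.swap) (simp add: sum_distrib_left)
  also have "\<dots> = b $ l" by (simp add: matrix_inv_left_sum[OF assms] if_distrib cong: if_cong)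
  finally show ?thesis .
qed

lemma rk_update_eq: "rk_update A b w W = w + (\<Sum>j\<in>UNIV. rk_weights A b j *\<^sub>R (W j - w))"
  unfolding rk_update_def rk_weights_def by (subst sum.swap) (simp add: scaleR_left.sum)

lemma R_inf_eq: "R_inf A b = 1 - (\<Sum>j\<in>UNIV. rk_weights A b j)"
  unfolding R_inf_def rk_weights_def inner_vec_def matrix_vector_mult_def
  by (subst sum.swap) (simp add: sum_distrib_left)

text \<open>The update is affine in the old value and the stages, and \<open>R_inf\<close> is the
  coefficient of the old value. This is the contraction factor of the z-component.\<close>

lemma rk_update_diff:
  "rk_update A b w W - rk_update A b w' W'
    = R_inf A b *\<^sub>R (w - w') + (\<Sum>j\<in>UNIV. rk_weights A b j *\<^sub>R (W j - W' j))"
proof -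
  have "(\<Sum>j\<in>UNIV. rk_weights A b j *\<^sub>R (W j - w)) - (\<Sum>j\<in>UNIV. rk_weights A b j *\<^sub>R (W' j - w'))
    = (\<Sum>j\<in>UNIV. rk_weights A b j *\<^sub>R (W j - W' j)) - (\<Sum>j\<in>UNIV. rk_weights A b j) *\<^sub>R (w - w')"
    by (simp add: scaleR_left.sum sum_subtractf[symmetric] algebra_simps)
  then show ?thesis by (simp add: rk_update_eq R_inf_eq algebra_simps)
qed

text \<open>If \<open>b\<close> is row \<open>m\<close> of \<open>A\<close>, then b^T A^-1 is the
  unit row with entry 1 at \<open>m\<close>.\<close>

lemma rk_update_stiffly_accurate:
  fixes A :: "real^'s^'s" assumes "invertible A" "\<And>i. A $ m $ i = b $ i"
  shows "rk_update A b w W = W m"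
proof -
  have "rk_weights A b j = (if m = j then 1 else 0)" for j
    using matrix_inv_right_sum[OF assms(1), of m j] assms(2) by (simp add: rk_weights_def)
  then show ?thesis by (simp add: rk_update_eq if_distrib[of "\<lambda>x. x *\<^sub>R _"] cong: if_cong)
qed

text \<open>In the variables \<kappa> = A^-1 (Y - y_n) the residuals decouple: each involves a
  single increment, scaled by the diagonal entry, and the update becomes the usual sum with weights
  \<open>b\<close>.\<close>

lemma stage_increments:
  fixes A :: "real^'s^'s" and Y :: "'s \<Rightarrow> real^'y"
  assumes inv: "invertible A"
  obtains \<kappa> where "\<And>i. Y i = yn + (\<Sum>j\<in>UNIV. A $ i $ j *\<^sub>R \<kappa> j)"
    "rk_update A b yn Y = yn + (\<Sum>i\<in>UNIV. b $ i *\<^sub>R \<kappa> i)"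
    "\<And>f h (Z :: 's \<Rightarrow> real^'z) i. stage_residual A f h yn Y Z i = A $ i $ i *\<^sub>R (\<kappa> i - h *\<^sub>R f (Y i) (Z i))"
proof -
  define \<kappa> where "\<kappa> = (\<lambda>j. \<Sum>k\<in>UNIV. matrix_inv A $ j $ k *\<^sub>R (Y k - yn))"
  have 1: "(\<Sum>j\<in>UNIV. A $ i $ j *\<^sub>R \<kappa> j) = Y i - yn" for i
  proof -
    have "(\<Sum>j\<in>UNIV. A $ i $ j *\<^sub>R \<kappa> j)
        = (\<Sum>k\<in>UNIV. (\<Sum>j\<in>UNIV. A $ i $ j * matrix_inv A $ j $ k) *\<^sub>R (Y k - yn))"
      unfolding \<kappa>_def scaleR_sum_right scaleR_scaleR by (subst sum.swap) (simp add: scaleR_left.sum)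
    then show ?thesis
      by (simp add: matrix_inv_right_sum[OF inv] if_distrib[of "\<lambda>x. x *\<^sub>R _"] cong: if_cong)
  qed
  have 3: "stage_residual A f h yn Y Z i = A $ i $ i *\<^sub>R (\<kappa> i - h *\<^sub>R f (Y i) (Z i))"
    for f h and Z :: "'s \<Rightarrow> real^'z" and i
  proof -
    have "(\<Sum>j\<in>UNIV - {i}. \<Sum>k\<in>UNIV. (A $ i $ j * matrix_inv A $ j $ k) *\<^sub>R (Y k - yn))
        = (\<Sum>j\<in>UNIV - {i}. A $ i $ j *\<^sub>R \<kappa> j)"
      by (simp add: \<kappa>_def scaleR_sum_right)
    also have "\<dots> = Y i - yn - A $ i $ i *\<^sub>R \<kappa> i"
      using sum.remove[of UNIV i "\<lambda>j. A $ i $ j *\<^sub>R \<kappa> j"] 1[of i] by (simp add: algebra_simps)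
    finally show ?thesis by (simp add: stage_residual_def algebra_simps)
  qed
  show thesis
  proof (rule that[of \<kappa>])
    show "Y i = yn + (\<Sum>j\<in>UNIV. A $ i $ j *\<^sub>R \<kappa> j)" for i using 1[of i] by simp
    show "rk_update A b yn Y = yn + (\<Sum>i\<in>UNIV. b $ i *\<^sub>R \<kappa> i)"
      by (simp add: rk_update_def \<kappa>_def scaleR_sum_right)
  qed (rule 3)
qed

lemma constraint_increments:
  fixes A :: "real^'s^'s" and \<kappa> \<mu> :: "'s \<Rightarrow> 'a::real_vector"
  assumes inv: "invertible A" and eq: "\<And>i. (\<Sum>j\<in>UNIV. A $ i $ j *\<^sub>R \<kappa> j) = (\<Sum>j\<in>UNIV. A $ i $ j *\<^sub>R \<mu> j)"
  shows "\<kappa> l = \<mu> l"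
proof -
  have *: "(\<Sum>i\<in>UNIV. matrix_inv A $ l $ i *\<^sub>R (\<Sum>j\<in>UNIV. A $ i $ j *\<^sub>R \<nu> j)) = \<nu> l" for \<nu> :: "'s \<Rightarrow> 'a"
  proof -
    have "(\<Sum>i\<in>UNIV. matrix_inv A $ l $ i *\<^sub>R (\<Sum>j\<in>UNIV. A $ i $ j *\<^sub>R \<nu> j))
        = (\<Sum>j\<in>UNIV. (\<Sum>i\<in>UNIV. matrix_inv A $ l $ i * A $ i $ j) *\<^sub>R \<nu> j)"
      unfolding scaleR_sum_right scaleR_scaleR by (subst sum.swap) (simp add: scaleR_sum_left)
    then show ?thesis
      by (simp add: matrix_inv_left_sum[OF inv] if_distrib[of "\<lambda>x. x *\<^sub>R _"] cong: if_cong)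
  qed
  show ?thesis using *[of \<kappa>] *[of \<mu>] eq by simp
qed

section \<open>Consistency from B(q) and C(q)\<close>

lemma rk_weights_power:
  fixes A :: "real^'s^'s"
  assumes inv: "invertible A" and B: "B_cond b c q" and C: "C_cond A c q" and k: "k < q"
  shows "(\<Sum>j\<in>UNIV. rk_weights A b j * c $ j ^ Suc k) = 1"
proof -
  have 1: "(\<Sum>l\<in>UNIV. A $ j $ l * c $ l ^ k) = c $ j ^ Suc k / real (Suc k)" for j
    using bspec[OF spec[OF C[unfolded C_cond_def], of j], of "Suc k"] k by simp
  have 2: "(\<Sum>i\<in>UNIV. b $ i * c $ i ^ k) = 1 / real (Suc k)"
    using bspec[OF B[unfolded B_cond_def], of "Suc k"] k by simp
  \<comment> \<open>C(q) writes c^(k+1) as k+1 times A c^k; the weights turn \<open>A\<close> into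
    b^T, and B(q) evaluates the result. Hence the update reproduces polynomials of degree at most
    \<open>q\<close>.\<close>
  have "(\<Sum>j\<in>UNIV. rk_weights A b j * c $ j ^ Suc k)
      = (\<Sum>j\<in>UNIV. rk_weights A b j * (real (Suc k) * (\<Sum>l\<in>UNIV. A $ j $ l * c $ l ^ k)))"
    unfolding 1 by (intro sum.cong) (auto simp del: of_nat_Suc)
  also have "\<dots> = real (Suc k) * (\<Sum>l\<in>UNIV. (\<Sum>j\<in>UNIV. rk_weights A b j * A $ j $ l) * c $ l ^ k)"
    unfolding sum_distrib_left sum_distrib_right by (subst sum.swap) (simp add: mult_ac)
  also have "\<dots> = 1" unfolding rk_weights_mult[OF inv] 2 by (simp del: of_nat_Suc)
  finally show ?thesis .
qed

text \<open>By C(q) the quadrature in each row of \<open>A\<close> is exact on the part of degree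
  below \<open>q\<close> of the expansion of \<open>w'\<close>. Only remainders survive, with a
  constant independent of \<open>t\<close>.\<close>

lemma C_cond_defect:
  fixes A :: "real^'s^'s" and w :: "real \<Rightarrow> 'a::real_normed_vector"
  assumes C: "C_cond A c q" and w: "\<And>x. x \<in> {l<..<r} \<Longrightarrow> (w has_vector_derivative w' x) (at x)"
    and w': "Ck_on q {l<..<r} w'" and lr: "l < lo" "hi < r"
  shows "\<exists>M\<ge>0. \<forall>t h i. h \<ge> 0 \<longrightarrow> t \<in> {lo..hi} \<longrightarrow> (\<forall>j. t + c $ j * h \<in> {lo..hi}) \<longrightarrow>
    norm (w (t + c $ i * h) - (w t + h *\<^sub>R (\<Sum>j\<in>UNIV. A $ i $ j *\<^sub>R w' (t + c $ j * h)))) \<le> M * h ^ Suc q"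
proof -
  obtain M a where M: "M \<ge> 0" and a: "\<And>t t'. t \<in> {lo..hi} \<Longrightarrow> t' \<in> {lo..hi} \<Longrightarrow>
      norm (w' t' - (\<Sum>j<q. (t' - t) ^ j *\<^sub>R a t j)) \<le> M * \<bar>t' - t\<bar> ^ q"
    using Ck_on_Taylor[OF w' lr] by blast
  define K where "K = (\<Sum>i\<in>UNIV. M * \<bar>c $ i\<bar> ^ Suc q + (\<Sum>j\<in>UNIV. \<bar>A $ i $ j\<bar> * (M * \<bar>c $ j\<bar> ^ q)))"
  have K: "M * \<bar>c $ i\<bar> ^ Suc q + (\<Sum>j\<in>UNIV. \<bar>A $ i $ j\<bar> * (M * \<bar>c $ j\<bar> ^ q)) \<le> K" for i
    unfolding K_def
    by (rule member_le_sum[of i UNIV "\<lambda>i. M * \<bar>c $ i\<bar> ^ Suc q + (\<Sum>j\<in>UNIV. \<bar>A $ i $ j\<bar> * (M * \<bar>c $ j\<bar> ^ q))"])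
      (auto intro!: add_nonneg_nonneg sum_nonneg mult_nonneg_nonneg M)
  have "norm (w (t + c $ i * h) - (w t + h *\<^sub>R (\<Sum>j\<in>UNIV. A $ i $ j *\<^sub>R w' (t + c $ j * h)))) \<le> K * h ^ Suc q"
    if h: "h \<ge> 0" and t: "t \<in> {lo..hi}" "\<And>j. t + c $ j * h \<in> {lo..hi}" for t h i
  proof -
    define E where "E = (\<lambda>j. w' (t + c $ j * h) - (\<Sum>k<q. (c $ j * h) ^ k *\<^sub>R a t k))"
    have E: "norm (E j) \<le> M * \<bar>c $ j\<bar> ^ q * h ^ q" for j
      using a[OF t(1) t(2)[of j]] h by (simp add: E_def abs_mult power_mult_distrib mult.assoc)
    have "norm (w (t + c $ i * h) - w t - (\<Sum>k<q. ((t + c $ i * h - t) ^ Suc k / real (Suc k)) *\<^sub>R a t k))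
        \<le> M * \<bar>t + c $ i * h - t\<bar> ^ Suc q"
    proof (rule Taylor_integrate[OF w a M])
      have seg: "closed_segment t (t + c $ i * h) \<subseteq> {lo..hi}"
        using t(1) t(2)[of i] by (auto simp: closed_segment_eq_real_ivl)
      show "\<tau> \<in> {l<..<r}" if "\<tau> \<in> closed_segment t (t + c $ i * h)" for \<tau> using seg that lr by fastforce
      show "\<tau> \<in> {lo..hi}" if "\<tau> \<in> closed_segment t (t + c $ i * h)" for \<tau> using seg that by blast
    qed (rule t)
    then have T: "norm (w (t + c $ i * h) - w t - (\<Sum>k<q. ((c $ i * h) ^ Suc k / real (Suc k)) *\<^sub>R a t k))
        \<le> M * \<bar>c $ i\<bar> ^ Suc q * h ^ Suc q"
      using h by (simp add: abs_mult power_mult_distrib mult_ac)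
    have main: "h *\<^sub>R (\<Sum>j\<in>UNIV. A $ i $ j *\<^sub>R (\<Sum>k<q. (c $ j * h) ^ k *\<^sub>R a t k))
        = (\<Sum>k<q. ((c $ i * h) ^ Suc k / real (Suc k)) *\<^sub>R a t k)"
    proof -
      have Ck: "(\<Sum>j\<in>UNIV. A $ i $ j * c $ j ^ k) = c $ i ^ Suc k / real (Suc k)" if "k < q" for k
        using bspec[OF spec[OF C[unfolded C_cond_def], of i], of "Suc k"] that by simp
      have "h *\<^sub>R (\<Sum>j\<in>UNIV. A $ i $ j *\<^sub>R (\<Sum>k<q. (c $ j * h) ^ k *\<^sub>R a t k))
          = (\<Sum>k<q. (h ^ Suc k * (\<Sum>j\<in>UNIV. A $ i $ j * c $ j ^ k)) *\<^sub>R a t k)"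
        unfolding scaleR_sum_right scaleR_sum_left sum_distrib_left scaleR_scaleR
        by (subst sum.swap) (simp add: power_mult_distrib mult_ac)
      also have "\<dots> = (\<Sum>k<q. ((c $ i * h) ^ Suc k / real (Suc k)) *\<^sub>R a t k)"
        by (intro sum.cong refl) (simp add: Ck power_mult_distrib mult_ac)
      finally show ?thesis .
    qed
    have "w (t + c $ i * h) - (w t + h *\<^sub>R (\<Sum>j\<in>UNIV. A $ i $ j *\<^sub>R w' (t + c $ j * h)))
        = (w (t + c $ i * h) - w t - (\<Sum>k<q. ((c $ i * h) ^ Suc k / real (Suc k)) *\<^sub>R a t k))
          - h *\<^sub>R (\<Sum>j\<in>UNIV. A $ i $ j *\<^sub>R E j)"
      unfolding main[symmetric] E_def
      by (simp add: scaleR_diff_right sum_subtractf)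
    also have "norm \<dots> \<le> M * \<bar>c $ i\<bar> ^ Suc q * h ^ Suc q + h * (\<Sum>j\<in>UNIV. \<bar>A $ i $ j\<bar> * (M * \<bar>c $ j\<bar> ^ q * h ^ q))"
    proof (rule order_trans[OF norm_triangle_ineq4 add_mono[OF T]])
      have "norm (\<Sum>j\<in>UNIV. A $ i $ j *\<^sub>R E j) \<le> (\<Sum>j\<in>UNIV. \<bar>A $ i $ j\<bar> * (M * \<bar>c $ j\<bar> ^ q * h ^ q))"
        by (rule sum_norm_le) (simp add: mult_left_mono E)
      then show "norm (h *\<^sub>R (\<Sum>j\<in>UNIV. A $ i $ j *\<^sub>R E j)) \<le> h * (\<Sum>j\<in>UNIV. \<bar>A $ i $ j\<bar> * (M * \<bar>c $ j\<bar> ^ q * h ^ q))"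
        using h by (simp add: mult_left_mono)
    qed
    also have "\<dots> = (M * \<bar>c $ i\<bar> ^ Suc q + (\<Sum>j\<in>UNIV. \<bar>A $ i $ j\<bar> * (M * \<bar>c $ j\<bar> ^ q))) * h ^ Suc q"
      by (simp add: sum_distrib_left sum_distrib_right algebra_simps)
    also have "\<dots> \<le> K * h ^ Suc q" by (intro mult_right_mono K) (use h in auto)
    finally show ?thesis .
  qed
  moreover have "K \<ge> 0" unfolding K_def by (auto intro!: add_nonneg_nonneg sum_nonneg mult_nonneg_nonneg M)
  ultimately show ?thesis by blast
qed

lemma rk_update_defect:
  fixes A :: "real^'s^'s" and w :: "real \<Rightarrow> real^'m"
  assumes inv: "invertible A" and B: "B_cond b c q" and C: "C_cond A c q"
    and w: "Ck_on (Suc q) {l<..<r} w" and lr: "l < lo" "hi < r"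
  shows "\<exists>M\<ge>0. \<forall>t h. h \<ge> 0 \<longrightarrow> t \<in> {lo..hi} \<longrightarrow> t + h \<in> {lo..hi} \<longrightarrow> (\<forall>j. t + c $ j * h \<in> {lo..hi}) \<longrightarrow>
    norm (w (t + h) - rk_update A b (w t) (\<lambda>j. w (t + c $ j * h))) \<le> M * h ^ Suc q"
proof -
  obtain M a where M: "M \<ge> 0" and a: "\<And>t t'. t \<in> {lo..hi} \<Longrightarrow> t' \<in> {lo..hi} \<Longrightarrow>
      norm (w t' - (\<Sum>j<Suc q. (t' - t) ^ j *\<^sub>R a t j)) \<le> M * \<bar>t' - t\<bar> ^ Suc q"
    using Ck_on_Taylor[OF w lr] by blast
  define K where "K = M + (\<Sum>j\<in>UNIV. \<bar>rk_weights A b j\<bar> * (M * \<bar>c $ j\<bar> ^ Suc q))"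
  have "norm (w (t + h) - rk_update A b (w t) (\<lambda>j. w (t + c $ j * h))) \<le> K * h ^ Suc q"
    if h: "h \<ge> 0" and t: "t \<in> {lo..hi}" "t + h \<in> {lo..hi}" "\<And>j. t + c $ j * h \<in> {lo..hi}" for t h
  proof -
    define E where "E = (\<lambda>s. w (t + s) - w t - (\<Sum>k<q. s ^ Suc k *\<^sub>R a t (Suc k)))"
    \<comment> \<open>The expansion taken at its own base point: the remainder vanishes and only the
      term with exponent 0 remains.\<close>
    have "w t = a t 0" using a[OF t(1) t(1)] by (simp add: sum.lessThan_Suc_shift del: sum.lessThan_Suc)
    then have E: "norm (E s) \<le> M * \<bar>s\<bar> ^ Suc q" if "t + s \<in> {lo..hi}" for s
      using a[OF t(1) that] by (simp add: E_def sum.lessThan_Suc_shift diff_diff_eq del: sum.lessThan_Suc)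
    have "(\<Sum>j\<in>UNIV. rk_weights A b j *\<^sub>R (\<Sum>k<q. (c $ j * h) ^ Suc k *\<^sub>R a t (Suc k)))
        = (\<Sum>k<q. (h ^ Suc k * (\<Sum>j\<in>UNIV. rk_weights A b j * c $ j ^ Suc k)) *\<^sub>R a t (Suc k))"
      unfolding scaleR_sum_right scaleR_sum_left sum_distrib_left scaleR_scaleR
      by (subst sum.swap) (simp add: power_mult_distrib mult_ac)
    also have "\<dots> = (\<Sum>k<q. h ^ Suc k *\<^sub>R a t (Suc k))"
      by (intro sum.cong refl) (simp add: rk_weights_power[OF inv B C] del: power_Suc)
    finally have main: "(\<Sum>j\<in>UNIV. rk_weights A b j *\<^sub>R (\<Sum>k<q. (c $ j * h) ^ Suc k *\<^sub>R a t (Suc k)))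
        = (\<Sum>k<q. h ^ Suc k *\<^sub>R a t (Suc k))" .
    have "w (t + h) - rk_update A b (w t) (\<lambda>j. w (t + c $ j * h))
        = E h - (\<Sum>j\<in>UNIV. rk_weights A b j *\<^sub>R E (c $ j * h))"
    proof -
      have "(\<Sum>j\<in>UNIV. rk_weights A b j *\<^sub>R E (c $ j * h))
          = (\<Sum>j\<in>UNIV. rk_weights A b j *\<^sub>R (w (t + c $ j * h) - w t)) - (\<Sum>k<q. h ^ Suc k *\<^sub>R a t (Suc k))"
        unfolding main[symmetric] E_def by (simp add: scaleR_diff_right sum_subtractf)
      then show ?thesis by (simp add: rk_update_eq E_def)
    qed
    also have "norm \<dots> \<le> M * h ^ Suc q + (\<Sum>j\<in>UNIV. \<bar>rk_weights A b j\<bar> * (M * \<bar>c $ j * h\<bar> ^ Suc q))"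
    proof (rule order_trans[OF norm_triangle_ineq4 add_mono])
      show "norm (E h) \<le> M * h ^ Suc q" using E[OF t(2)] h by simp
      show "norm (\<Sum>j\<in>UNIV. rk_weights A b j *\<^sub>R E (c $ j * h))
          \<le> (\<Sum>j\<in>UNIV. \<bar>rk_weights A b j\<bar> * (M * \<bar>c $ j * h\<bar> ^ Suc q))"
        by (rule sum_norm_le) (use E[OF t(3)] in \<open>simp add: mult_left_mono del: power_Suc\<close>)
    qed
    also have "\<dots> = K * h ^ Suc q"
      using h by (simp add: K_def distrib_right distrib_left sum_distrib_right sum_distrib_left abs_mult power_mult_distrib mult_ac)
    finally show ?thesis .
  qed
  moreover have "K \<ge> 0" unfolding K_def by (auto intro!: add_nonneg_nonneg sum_nonneg mult_nonneg_nonneg M)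
  ultimately show ?thesis by blast
qed


section \<open>Error propagation\<close>

text \<open>The one-step bounds hold only while both errors are at most \<open>d\<close>, so the two
  estimates must be proved in one induction. The \<open>y\<close>-errors accumulate over
  \<open>N\<close> steps with N h at most C; in the \<open>z\<close>-recursion the local errors form
  a geometric series, so no power of \<open>h\<close> is lost.\<close>

lemma coupled_error_recursion:
  fixes e \<zeta> :: "nat \<Rightarrow> real" and P :: "nat \<Rightarrow> bool"
  assumes K: "K \<ge> 0" and \<rho>: "0 \<le> \<rho>" "\<rho> < 1" and pq: "p \<ge> q + 1"
    and E: "E = C * K * exp (K * C)" and D: "D = K * (E + 1) / (1 - \<rho>)"
    and h: "0 < h" "h \<le> 1" "E * h \<le> d" "D * h \<le> d" and N: "real N * h \<le> C"
    and init: "e 0 = 0" "\<zeta> 0 = 0" "P 0"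
    and step: "\<And>n. n < N \<Longrightarrow> P n \<Longrightarrow> e n \<le> d \<Longrightarrow> \<zeta> n \<le> d \<Longrightarrow>
      P (Suc n) \<and> e (Suc n) \<le> (1 + K * h) * e n + K * h ^ (p + 1) \<and>
      \<zeta> (Suc n) \<le> \<rho> * \<zeta> n + K * (e n + h ^ (q + 1))"
    and n: "n \<le> N"
  shows "P n \<and> e n \<le> E * h ^ p \<and> \<zeta> n \<le> D * h ^ (q + 1)"
proof -
  have C: "C \<ge> 0" using N h(1) by (meson mult_nonneg_nonneg of_nat_0_le_iff less_imp_le order_trans)
  have E0: "E \<ge> 0" using C K by (simp add: E)
  have D0: "D \<ge> 0" using E0 K \<rho> by (simp add: D)
  have hp: "h ^ p \<le> h" using power_decreasing[of 1 p h] h pq by simp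
  have hpq: "h ^ p \<le> h ^ (q + 1)" using power_decreasing[of "q + 1" p h] h pq by simp
  have hq: "h ^ (q + 1) \<le> h" using power_decreasing[of 1 "q + 1" h] h by simp
  have bound: "real m * (K * h ^ (p + 1)) * (1 + K * h) ^ m \<le> E * h ^ p" if "m \<le> N" for m
  proof -
    have mh: "real m * h \<le> C" using that N h(1) by (meson mult_right_mono of_nat_le_iff less_imp_le order_trans)
    have "(1 + K * h) ^ m \<le> exp (K * h) ^ m" using K h(1) by (intro power_mono exp_ge_add_one_self) auto
    also have "\<dots> = exp (K * (real m * h))" by (simp add: exp_of_nat_mult[symmetric] mult_ac)
    also have "\<dots> \<le> exp (K * C)" using mh K by (simp add: mult_left_mono)
    finally have 1: "(1 + K * h) ^ m \<le> exp (K * C)" .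
    have 2: "real m * (K * h ^ (p + 1)) \<le> C * K * h ^ p"
    proof -
      have "real m * (K * h ^ (p + 1)) = (real m * h) * (K * h ^ p)" by simp
      also have "\<dots> \<le> C * (K * h ^ p)" using mh K h(1) by (intro mult_right_mono) auto
      finally show ?thesis by simp
    qed
    have "real m * (K * h ^ (p + 1)) * (1 + K * h) ^ m \<le> C * K * h ^ p * exp (K * C)"
      by (rule mult_mono[OF 2 1]) (use K C h(1) in auto)
    then show ?thesis by (simp add: E mult_ac)
  qed
  \<comment> \<open>The bound with \<open>E\<close> does not reproduce itself under the recursion;
    the version growing with \<open>n\<close> does, and \<open>bound\<close> caps it
    uniformly.\<close>
  have "P n \<and> e n \<le> real n * (K * h ^ (p + 1)) * (1 + K * h) ^ n \<and> \<zeta> n \<le> D * h ^ (q + 1)"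
    using n
  proof (induction n)
    case 0
    then show ?case using init D0 h by simp
  next
    case (Suc n)
    then have IH: "P n" "e n \<le> real n * (K * h ^ (p + 1)) * (1 + K * h) ^ n" "\<zeta> n \<le> D * h ^ (q + 1)"
      and nN: "n < N" by auto
    have en: "e n \<le> E * h ^ p" using IH(2) bound[of n] nN by linarith
    have "e n \<le> d" using en mult_left_mono[OF hp E0] h(3) by linarith
    moreover have "\<zeta> n \<le> d" using IH(3) mult_left_mono[OF hq D0] h(4) by linarith
    ultimately have st: "P (Suc n)" "e (Suc n) \<le> (1 + K * h) * e n + K * h ^ (p + 1)"
      "\<zeta> (Suc n) \<le> \<rho> * \<zeta> n + K * (e n + h ^ (q + 1))" using step[OF nN IH(1)] by auto
    have Kh: "1 \<le> 1 + K * h" using K h(1) by simp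
    have "(1 + K * h) * e n \<le> (1 + K * h) * (real n * (K * h ^ (p + 1)) * (1 + K * h) ^ n)"
      using IH(2) Kh by (intro mult_left_mono) auto
    moreover have "K * h ^ (p + 1) * 1 \<le> K * h ^ (p + 1) * (1 + K * h) ^ Suc n"
      by (rule mult_left_mono[OF one_le_power[OF Kh]]) (use K h(1) in auto)
    ultimately have "e (Suc n) \<le> real (Suc n) * (K * h ^ (p + 1)) * (1 + K * h) ^ Suc n"
      using st(2) by (simp add: algebra_simps)
    moreover have "\<zeta> (Suc n) \<le> D * h ^ (q + 1)"
    proof -
      have "e n \<le> E * h ^ (q + 1)" using en mult_left_mono[OF hpq E0] by linarith
      then have "K * (e n + h ^ (q + 1)) \<le> K * ((E + 1) * h ^ (q + 1))"
        using K by (intro mult_left_mono) (auto simp: algebra_simps)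
      moreover have "\<rho> * \<zeta> n \<le> \<rho> * (D * h ^ (q + 1))" using IH(3) \<rho> by (intro mult_left_mono) auto
      ultimately have "\<zeta> (Suc n) \<le> \<rho> * (D * h ^ (q + 1)) + K * ((E + 1) * h ^ (q + 1))" using st(3) by linarith
      also have "\<dots> = (\<rho> * D + K * (E + 1)) * h ^ (q + 1)" by (simp add: algebra_simps)
      \<comment> \<open>\<open>D\<close> was chosen as the fixed point of the affine recursion for
        the scaled \<open>z\<close>-error.\<close>
      also have "\<rho> * D + K * (E + 1) = D"
      proof -
        have "D * (1 - \<rho>) = K * (E + 1)" using \<rho> by (simp add: D)
        then show ?thesis by (simp add: algebra_simps)
      qed
      finally show ?thesis .
    qed
    ultimately show ?case using st(1) by blast
  qed
  then show ?thesis using bound[OF n] by linarith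
qed

text \<open>The perturbed step from \<open>v\<close> is compared with the exact step from
  \<open>y t\<close>. Stage stability bounds the difference of the two steps, and the order of the
  scheme bounds the error of the exact one.\<close>

lemma rk_step_error:
  fixes A :: "real^'s^'s" and F :: "real \<times> (real^'n) \<Rightarrow> real^'n" and y :: "real \<Rightarrow> real^'n"
  assumes M0: "\<epsilon>0 > 0" "h0 > 0" "\<forall>t h X. 0 < h \<and> h \<le> h0 \<and> 0 \<le> t \<and> t + h \<le> C \<and>
       (\<forall>i. (t + c $ i * h, X i) \<in> S \<and>
          X i = y t + h *\<^sub>R (\<Sum>j\<in>UNIV. A $ i $ j *\<^sub>R F (t + c $ j * h, X j)) \<and> norm (X i - y t) \<le> \<epsilon>0) \<longrightarrow>
       norm (y (t + h) - (y t + h *\<^sub>R (\<Sum>i\<in>UNIV. b $ i *\<^sub>R F (t + c $ i * h, X i)))) \<le> M0 * h ^ (p + 1)"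
    and d: "d > 0" "\<And>t. t \<in> {0..C} \<Longrightarrow> cball (t, y t) d \<subseteq> S"
    and L: "L \<ge> 0" "\<And>t x x'. t \<in> {0..C} \<Longrightarrow> x \<in> cball (t, y t) d \<Longrightarrow> x' \<in> cball (t, y t) d \<Longrightarrow>
        norm (F x - F x') \<le> L * norm (x - x')"
    and B0: "\<And>t. t \<in> {0..C} \<Longrightarrow> norm (F (t, y t)) \<le> B0"
  obtains h1 K where "h1 > 0" "K \<ge> 0"
    "\<And>t h v Y \<delta> \<eta>. 0 < h \<Longrightarrow> h \<le> h1 \<Longrightarrow> 0 \<le> t \<Longrightarrow> t + h \<le> C \<Longrightarrow>
      (\<And>i. (t + c $ i * h, Y i) \<in> cball (t, y t) d) \<Longrightarrow>
      (\<And>i. Y i = v + h *\<^sub>R (\<Sum>j\<in>UNIV. A $ i $ j *\<^sub>R (F (t + c $ j * h, Y j) + \<delta> j))) \<Longrightarrow>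
      (\<And>j. norm (\<delta> j) \<le> \<eta>) \<Longrightarrow>
      norm (v + h *\<^sub>R (\<Sum>i\<in>UNIV. b $ i *\<^sub>R (F (t + c $ i * h, Y i) + \<delta> i)) - y (t + h))
        \<le> (1 + K * h) * norm (v - y t) + K * (h * \<eta>) + K * h ^ (p + 1)"
proof -
  define \<alpha> where "\<alpha> = (\<Sum>i\<in>UNIV. \<Sum>j\<in>UNIV. \<bar>A $ i $ j\<bar>)"
  define \<beta> where "\<beta> = (\<Sum>i\<in>UNIV. \<bar>b $ i\<bar>)"
  define \<gamma> where "\<gamma> = (\<Sum>i\<in>UNIV. \<bar>c $ i\<bar>)"
  let ?s = "real CARD('s)"
  have \<alpha>: "\<bar>A $ i $ j\<bar> \<le> \<alpha>" for i j
    unfolding \<alpha>_def by (rule abs_matrix_entry_le_sum)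
  have \<beta>: "\<bar>b $ i\<bar> \<le> \<beta>" for i
    unfolding \<beta>_def by (rule member_le_sum[of i UNIV "\<lambda>i. \<bar>b $ i\<bar>"]) auto
  have \<gamma>: "\<bar>c $ i\<bar> \<le> \<gamma>" for i
    unfolding \<gamma>_def by (rule member_le_sum[of i UNIV "\<lambda>i. \<bar>c $ i\<bar>"]) auto
  have nn: "\<alpha> \<ge> 0" "\<beta> \<ge> 0" "\<gamma> \<ge> 0" using \<alpha> \<beta> \<gamma> abs_ge_zero order_trans by blast+
  define B where "B = \<bar>B0\<bar> + L * d"
  have B: "B \<ge> 0" using L(1) d(1) by (simp add: B_def)
  \<comment> \<open>Half of the radius \<open>d\<close> is left for the shift in time from
    \<open>t\<close> to the node; \<open>\<epsilon>0\<close> is the closeness of stages demanded by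
    the order estimate.\<close>
  define \<rho> where "\<rho> = min (d / 2) \<epsilon>0"
  have \<rho>: "\<rho> > 0" "\<rho> \<le> d / 2" "\<rho> \<le> \<epsilon>0" using d(1) M0(1) by (auto simp: \<rho>_def)
  \<comment> \<open>The bounds beyond 1 and \<open>h0\<close> ensure, in turn, that nodes move by at
    most \<open>d / 2\<close>, that the exact stages stay within \<open>\<rho>\<close>, and that the
    stage map contracts.\<close>
  define h1 where "h1 = min (min 1 h0) (min (d / (2 * (\<gamma> + 1)))
    (min (\<rho> / (?s * \<alpha> * B + 1)) (1 / (2 * (?s * (?s * \<alpha> * L) + 1)))))"
  have pos: "?s * \<alpha> * B + 1 > 0" "?s * (?s * \<alpha> * L) + 1 > 0" "\<gamma> + 1 > 0"
    using nn B L(1) by (auto intro!: add_nonneg_pos mult_nonneg_nonneg)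
  have "d / (2 * (\<gamma> + 1)) > 0" "\<rho> / (?s * \<alpha> * B + 1) > 0" "1 / (2 * (?s * (?s * \<alpha> * L) + 1)) > 0"
    using pos d(1) \<rho>(1) by auto
  then have h1: "h1 > 0" "h1 \<le> 1" "h1 \<le> h0" "h1 \<le> d / (2 * (\<gamma> + 1))" "h1 \<le> \<rho> / (?s * \<alpha> * B + 1)"
    "h1 \<le> 1 / (2 * (?s * (?s * \<alpha> * L) + 1))"
    unfolding h1_def using M0(2) by (simp_all add: min_le_iff_disj)
  \<comment> \<open>The summands account for the starting error passing through the stages, for the
    perturbations passing through the stages and entering the update directly, and for the local
    error.\<close>
  define K where "K = \<beta> * L * (2 * ?s) + (\<beta> * L * (2 * (?s * (?s * \<alpha>))) + ?s * \<beta>) + \<bar>M0\<bar>"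
  show thesis
  proof (rule that[OF h1(1)])
    show "K \<ge> 0" unfolding K_def using nn L(1) by (intro add_nonneg_nonneg mult_nonneg_nonneg) auto
    fix t h v Y \<delta> \<eta>
    assume h: "0 < h" "h \<le> h1" and t: "0 \<le> t" "t + h \<le> C"
      and Yd: "\<And>i. (t + c $ i * h, Y i) \<in> cball (t, y t) d"
      and Y: "\<And>i. Y i = v + h *\<^sub>R (\<Sum>j\<in>UNIV. A $ i $ j *\<^sub>R (F (t + c $ j * h, Y j) + \<delta> j))"
      and \<delta>: "\<And>j. norm (\<delta> j) \<le> \<eta>"
    have tC: "t \<in> {0..C}" using t h by auto
    have \<eta>: "\<eta> \<ge> 0" using \<delta> norm_ge_zero order_trans by blast
    have "h * (2 * (\<gamma> + 1)) \<le> d" using order_trans[OF h(2) h1(4)] pos by (simp add: pos_le_divide_eq)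
    then have "2 * (\<gamma> * h) \<le> d" using h(1) by (simp add: algebra_simps)
    then have hc: "\<bar>c $ i\<bar> * h \<le> d / 2" for i
      using mult_right_mono[OF \<gamma>[of i] less_imp_le[OF h(1)]] by linarith
    have "h * (?s * \<alpha> * B + 1) \<le> \<rho>" using order_trans[OF h(2) h1(5)] pos by (simp add: pos_le_divide_eq)
    then have hB: "h * (?s * \<alpha> * B) \<le> \<rho>" using h(1) by (simp add: algebra_simps)
    have "h * (2 * (?s * (?s * \<alpha> * L) + 1)) \<le> 1" using order_trans[OF h(2) h1(6)] pos by (simp add: pos_le_divide_eq)
    then have hL: "h * (?s * (?s * \<alpha> * L)) \<le> 1 / 2" using h(1) by (simp add: algebra_simps)
    have s1: "?s \<ge> 1" by (simp add: Suc_leI)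
    have "1 * (?s * \<alpha> * L) \<le> ?s * (?s * \<alpha> * L)" using s1 nn L(1) by (intro mult_right_mono) auto
    from mult_left_mono[OF this less_imp_le[OF h(1)]] hL
    have hL': "h * (?s * \<alpha> * L) \<le> 1 / 2" unfolding mult_1 by (rule order_trans)
    have ball: "(t + c $ j * h, x) \<in> cball (t, y t) d" if "x \<in> cball (y t) \<rho>" for x j
    proof -
      have "dist (t, y t) (t + c $ j * h, x) \<le> dist t (t + c $ j * h) + dist (y t) x"
        by (simp add: dist_Pair_Pair sqrt_sum_squares_le_sum)
      also have "\<dots> \<le> d / 2 + d / 2" using that \<rho>(2) hc[of j] h(1)
        by (intro add_mono) (auto simp: dist_real_def abs_mult)
      finally show ?thesis by simp
    qed
    have Gd: "norm (F (t + c $ j * h, x)) \<le> B" if "x \<in> cball (y t) \<rho>" for x j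
    proof -
      have "norm (F (t + c $ j * h, x) - F (t, y t)) \<le> L * norm ((t + c $ j * h, x) - (t, y t))"
        using ball[OF that] d(1) by (intro L(2)[OF tC]) auto
      also have "\<dots> \<le> L * d"
        using ball[OF that, of j] unfolding mem_cball dist_norm norm_minus_commute[of "(t, y t)" "(t + c $ j * h, x)"]
        by (rule mult_left_mono[OF _ L(1)])
      finally show ?thesis using B0[OF tC] norm_triangle_sub[of "F (t + c $ j * h, x)" "F (t, y t)"]
        by (simp add: B_def)
    qed
    have GL: "norm (F (t + c $ j * h, x) - F (t + c $ j * h, x')) \<le> L * norm (x - x')"
      if "x \<in> cball (y t) \<rho>" "x' \<in> cball (y t) \<rho>" for x x' j
      using L(2)[OF tC ball[OF that(1)] ball[OF that(2)], of j j] by (simp add: norm_Pair)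
    obtain X where X: "\<And>i. X i = y t + h *\<^sub>R (\<Sum>j\<in>UNIV. A $ i $ j *\<^sub>R F (t + c $ j * h, X j))"
      "\<And>i. X i \<in> cball (y t) \<rho>"
    proof (rule stages_exist[of A \<alpha> "y t" \<rho> "\<lambda>j x. F (t + c $ j * h, x)" B L h,
          OF \<alpha> Gd GL \<rho>(1) L(1) less_imp_le[OF h(1)] hB hL])
      fix X
      assume "\<And>i. X i = y t + h *\<^sub>R (\<Sum>j\<in>UNIV. A $ i $ j *\<^sub>R F (t + c $ j * h, X j))"
        "\<And>i. X i \<in> cball (y t) \<rho>"
      then show ?thesis by (rule that)
    qed
    have XL: "norm (F (t + c $ j * h, Y j) - F (t + c $ j * h, X j)) \<le> L * norm (Y j - X j)" for j
      using L(2)[OF tC Yd[of j] ball[OF X(2)[of j], of j]] by (simp add: norm_Pair)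
    define H where "H = (\<lambda>i. h *\<^sub>R (\<Sum>j\<in>UNIV. A $ i $ j *\<^sub>R \<delta> j))"
    have H: "norm (H i) \<le> h * (?s * \<alpha> * \<eta>)" for i
    proof -
      have "norm (\<Sum>j\<in>UNIV. A $ i $ j *\<^sub>R \<delta> j) \<le> (\<Sum>j\<in>(UNIV::'s set). \<alpha> * \<eta>)"
        by (rule sum_norm_le) (use mult_mono[OF \<alpha> \<delta>] nn in auto)
      then show ?thesis using h(1) by (simp add: H_def mult_left_mono mult.assoc)
    qed
    have "(\<Sum>i\<in>UNIV. norm (Y i - X i)) \<le> 2 * (?s * norm (v - y t) + (\<Sum>i\<in>UNIV. norm (H i - 0)))"
    proof (rule stage_stability[OF \<alpha> _ _ XL L(1) less_imp_le[OF h(1)] hL'])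
      show "Y i = v + h *\<^sub>R (\<Sum>j\<in>UNIV. A $ i $ j *\<^sub>R F (t + c $ j * h, Y j)) + H i" for i
        by (subst Y) (simp add: H_def scaleR_add_right sum.distrib)
      show "X i = y t + h *\<^sub>R (\<Sum>j\<in>UNIV. A $ i $ j *\<^sub>R F (t + c $ j * h, X j)) + 0" for i
        unfolding add_0_right by (rule X(1))
    qed
    also have "(\<Sum>i\<in>UNIV. norm (H i - 0)) \<le> (\<Sum>i\<in>(UNIV::'s set). h * (?s * \<alpha> * \<eta>))"
      by (rule sum_mono) (simp add: H)
    finally have YX: "(\<Sum>i\<in>UNIV. norm (Y i - X i)) \<le> 2 * (?s * norm (v - y t) + ?s * (h * (?s * \<alpha> * \<eta>)))"
      by simp
    have loc: "norm (y (t + h) - (y t + h *\<^sub>R (\<Sum>i\<in>UNIV. b $ i *\<^sub>R F (t + c $ i * h, X i)))) \<le> M0 * h ^ (p + 1)"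
    proof (rule M0(3)[rule_format], intro conjI allI)
      show "h \<le> h0" using h(2) h1(3) by simp
      fix i
      show "(t + c $ i * h, X i) \<in> S" using ball[OF X(2)] d(2)[OF tC] by blast
      show "X i = y t + h *\<^sub>R (\<Sum>j\<in>UNIV. A $ i $ j *\<^sub>R F (t + c $ j * h, X j))" by (rule X(1))
      show "norm (X i - y t) \<le> \<epsilon>0" using X(2)[of i] \<rho>(3) by (simp add: dist_norm norm_minus_commute)
    qed (use h t in auto)
    have bsum: "norm (\<Sum>i\<in>UNIV. b $ i *\<^sub>R (F (t + c $ i * h, Y i) - F (t + c $ i * h, X i) + \<delta> i))
        \<le> \<beta> * L * (\<Sum>i\<in>UNIV. norm (Y i - X i)) + ?s * \<beta> * \<eta>"
    proof -
      have "norm (\<Sum>i\<in>UNIV. b $ i *\<^sub>R (F (t + c $ i * h, Y i) - F (t + c $ i * h, X i) + \<delta> i))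
        \<le> (\<Sum>i\<in>UNIV. \<beta> * (L * norm (Y i - X i) + \<eta>))"
      proof (rule sum_norm_le)
        fix i
        have "norm (F (t + c $ i * h, Y i) - F (t + c $ i * h, X i) + \<delta> i) \<le> L * norm (Y i - X i) + \<eta>"
          by (rule norm_triangle_le[OF add_mono[OF XL \<delta>]])
        then show "norm (b $ i *\<^sub>R (F (t + c $ i * h, Y i) - F (t + c $ i * h, X i) + \<delta> i))
            \<le> \<beta> * (L * norm (Y i - X i) + \<eta>)"
          using mult_mono[OF \<beta>[of i]] nn by simp
      qed
      also have "\<dots> = \<beta> * L * (\<Sum>i\<in>UNIV. norm (Y i - X i)) + ?s * \<beta> * \<eta>"
        by (simp add: sum.distrib distrib_left sum_distrib_left mult.assoc)
      finally show ?thesis .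
    qed
    let ?e = "norm (v - y t)"
    \<comment> \<open>Starting error, plus the effect of differing stages and perturbations, minus
      the local error of the exact step.\<close>
    have "v + h *\<^sub>R (\<Sum>i\<in>UNIV. b $ i *\<^sub>R (F (t + c $ i * h, Y i) + \<delta> i)) - y (t + h)
      = (v - y t) + h *\<^sub>R (\<Sum>i\<in>UNIV. b $ i *\<^sub>R (F (t + c $ i * h, Y i) - F (t + c $ i * h, X i) + \<delta> i))
        - (y (t + h) - (y t + h *\<^sub>R (\<Sum>i\<in>UNIV. b $ i *\<^sub>R F (t + c $ i * h, X i))))"
      by (simp add: scaleR_add_right scaleR_diff_right sum.distrib sum_subtractf)
    also have "norm \<dots> \<le> (?e + h * (\<beta> * L * (\<Sum>i\<in>UNIV. norm (Y i - X i)) + ?s * \<beta> * \<eta>)) + M0 * h ^ (p + 1)"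
      by (rule order_trans[OF norm_triangle_ineq4 add_mono[OF norm_triangle_le[OF add_left_mono] loc]])
        (use bsum h(1) in \<open>simp add: mult_left_mono\<close>)
    also have "\<dots> \<le> (?e + h * (\<beta> * L * (2 * (?s * ?e + ?s * (h * (?s * \<alpha> * \<eta>)))) + ?s * \<beta> * \<eta>)) + M0 * h ^ (p + 1)"
      using YX nn L(1) h(1) by (intro add_mono mult_left_mono order_refl) auto
    also have "\<dots> = ?e + (\<beta> * L * (2 * ?s)) * (h * ?e) + (\<beta> * L * (2 * (?s * (?s * \<alpha>))) * h + ?s * \<beta>) * (h * \<eta>)
        + M0 * h ^ (p + 1)"
      by (simp add: algebra_simps)
    also have "\<dots> \<le> ?e + K * (h * ?e) + K * (h * \<eta>) + K * h ^ (p + 1)"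
    proof -
      have k1: "\<beta> * L * (2 * ?s) \<le> K" unfolding K_def using nn L(1) by auto
      have "\<beta> * L * (2 * (?s * (?s * \<alpha>))) * h \<le> \<beta> * L * (2 * (?s * (?s * \<alpha>))) * 1"
        using h(2) h1(2) nn L(1) by (intro mult_left_mono) auto
      moreover have "0 \<le> \<beta> * L * (2 * ?s)" using nn L(1) by auto
      ultimately have k2: "\<beta> * L * (2 * (?s * (?s * \<alpha>))) * h + ?s * \<beta> \<le> K" unfolding K_def by linarith
      have "M0 \<le> \<bar>M0\<bar>" by simp
      also have "\<dots> \<le> K" unfolding K_def using nn L(1) by auto
      finally have k3: "M0 \<le> K" .
      show ?thesis using k1 k2 k3 h(1) \<eta> by (intro add_mono mult_right_mono order_refl) auto
    qed
    finally show "norm (v + h *\<^sub>R (\<Sum>i\<in>UNIV. b $ i *\<^sub>R (F (t + c $ i * h, Y i) + \<delta> i)) - y (t + h))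
        \<le> (1 + K * h) * ?e + K * (h * \<eta>) + K * h ^ (p + 1)" by (simp add: algebra_simps)
  qed
qed


section \<open>The index 2 problem\<close>

text \<open>The values of the smooth extension \<open>w\<close> at the nodes serve as reference
  stages. They satisfy the stage equations up to O(h^(q+1)), and \<open>\<zeta>\<close>, later the
  map recovering z from (t, y), is consistent along them to the same order.\<close>

lemma solution_stage_defects:
  fixes A :: "real^'s^'s" and F :: "real \<times> (real^'n) \<Rightarrow> real^'n" and \<zeta> :: "real \<times> (real^'n) \<Rightarrow> real^'m"
  assumes inv: "invertible A" and B: "B_cond b c q" and Cc: "C_cond A c q"
    and C: "C > 0" and S: "open S" and F: "Ck_on q S F" and \<zeta>: "Ck_on (Suc q) S \<zeta>"
    and y: "\<And>t. t \<in> {0..C} \<Longrightarrow> (t, y t) \<in> S"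
      "\<And>t. t \<in> {0..C} \<Longrightarrow> (y has_vector_derivative F (t, y t)) (at t within {0..C})"
    and d: "d > 0"
  shows "\<exists>h1>0. \<exists>K\<ge>0. \<exists>w. \<forall>t h. 0 < h \<and> h \<le> h1 \<and> t \<in> {0..C} \<longrightarrow>
    (\<forall>i. (t + c $ i * h, w (t + c $ i * h)) \<in> cball (t, y t) d \<and>
       norm (w (t + c $ i * h) - (y t + h *\<^sub>R (\<Sum>j\<in>UNIV. A $ i $ j *\<^sub>R F (t + c $ j * h, w (t + c $ j * h)))))
         \<le> K * h ^ Suc q) \<and>
    (t + h \<le> C \<longrightarrow> norm (\<zeta> (t + h, y (t + h)) - rk_update A b (\<zeta> (t, y t)) (\<lambda>j. \<zeta> (t + c $ j * h, w (t + c $ j * h))))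
         \<le> K * h ^ Suc q)"
proof -
  obtain \<delta> w where \<delta>: "\<delta> > 0" and w: "Ck_on (Suc q) {-\<delta><..<C + \<delta>} w" "\<And>t. t \<in> {0..C} \<Longrightarrow> w t = y t"
    using solution_Ck_extension[OF C S F y order_refl] by blast
  let ?I = "{-\<delta><..<C + \<delta>}"
  let ?T = "?I \<inter> (\<lambda>t. (t, w t)) -` S"
  have "open ?T"
    by (intro continuous_open_preimage S continuous_on_Pair continuous_on_id Ck_on_continuous[OF w(1)]) auto
  moreover have "{0..C} \<subseteq> ?T" using w(2) y(1) \<delta> by auto
  ultimately obtain e where e: "e > 0" and sub: "{-e..C + e} \<subseteq> ?T"
    using open_contains_Icc_enlargement[OF _ _ C] by blast
  let ?J = "{-e<..<C + e}" and ?lo = "-(e / 2)" and ?hi = "C + e / 2"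
  have JI: "?J \<subseteq> ?I" using sub by auto
  have JS: "(t, w t) \<in> S" if "t \<in> ?J" for t using subsetD[OF sub, of t] that by auto
  have lohi: "-e < ?lo" "?hi < C + e" using e by auto
  have wJ: "Ck_on (Suc q) ?J w" by (rule Ck_on_subset[OF w(1) JI])
  obtain w' where w': "\<And>x. x \<in> ?J \<Longrightarrow> (w has_vector_derivative w' x) (at x)" "Ck_on q ?J w'"
    using wJ by (elim Ck_on_real_SucE) (rule that; assumption)
  have graph: "Ck_on (Suc q) ?J (\<lambda>t. (t, w t))" by (intro Ck_on_Pair Ck_on_id wJ)
  have graphS: "(\<lambda>t. (t, w t)) ` ?J \<subseteq> S" using JS by auto
  have w'_eq: "w' t = F (t, y t)" if t: "t \<in> {0..C}" for t
  proof -
    have "(w has_vector_derivative w' t) (at t within cbox 0 C)"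
      using w'(1)[of t] t e by (auto intro: has_vector_derivative_at_within)
    moreover have "(w has_vector_derivative F (t, y t)) (at t within cbox 0 C)"
      by (rule has_vector_derivative_transform[of t _ w y]) (use t y(2)[OF t] w(2) in auto)
    ultimately show ?thesis
      using vector_derivative_unique_within_closed_interval[of 0 C t w] t C by auto
  qed
  \<comment> \<open>Outside \<open>{0..C}\<close> the extension need not satisfy the equation. Its
    defect is of order \<open>q\<close> in the distance, and the factor \<open>h\<close> in the
    stage equation supplies the missing power.\<close>
  have "Ck_on q ?J (\<lambda>t. w' t - F (t, w t))"
    by (intro Ck_on_diff w'(2) Ck_on_compose[OF F Ck_on_SucD[OF graph] graphS])
  then obtain M1 where M1: "M1 \<ge> 0" "\<And>t t'. t \<in> {0..C} \<Longrightarrow> t' \<in> {?lo..?hi} \<Longrightarrow>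
      norm (w' t' - F (t', w t')) \<le> M1 * \<bar>t' - t\<bar> ^ q"
    using Ck_on_vanishing_bound[of q "-e" "C + e" "\<lambda>t. w' t - F (t, w t)" C ?lo ?hi] w'_eq w(2) e C by auto
  obtain M2 where M2: "M2 \<ge> 0" "\<And>t h i. h \<ge> 0 \<Longrightarrow> t \<in> {?lo..?hi} \<Longrightarrow> (\<forall>j. t + c $ j * h \<in> {?lo..?hi}) \<Longrightarrow>
    norm (w (t + c $ i * h) - (w t + h *\<^sub>R (\<Sum>j\<in>UNIV. A $ i $ j *\<^sub>R w' (t + c $ j * h)))) \<le> M2 * h ^ Suc q"
    using C_cond_defect[OF Cc w' lohi] by blast
  obtain M3 where M3: "M3 \<ge> 0" "\<And>t h. h \<ge> 0 \<Longrightarrow> t \<in> {?lo..?hi} \<Longrightarrow> t + h \<in> {?lo..?hi} \<Longrightarrow>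
    (\<forall>j. t + c $ j * h \<in> {?lo..?hi}) \<Longrightarrow>
    norm (\<zeta> (t + h, w (t + h)) - rk_update A b (\<zeta> (t, w t)) (\<lambda>j. \<zeta> (t + c $ j * h, w (t + c $ j * h)))) \<le> M3 * h ^ Suc q"
    using rk_update_defect[OF inv B Cc Ck_on_compose[OF \<zeta> graph graphS] lohi] by blast
  obtain M4 a where M4: "M4 \<ge> 0" "\<And>t t'. t \<in> {?lo..?hi} \<Longrightarrow> t' \<in> {?lo..?hi} \<Longrightarrow>
      norm (w t' - (\<Sum>j<Suc 0. (t' - t) ^ j *\<^sub>R a t j)) \<le> M4 * \<bar>t' - t\<bar> ^ Suc 0"
    using Ck_on_Taylor[OF Ck_on_le[OF wJ Suc_le_mono[THEN iffD2, OF le0]] lohi] by blast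
  \<comment> \<open>The expansion of order one at \<open>t' = t\<close> identifies its coefficient
    as \<open>w t\<close>, so the remainder bound is a Lipschitz bound.\<close>
  have wLip: "norm (w t' - w t) \<le> M4 * \<bar>t' - t\<bar>" if "t \<in> {?lo..?hi}" "t' \<in> {?lo..?hi}" for t t'
    using M4(2)[OF that] M4(2)[OF that(1,1)] by simp
  define \<gamma> where "\<gamma> = (\<Sum>i\<in>UNIV. \<bar>c $ i\<bar>)"
  have \<gamma>: "\<bar>c $ i\<bar> \<le> \<gamma>" for i
    unfolding \<gamma>_def by (rule member_le_sum[of i UNIV "\<lambda>i. \<bar>c $ i\<bar>"]) auto
  have \<gamma>0: "\<gamma> \<ge> 0" using \<gamma> abs_ge_zero order_trans by blast
  define K1 where "K1 = (\<Sum>i\<in>UNIV. \<Sum>j\<in>UNIV. \<bar>A $ i $ j\<bar> * (M1 * \<bar>c $ j\<bar> ^ q))"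
  have K1: "(\<Sum>j\<in>UNIV. \<bar>A $ i $ j\<bar> * (M1 * \<bar>c $ j\<bar> ^ q)) \<le> K1" for i
    unfolding K1_def
    by (rule member_le_sum[of i UNIV "\<lambda>i. \<Sum>j\<in>UNIV. \<bar>A $ i $ j\<bar> * (M1 * \<bar>c $ j\<bar> ^ q)"])
      (auto intro!: sum_nonneg mult_nonneg_nonneg M1(1))
  have K1_0: "K1 \<ge> 0" unfolding K1_def by (auto intro!: sum_nonneg mult_nonneg_nonneg M1(1))
  define K where "K = M2 + K1 + M3"
  define h1 where "h1 = min (e / 2) (min (e / (2 * (\<gamma> + 1))) (d / ((\<gamma> + 1) * (M4 + 1))))"
  \<comment> \<open>The minimum keeps nodes within \<open>e / 2\<close> of \<open>t\<close>, hence
    inside the margin, and the reference stages within \<open>d\<close> of the solution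
    point.\<close>
  have "h1 > 0" using e d \<gamma>0 M4(1) by (auto simp: h1_def intro!: divide_pos_pos mult_pos_pos)
  moreover have "K \<ge> 0" using M2(1) M3(1) K1_0 by (simp add: K_def)
  moreover have "(t + c $ i * h, w (t + c $ i * h)) \<in> cball (t, y t) d \<and>
       norm (w (t + c $ i * h) - (y t + h *\<^sub>R (\<Sum>j\<in>UNIV. A $ i $ j *\<^sub>R F (t + c $ j * h, w (t + c $ j * h)))))
         \<le> K * h ^ Suc q" (is ?P)
    and "t + h \<le> C \<longrightarrow> norm (\<zeta> (t + h, y (t + h)) - rk_update A b (\<zeta> (t, y t)) (\<lambda>j. \<zeta> (t + c $ j * h, w (t + c $ j * h))))
         \<le> K * h ^ Suc q" (is ?Q)
    if h: "0 < h" "h \<le> h1" and t: "t \<in> {0..C}" for t h i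
  proof -
    have hq: "h ^ Suc q \<ge> 0" using h(1) by simp
    have "h \<le> e / (2 * (\<gamma> + 1))" "h \<le> d / ((\<gamma> + 1) * (M4 + 1))" using h(2) by (auto simp: h1_def)
    then have "h * (2 * (\<gamma> + 1)) \<le> e" and hd: "h * ((\<gamma> + 1) * (M4 + 1)) \<le> d"
      using \<gamma>0 M4(1) by (simp_all add: pos_le_divide_eq)
    then have "\<gamma> * h \<le> e / 2" using h(1) by (simp add: algebra_simps)
    moreover have ch: "\<bar>c $ j * h\<bar> \<le> \<gamma> * h" for j
      using mult_right_mono[OF \<gamma>[of j] less_imp_le[OF h(1)]] h(1) by (simp add: abs_mult)
    ultimately have cj: "\<bar>c $ j * h\<bar> \<le> e / 2" for j using order_trans by blast
    have tj: "t + c $ j * h \<in> {?lo..?hi}" for j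
      using cj[of j] t unfolding abs_le_iff atLeastAtMost_iff by linarith
    have tt: "t \<in> {?lo..?hi}" using t e by auto
    show ?P
    proof
      have "dist (t, y t) (t + c $ i * h, w (t + c $ i * h)) \<le> dist t (t + c $ i * h) + dist (y t) (w (t + c $ i * h))"
        by (simp add: dist_Pair_Pair sqrt_sum_squares_le_sum)
      also have "\<dots> \<le> \<bar>c $ i * h\<bar> + M4 * \<bar>c $ i * h\<bar>"
        using wLip[OF tt tj[of i]] w(2)[OF t] by (simp add: dist_norm norm_minus_commute)
      also have "\<dots> = \<bar>c $ i * h\<bar> * (M4 + 1)" by (simp add: algebra_simps)
      also have "\<dots> \<le> (\<gamma> * h) * (M4 + 1)" using ch M4(1) by (intro mult_right_mono) auto
      also have "\<dots> \<le> h * ((\<gamma> + 1) * (M4 + 1))"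
        using h(1) M4(1) by (simp add: algebra_simps)
      finally show "(t + c $ i * h, w (t + c $ i * h)) \<in> cball (t, y t) d" using hd by simp
    next
      let ?D = "\<lambda>j. w' (t + c $ j * h) - F (t + c $ j * h, w (t + c $ j * h))"
      have "w (t + c $ i * h) - (y t + h *\<^sub>R (\<Sum>j\<in>UNIV. A $ i $ j *\<^sub>R F (t + c $ j * h, w (t + c $ j * h))))
        = (w (t + c $ i * h) - (w t + h *\<^sub>R (\<Sum>j\<in>UNIV. A $ i $ j *\<^sub>R w' (t + c $ j * h))))
          + h *\<^sub>R (\<Sum>j\<in>UNIV. A $ i $ j *\<^sub>R ?D j)"
        using w(2)[OF t] by (simp add: scaleR_diff_right sum_subtractf)
      also have "norm \<dots> \<le> M2 * h ^ Suc q + h * (K1 * h ^ q)"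
      proof (rule norm_triangle_le[OF add_mono])
        show "norm (w (t + c $ i * h) - (w t + h *\<^sub>R (\<Sum>j\<in>UNIV. A $ i $ j *\<^sub>R w' (t + c $ j * h)))) \<le> M2 * h ^ Suc q"
          using M2(2)[OF less_imp_le[OF h(1)] tt] tj by blast
        have "norm (\<Sum>j\<in>UNIV. A $ i $ j *\<^sub>R ?D j) \<le> (\<Sum>j\<in>UNIV. \<bar>A $ i $ j\<bar> * (M1 * \<bar>c $ j\<bar> ^ q) * h ^ q)"
        proof (rule sum_norm_le)
          fix j
          have "norm (?D j) \<le> M1 * \<bar>c $ j\<bar> ^ q * h ^ q"
            using M1(2)[OF t tj[of j]] h(1) by (simp add: abs_mult power_mult_distrib mult.assoc)
          then show "norm (A $ i $ j *\<^sub>R ?D j) \<le> \<bar>A $ i $ j\<bar> * (M1 * \<bar>c $ j\<bar> ^ q) * h ^ q"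
            by (simp add: mult.assoc mult_left_mono)
        qed
        also have "\<dots> = (\<Sum>j\<in>UNIV. \<bar>A $ i $ j\<bar> * (M1 * \<bar>c $ j\<bar> ^ q)) * h ^ q" by (simp add: sum_distrib_right)
        also have "\<dots> \<le> K1 * h ^ q" using K1 h(1) by (intro mult_right_mono) auto
        finally show "norm (h *\<^sub>R (\<Sum>j\<in>UNIV. A $ i $ j *\<^sub>R ?D j)) \<le> h * (K1 * h ^ q)"
          using h(1) by (simp add: mult_left_mono)
      qed
      also have "\<dots> = (M2 + K1) * h ^ Suc q" by (simp add: algebra_simps)
      also have "\<dots> \<le> K * h ^ Suc q" using M3(1) hq by (intro mult_right_mono) (auto simp: K_def)
      finally show "norm (w (t + c $ i * h) - (y t + h *\<^sub>R (\<Sum>j\<in>UNIV. A $ i $ j *\<^sub>R F (t + c $ j * h, w (t + c $ j * h)))))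
         \<le> K * h ^ Suc q" .
    qed
    show ?Q
    proof
      assume th: "t + h \<le> C"
      then have "t + h \<in> {0..C}" "t + h \<in> {?lo..?hi}" using t h(1) e by auto
      then have "norm (\<zeta> (t + h, y (t + h)) - rk_update A b (\<zeta> (t, y t)) (\<lambda>j. \<zeta> (t + c $ j * h, w (t + c $ j * h)))) \<le> M3 * h ^ Suc q"
        using M3(2)[OF less_imp_le[OF h(1)] tt] tj w(2) t by simp
      also have "\<dots> \<le> K * h ^ Suc q" using M2(1) K1_0 hq by (intro mult_right_mono) (auto simp: K_def)
      finally show "norm (\<zeta> (t + h, y (t + h)) - rk_update A b (\<zeta> (t, y t)) (\<lambda>j. \<zeta> (t + c $ j * h, w (t + c $ j * h))))
         \<le> K * h ^ Suc q" .
    qed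
  qed
  ultimately show ?thesis by (intro exI[of _ h1] exI[of _ K] exI[of _ w] conjI allI impI) simp_all
qed

text \<open>The implicit function theorem for g f(u, v) - r'(t) with parameter (t, u). One
  derivative is spent on \<open>r'\<close>, none by the inversion; keeping the defect as a further
  argument of \<open>\<Psi>\<close> lets the perturbed numerical stages be represented too.\<close>

lemma index2_constraint_inverse:
  fixes f :: "real^'y \<Rightarrow> real^'z \<Rightarrow> real^'y" and g :: "real^'y^'z" and r :: "real \<Rightarrow> real^'z"
  assumes f: "C_k (Suc (Suc n)) (\<lambda>(u, v). f u v)" and r: "C_k (Suc (Suc n)) r" and C: "C > 0"
    and sol: "dae_solution f g r C y z" and idx: "index2_near f g C y z"
  obtains S \<Omega> \<Psi> where "open S" "open \<Omega>" "Ck_on (Suc n) \<Omega> \<Psi>"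
    "\<And>t. t \<in> {0..C} \<Longrightarrow> ((t, y t), z t) \<in> S"
    "\<And>t u v. ((t, u), v) \<in> S \<Longrightarrow> ((t, u), g *v f u v - vector_derivative r (at t)) \<in> \<Omega>"
    "\<And>t u v. ((t, u), v) \<in> S \<Longrightarrow> \<Psi> ((t, u), g *v f u v - vector_derivative r (at t)) = v"
    "\<And>t. t \<in> {0..C} \<Longrightarrow> g *v f (y t) (z t) = vector_derivative r (at t)"
proof -
  have y: "\<And>t. t \<in> {0..C} \<Longrightarrow> (y has_vector_derivative f (y t) (z t)) (at t within {0..C})"
    and gy: "\<And>t. t \<in> {0..C} \<Longrightarrow> g *v y t = r t" and z: "continuous_on {0..C} z"
    using sol by (auto simp: dae_solution_def)
  obtain U where U: "open U" "\<And>t. t \<in> {0..C} \<Longrightarrow> (y t, z t) \<in> U"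
    "\<And>u v. (u, v) \<in> U \<Longrightarrow> invertible (g ** f_z f u v)"
    using idx unfolding index2_near_def by (elim exE conjE) (rule that, auto)
  obtain r' where r': "\<And>x. (r has_vector_derivative r' x) (at x)" "Ck_on (Suc n) UNIV r'"
    by (rule Ck_on_real_SucE[OF C_k_imp_Ck_on[OF r]]) (rule that, auto simp del: Ck_on.simps)
  have vr: "vector_derivative r (at t) = r' t" for t by (rule vector_derivative_at[OF r'(1)])
  have fC: "Ck_on (Suc (Suc n)) UNIV (\<lambda>(u, v). f u v)" by (rule C_k_imp_Ck_on[OF f])
  define H where "H = (\<lambda>x :: (real \<times> (real^'y)) \<times> (real^'z). g *v f (snd (fst x)) (snd x) - r' (fst (fst x)))"
  have bl1: "bounded_linear (\<lambda>x :: (real \<times> (real^'y)) \<times> (real^'z). (snd (fst x), snd x))"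
    by (intro bounded_linear_Pair bounded_linear_compose[OF bounded_linear_snd bounded_linear_fst] bounded_linear_snd)
  have bl2: "bounded_linear (\<lambda>x :: (real \<times> (real^'y)) \<times> (real^'z). fst (fst x))"
    by (rule bounded_linear_compose[OF bounded_linear_fst bounded_linear_fst])
  have "Ck_on (Suc n) UNIV (\<lambda>x :: (real \<times> (real^'y)) \<times> (real^'z). (\<lambda>(u, v). f u v) (snd (fst x), snd x))"
    using Ck_on_compose[OF Ck_on_SucD[OF fC] Ck_on_bounded_linear[OF bl1] subset_UNIV] .
  then have "Ck_on (Suc n) UNIV (\<lambda>x :: (real \<times> (real^'y)) \<times> (real^'z). f (snd (fst x)) (snd x))"
    by (simp del: Ck_on.simps)
  moreover have "Ck_on (Suc n) UNIV (\<lambda>x :: (real \<times> (real^'y)) \<times> (real^'z). r' (fst (fst x)))"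
    by (rule Ck_on_compose[OF r'(2) Ck_on_bounded_linear[OF bl2]]) auto
  ultimately have "Ck_on (Suc n) UNIV H"
    unfolding H_def by (intro Ck_on_diff Ck_on_linear[OF matrix_vector_mul_bounded_linear])
  then obtain H' where H': "\<And>x. (H has_derivative H' x) (at x)" "\<And>v. Ck_on n UNIV (\<lambda>x. H' x v)"
    by (elim Ck_on_SucE) (rule that, auto)
  have H'_eq: "H' ((t, u), v) (0, w) = (g ** f_z f u v) *v w" for t u v w
  proof -
    have "(\<lambda>(u, v). f u v) differentiable (at (u, v))" using f by simp
    then obtain D where D: "((\<lambda>(u, v). f u v) has_derivative D) (at (u, v))" by (auto simp: differentiable_def)
    have "((\<lambda>v. (u, v)) has_derivative (\<lambda>w. (0, w))) (at v)"
      by (intro has_derivative_Pair has_derivative_const has_derivative_ident)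
    from has_derivative_compose[OF this D]
    have "(f u has_derivative (\<lambda>w. D (0, w))) (at v)" by simp
    then have "(f u) differentiable (at v)" by (auto simp: differentiable_def)
    then have fD: "(f u has_derivative frechet_derivative (f u) (at v)) (at v)"
      by (simp add: frechet_derivative_works)
    then have "frechet_derivative (f u) (at v) = (\<lambda>w. f_z f u v *v w)"
      unfolding f_z_def using has_derivative_linear[OF fD] by (simp add: matrix_works fun_eq_iff)
    from fD[unfolded this] have "((\<lambda>v. g *v f u v - r' t) has_derivative (\<lambda>w. g *v (f_z f u v *v w) - 0)) (at v)"
      by (intro has_derivative_diff has_derivative_const
          bounded_linear.has_derivative[OF matrix_vector_mul_bounded_linear])
    moreover have "((\<lambda>v. H ((t, u), v)) has_derivative (\<lambda>w. H' ((t, u), v) (0, w))) (at v)"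
      by (rule has_derivative_compose[of "\<lambda>v. ((t, u), v)" "\<lambda>w. (0, w)"])
        (auto intro!: has_derivative_Pair has_derivative_const has_derivative_ident H'(1))
    ultimately have "(\<lambda>w. H' ((t, u), v) (0, w)) = (\<lambda>w. g *v (f_z f u v *v w) - 0)"
      unfolding H_def by (auto intro: has_derivative_unique)
    from fun_cong[OF this, of w] show ?thesis by (simp add: matrix_vector_mul_assoc)
  qed
  \<comment> \<open>The hidden constraint, obtained by differentiating g y = r along the solution;
    at the end points one-sided derivatives suffice.\<close>
  have gf: "g *v f (y t) (z t) = r' t" if t: "t \<in> {0..C}" for t
  proof -
    have "((\<lambda>t. g *v y t) has_vector_derivative g *v f (y t) (z t)) (at t within cbox 0 C)"
      using bounded_linear.has_vector_derivative[OF matrix_vector_mul_bounded_linear y[OF t]] by simp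
    moreover have "((\<lambda>t. g *v y t) has_vector_derivative r' t) (at t within cbox 0 C)"
      by (rule has_vector_derivative_transform[of t _ "\<lambda>t. g *v y t" r])
        (use t gy in \<open>auto intro: has_vector_derivative_at_within r'(1)\<close>)
    ultimately show ?thesis
      using vector_derivative_unique_within_closed_interval[of 0 C t "\<lambda>t. g *v y t"] t C by auto
  qed
  let ?V = "(\<lambda>x :: (real \<times> (real^'y)) \<times> (real^'z). (snd (fst x), snd x)) -` U"
  let ?K = "(\<lambda>t. ((t, y t), z t)) ` {0..C}"
  have V: "open ?V" using continuous_open_vimage[OF U(1)] linear_continuous_at[OF bl1] by blast
  have K: "compact ?K"
    using has_derivative_continuous_on[OF y[unfolded has_vector_derivative_def]]
    by (intro compact_continuous_image continuous_on_Pair continuous_on_id z) auto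
  have KV: "?K \<subseteq> ?V" using U(2) by auto
  \<comment> \<open>Distinct points of the curve differ already in their time coordinate.\<close>
  have inj: "inj_on (\<lambda>x. (fst x, H x)) ?K" by (auto simp: inj_on_def)
  have inv: "invertible (matrix (\<lambda>w. H' x (0, w)))" if x: "x \<in> ?V" for x
  proof -
    obtain t u v where x': "x = ((t, u), v)" by (metis prod.collapse)
    have "matrix (\<lambda>w. H' x (0, w)) = g ** f_z f u v" unfolding x' H'_eq by simp
    then show ?thesis using U(3) x x' by simp
  qed
  obtain W \<Psi> where W: "open W" "?K \<subseteq> W" "W \<subseteq> ?V" "open ((\<lambda>x. (fst x, H x)) ` W)"
    "Ck_on (Suc n) ((\<lambda>x. (fst x, H x)) ` W) \<Psi>" "\<And>x. x \<in> W \<Longrightarrow> \<Psi> (fst x, H x) = x"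
  proof (rule Ck_on_implicit_function[of ?V H H' n ?K, OF V H'(1) Ck_on_subset[OF H'(2) subset_UNIV] inv K KV inj])
    fix W \<Psi>
    assume "open W" "?K \<subseteq> W" "W \<subseteq> ?V" "open ((\<lambda>x. (fst x, H x)) ` W)"
      "Ck_on (Suc n) ((\<lambda>x. (fst x, H x)) ` W) \<Psi>" "\<And>x. x \<in> W \<Longrightarrow> \<Psi> (fst x, H x) = x"
    then show ?thesis by (rule that)
  qed
  show thesis
  proof (rule that[OF W(1,4)])
    show "Ck_on (Suc n) ((\<lambda>x. (fst x, H x)) ` W) (\<lambda>x. snd (\<Psi> x))"
      by (rule Ck_on_linear[OF bounded_linear_snd W(5)])
    show "((t, y t), z t) \<in> W" if "t \<in> {0..C}" for t using W(2) that by auto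
    show "((t, u), g *v f u v - vector_derivative r (at t)) \<in> (\<lambda>x. (fst x, H x)) ` W" if "((t, u), v) \<in> W" for t u v
      by (rule image_eqI[OF _ that]) (simp add: H_def vr)
    show "snd (\<Psi> ((t, u), g *v f u v - vector_derivative r (at t))) = v" if "((t, u), v) \<in> W" for t u v
      using W(6)[OF that] by (simp add: H_def vr)
    show "g *v f (y t) (z t) = vector_derivative r (at t)" if "t \<in> {0..C}" for t using gf[OF that] vr by simp
  qed
qed

text \<open>Constraint (2) fixes the image of every increment under \<open>g\<close> exactly, while
  (1) ties the increment to \<open>f\<close> up to an error of size O(h^(p+1)). Together they show
  by how much each stage misses the hidden constraint, which is the argument
  \<open>\<epsilon>\<close> handed to \<open>\<Psi>\<close>.\<close>

lemma numerical_stages: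
  fixes A :: "real^'s^'s" and f :: "real^'y \<Rightarrow> real^'z \<Rightarrow> real^'y" and g :: "real^'y^'z"
  assumes inv: "invertible A" and diag: "\<And>i. A $ i $ i \<noteq> 0"
    and \<Psi>: "\<And>t u v. ((t, u), v) \<in> S \<Longrightarrow> \<Psi> ((t, u), g *v f u v - vector_derivative r (at t)) = v"
  shows "\<exists>K\<ge>0. \<forall>t h yn Y Z \<theta> M. 0 < h \<and> g *v yn = r t \<and> stage_constraint A c g r \<theta> h t Y \<and>
    theta_condition b c r \<theta> h t \<and> (\<forall>i. norm (stage_residual A f h yn Y Z i) \<le> M * h ^ (p + 1)) \<and>
    (\<forall>i. norm (\<theta> i) \<le> M * h ^ p) \<and> (\<forall>i. ((t + c $ i * h, Y i), Z i) \<in> S) \<longrightarrow>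
    g *v rk_update A b yn Y = r (t + h) \<and>
    (\<exists>\<delta> \<epsilon>. (\<forall>i. Z i = \<Psi> ((t + c $ i * h, Y i), \<epsilon> i) \<and> norm (\<epsilon> i) \<le> K * M * h ^ p \<and>
        norm (\<delta> i) \<le> K * M * h ^ p \<and>
        Y i = yn + h *\<^sub>R (\<Sum>j\<in>UNIV. A $ i $ j *\<^sub>R (f (Y j) (Z j) + \<delta> j))) \<and>
      rk_update A b yn Y = yn + h *\<^sub>R (\<Sum>i\<in>UNIV. b $ i *\<^sub>R (f (Y i) (Z i) + \<delta> i)))"
proof -
  obtain G where G: "G > 0" "\<And>x. norm (g *v x) \<le> norm x * G"
    using bounded_linear.pos_bounded[OF matrix_vector_mul_bounded_linear[of g]] by blast
  define a where "a = (\<Sum>i\<in>UNIV. 1 / \<bar>A $ i $ i\<bar>)"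
  have a: "1 / \<bar>A $ i $ i\<bar> \<le> a" for i
    unfolding a_def by (rule member_le_sum[of i UNIV "\<lambda>i. 1 / \<bar>A $ i $ i\<bar>"]) auto
  have a0: "a \<ge> 0" unfolding a_def by (intro sum_nonneg) auto
  have sumg: "g *v (\<Sum>j\<in>I. k j *\<^sub>R x j) = (\<Sum>j\<in>I. k j *\<^sub>R (g *v x j))" for I :: "'s set" and k x
    by (simp add: linear_sum[OF matrix_vector_mul_linear] matrix_vector_mult_scaleR)
  show ?thesis
  proof (intro exI[of _ "1 + a + a * G"] conjI allI impI; (elim conjE)?)
    show "0 \<le> 1 + a + a * G" using a0 G(1) by simp
    fix t h yn Y Z \<theta> M
    assume h: "0 < h" and gyn: "g *v yn = r t" and sc: "stage_constraint A c g r \<theta> h t Y"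
      and tc: "theta_condition b c r \<theta> h t"
      and res: "\<forall>i. norm (stage_residual A f h yn Y Z i) \<le> M * h ^ (p + 1)"
      and \<theta>: "\<forall>i. norm (\<theta> i) \<le> M * h ^ p" and S: "\<forall>i. ((t + c $ i * h, Y i), Z i) \<in> S"
    let ?r' = "\<lambda>j. vector_derivative r (at (t + c $ j * h))"
    obtain \<kappa> where \<kappa>: "\<And>i. Y i = yn + (\<Sum>j\<in>UNIV. A $ i $ j *\<^sub>R \<kappa> j)"
      "rk_update A b yn Y = yn + (\<Sum>i\<in>UNIV. b $ i *\<^sub>R \<kappa> i)"
      "\<And>f h (Z :: 's \<Rightarrow> real^'z) i. stage_residual A f h yn Y Z i = A $ i $ i *\<^sub>R (\<kappa> i - h *\<^sub>R f (Y i) (Z i))"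
      by (rule stage_increments[OF inv, of Y yn b]) (rule that, assumption+)
    \<comment> \<open>Invertibility of \<open>A\<close> separates the summed constraints into one
      equation per stage; the terms \<open>r t\<close> cancel because the old value satisfies the
      constraint.\<close>
    have g\<kappa>: "g *v \<kappa> i = h *\<^sub>R (?r' i + \<theta> i)" for i
    proof (rule constraint_increments[OF inv])
      fix i
      have "r t + g *v (\<Sum>j\<in>UNIV. A $ i $ j *\<^sub>R \<kappa> j) = r t + h *\<^sub>R (\<Sum>j\<in>UNIV. A $ i $ j *\<^sub>R (?r' j + \<theta> j))"
        using sc \<kappa>(1)[of i] gyn unfolding stage_constraint_def by (metis matrix_vector_right_distrib)
      then show "(\<Sum>j\<in>UNIV. A $ i $ j *\<^sub>R (g *v \<kappa> j)) = (\<Sum>j\<in>UNIV. A $ i $ j *\<^sub>R (h *\<^sub>R (?r' j + \<theta> j)))"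
        by (simp add: sumg scaleR_sum_right mult.commute)
    qed
    have "g *v rk_update A b yn Y = r t + (\<Sum>i\<in>UNIV. b $ i *\<^sub>R (h *\<^sub>R (?r' i + \<theta> i)))"
      unfolding \<kappa>(2) matrix_vector_right_distrib gyn sumg g\<kappa> ..
    also have "\<dots> = r (t + h)"
      using tc by (simp add: theta_condition_def scaleR_sum_right mult.commute)
    finally show "g *v rk_update A b yn Y = r (t + h)" .
    \<comment> \<open>The perturbation of \<open>f\<close> at each stage; division by
      \<open>h\<close> costs one power of the residual bound.\<close>
    define \<delta> where "\<delta> = (\<lambda>i. (1 / h) *\<^sub>R \<kappa> i - f (Y i) (Z i))"
    have \<kappa>\<delta>: "\<kappa> i = h *\<^sub>R (f (Y i) (Z i) + \<delta> i)" for i using h by (simp add: \<delta>_def)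
    have \<delta>: "norm (\<delta> i) \<le> a * (M * h ^ p)" for i
    proof -
      have "stage_residual A f h yn Y Z i = A $ i $ i *\<^sub>R (h *\<^sub>R \<delta> i)"
        unfolding \<kappa>(3) \<kappa>\<delta> by (simp add: algebra_simps)
      then have "\<bar>A $ i $ i\<bar> * (h * norm (\<delta> i)) \<le> M * h ^ (p + 1)" using res h by (metis abs_of_pos norm_scaleR)
      then have "h * (\<bar>A $ i $ i\<bar> * norm (\<delta> i)) \<le> h * (M * h ^ p)" by (simp add: mult_ac)
      then have "\<bar>A $ i $ i\<bar> * norm (\<delta> i) \<le> M * h ^ p" using h by simp
      then have "norm (\<delta> i) \<le> (1 / \<bar>A $ i $ i\<bar>) * (M * h ^ p)"
        using diag[of i] by (simp add: pos_le_divide_eq mult.commute)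
      also have "\<dots> \<le> a * (M * h ^ p)"
        using a[of i] order_trans[OF norm_ge_zero \<theta>[rule_format, of i]] by (rule mult_right_mono)
      finally show ?thesis .
    qed
    have Mh: "0 \<le> M * h ^ p" using order_trans[OF norm_ge_zero \<theta>[rule_format]] .
    show "\<exists>\<delta> \<epsilon>. (\<forall>i. Z i = \<Psi> ((t + c $ i * h, Y i), \<epsilon> i) \<and> norm (\<epsilon> i) \<le> (1 + a + a * G) * M * h ^ p \<and>
        norm (\<delta> i) \<le> (1 + a + a * G) * M * h ^ p \<and>
        Y i = yn + h *\<^sub>R (\<Sum>j\<in>UNIV. A $ i $ j *\<^sub>R (f (Y j) (Z j) + \<delta> j))) \<and>
      rk_update A b yn Y = yn + h *\<^sub>R (\<Sum>i\<in>UNIV. b $ i *\<^sub>R (f (Y i) (Z i) + \<delta> i))"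
    proof (intro exI[of _ \<delta>] exI[of _ "\<lambda>i. \<theta> i - g *v \<delta> i"] conjI allI)
      fix i
      have "h *\<^sub>R (g *v f (Y i) (Z i) + g *v \<delta> i) = h *\<^sub>R (?r' i + \<theta> i)"
        using g\<kappa>[of i] unfolding \<kappa>\<delta> by (simp add: matrix_vector_mult_scaleR matrix_vector_right_distrib)
      then have "g *v f (Y i) (Z i) + g *v \<delta> i = ?r' i + \<theta> i" using h by simp
      then have "g *v f (Y i) (Z i) - ?r' i = \<theta> i - g *v \<delta> i" by (simp add: algebra_simps)
      then show "Z i = \<Psi> ((t + c $ i * h, Y i), \<theta> i - g *v \<delta> i)" using \<Psi>[OF S[rule_format, of i]] by simp
      have "norm (\<theta> i - g *v \<delta> i) \<le> M * h ^ p + (a * (M * h ^ p)) * G"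
        by (rule order_trans[OF norm_triangle_ineq4 add_mono[OF \<theta>[rule_format] order_trans[OF G(2) mult_right_mono[OF \<delta>]]]])
          (use G in simp)
      also have "\<dots> \<le> (1 + a + a * G) * (M * h ^ p)" using mult_nonneg_nonneg[OF a0 Mh] by (simp add: algebra_simps)
      finally show "norm (\<theta> i - g *v \<delta> i) \<le> (1 + a + a * G) * M * h ^ p" by (simp add: mult.assoc)
      have "a * (M * h ^ p) \<le> (1 + a + a * G) * (M * h ^ p)" using a0 G(1) Mh by (intro mult_right_mono) auto
      then show "norm (\<delta> i) \<le> (1 + a + a * G) * M * h ^ p" using \<delta>[of i] by (simp add: mult.assoc)
      show "Y i = yn + h *\<^sub>R (\<Sum>j\<in>UNIV. A $ i $ j *\<^sub>R (f (Y j) (Z j) + \<delta> j))"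
        using \<kappa>(1)[of i] unfolding \<kappa>\<delta> by (simp add: scaleR_sum_right mult.commute)
    next
      show "rk_update A b yn Y = yn + h *\<^sub>R (\<Sum>i\<in>UNIV. b $ i *\<^sub>R (f (Y i) (Z i) + \<delta> i))"
        using \<kappa>(2) unfolding \<kappa>\<delta> by (simp add: scaleR_sum_right mult.commute)
    qed
  qed
qed

text \<open>A single step from arbitrary nearby values, with constants fixed by the problem and by
  \<open>M\<close> before \<open>t\<close>, \<open>h\<close> and the numerical data. The order
  enters in the form of \<open>classical_order_local_error\<close>, so that \<open>k\<close> can be
  chosen ahead of \<open>f\<close>, \<open>g\<close> and \<open>r\<close>.\<close>

lemma rk_dae_step:
  fixes A :: "real^'s^'s" and f :: "real^'y \<Rightarrow> real^'z \<Rightarrow> real^'y" and g :: "real^'y^'z"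
  assumes k: "\<forall>(F :: real \<times> (real^'y) \<Rightarrow> real^'y) S C y. open S \<and> Ck_on k S F \<and> 0 < C \<and>
     (\<forall>t\<in>{0..C}. (t, y t) \<in> S \<and> (y has_vector_derivative F (t, y t)) (at t within {0..C})) \<longrightarrow>
     (\<exists>M. \<exists>\<epsilon>>0. \<exists>h0>0. \<forall>t h X. 0 < h \<and> h \<le> h0 \<and> 0 \<le> t \<and> t + h \<le> C \<and>
       (\<forall>i. (t + c $ i * h, X i) \<in> S \<and>
          X i = y t + h *\<^sub>R (\<Sum>j\<in>UNIV. A $ i $ j *\<^sub>R F (t + c $ j * h, X j)) \<and> norm (X i - y t) \<le> \<epsilon>) \<longrightarrow>
       norm (y (t + h) - (y t + h *\<^sub>R (\<Sum>i\<in>UNIV. b $ i *\<^sub>R F (t + c $ i * h, X i)))) \<le> M * h ^ (p + 1))"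
    and inv: "invertible A" and diag: "\<And>i. A $ i $ i \<noteq> 0" and B: "B_cond b c q" and Cc: "C_cond A c q"
    and pq: "p \<ge> q + 1"
    and f: "C_k (k + q + 3) (\<lambda>(u, v). f u v)" and r: "C_k (k + q + 3) r" and C: "C > 0"
    and sol: "dae_solution f g r C y z" and idx: "index2_near f g C y z" and M: "M \<ge> 0"
  shows "\<exists>d>0. \<exists>h1>0. \<exists>K\<ge>0. \<forall>t h v w Y Z \<theta>. 0 < h \<and> h \<le> h1 \<and> 0 \<le> t \<and> t + h \<le> C \<and>
    norm (v - y t) \<le> d \<and> norm (w - z t) \<le> d \<and> g *v v = r t \<and>
    stage_constraint A c g r \<theta> h t Y \<and> theta_condition b c r \<theta> h t \<and>
    (\<forall>i. norm (stage_residual A f h v Y Z i) \<le> M * h ^ (p + 1)) \<and> (\<forall>i. norm (\<theta> i) \<le> M * h ^ p) \<and>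
    (\<forall>i. norm (Y i - v) \<le> M * h) \<and> (\<forall>i. norm (Z i - w) \<le> M * h) \<longrightarrow>
    g *v rk_update A b v Y = r (t + h) \<and>
    norm (rk_update A b v Y - y (t + h)) \<le> (1 + K * h) * norm (v - y t) + K * h ^ (p + 1) \<and>
    norm (rk_update A b w Z - z (t + h)) \<le> \<bar>R_inf A b\<bar> * norm (w - z t) + K * (norm (v - y t) + h ^ (q + 1)) \<and>
    (\<forall>i. c $ i = 1 \<longrightarrow> norm (Z i - z (t + h)) \<le> K * (norm (Y i - y (t + h)) + h ^ p))"
proof -
  let ?n = "k + q + 1" and ?s = "real CARD('s)"
  have N: "k + q + 3 = Suc (Suc ?n)" by simp
  have y: "\<And>t. t \<in> {0..C} \<Longrightarrow> (y has_vector_derivative f (y t) (z t)) (at t within {0..C})"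
    and z: "continuous_on {0..C} z"
    using sol by (auto simp: dae_solution_def)
  have ycont: "continuous_on {0..C} y"
    using has_derivative_continuous_on[OF y[unfolded has_vector_derivative_def]] by blast
  obtain S \<Omega> \<Psi> where S: "open S" and \<Omega>: "open \<Omega>" and \<Psi>: "Ck_on (Suc ?n) \<Omega> \<Psi>"
    and SG: "\<And>t. t \<in> {0..C} \<Longrightarrow> ((t, y t), z t) \<in> S"
    and S\<Omega>: "\<And>t u v. ((t, u), v) \<in> S \<Longrightarrow> ((t, u), g *v f u v - vector_derivative r (at t)) \<in> \<Omega>"
    and \<Psi>S: "\<And>t u v. ((t, u), v) \<in> S \<Longrightarrow> \<Psi> ((t, u), g *v f u v - vector_derivative r (at t)) = v"
    and gf: "\<And>t. t \<in> {0..C} \<Longrightarrow> g *v f (y t) (z t) = vector_derivative r (at t)"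
  proof (rule index2_constraint_inverse[OF f[unfolded N] r[unfolded N] C sol idx])
    fix S \<Omega> \<Psi>
    assume "open S" "open \<Omega>" "Ck_on (Suc ?n) \<Omega> \<Psi>"
    "\<And>t. t \<in> {0..C} \<Longrightarrow> ((t, y t), z t) \<in> S"
    "\<And>t u v. ((t, u), v) \<in> S \<Longrightarrow> ((t, u), g *v f u v - vector_derivative r (at t)) \<in> \<Omega>"
    "\<And>t u v. ((t, u), v) \<in> S \<Longrightarrow> \<Psi> ((t, u), g *v f u v - vector_derivative r (at t)) = v"
    "\<And>t. t \<in> {0..C} \<Longrightarrow> g *v f (y t) (z t) = vector_derivative r (at t)"
    then show ?thesis by (rule that)
  qed
  have y\<Omega>: "((t, y t), 0) \<in> \<Omega>" and \<Psi>y: "\<Psi> ((t, y t), 0) = z t" if "t \<in> {0..C}" for t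
    using S\<Omega>[OF SG[OF that]] \<Psi>S[OF SG[OF that]] gf[OF that] by simp_all
  \<comment> \<open>\<open>\<phi>\<close> is \<open>f\<close> with z eliminated at a prescribed
    constraint defect; the slice with defect zero is the reduced equation \<open>F\<close>, and
    \<open>\<zeta>\<close> recovers z on it.\<close>
  define \<phi> where "\<phi> = (\<lambda>x. f (snd (fst x)) (\<Psi> x))"
  have arg: "Ck_on (Suc ?n) \<Omega> (\<lambda>x. (snd (fst x), \<Psi> x))"
    by (intro Ck_on_Pair \<Psi> Ck_on_bounded_linear bounded_linear_compose[OF bounded_linear_snd bounded_linear_fst])
  have \<phi>: "Ck_on (Suc ?n) \<Omega> \<phi>"
    using Ck_on_compose[OF Ck_on_SucD[OF C_k_imp_Ck_on[OF f[unfolded N]]] arg subset_UNIV] unfolding \<phi>_def prod.case .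
  define S0 where "S0 = (\<lambda>x. (x, 0)) -` \<Omega>"
  define F where "F = (\<lambda>x. \<phi> (x, 0))"
  define \<zeta> where "\<zeta> = (\<lambda>x. \<Psi> (x, 0))"
  have S0: "open S0" unfolding S0_def
    by (intro open_vimage \<Omega> continuous_on_Pair continuous_on_id continuous_on_const)
  have emb: "Ck_on (Suc ?n) S0 (\<lambda>x. (x, 0 :: real^'z))" by (intro Ck_on_Pair Ck_on_id Ck_on_const)
  have embS: "(\<lambda>x. (x, 0)) ` S0 \<subseteq> \<Omega>" by (auto simp: S0_def)
  have F: "Ck_on (Suc ?n) S0 F" unfolding F_def by (rule Ck_on_compose[OF \<phi> emb embS])
  have \<zeta>: "Ck_on (Suc ?n) S0 \<zeta>" unfolding \<zeta>_def by (rule Ck_on_compose[OF \<Psi> emb embS])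
  have Fy: "F (t, y t) = f (y t) (z t)" and \<zeta>y: "\<zeta> (t, y t) = z t" and yS0: "(t, y t) \<in> S0"
    if "t \<in> {0..C}" for t
    using \<Psi>y[OF that] y\<Omega>[OF that] by (simp_all add: F_def \<phi>_def \<zeta>_def S0_def)
  have yF: "(y has_vector_derivative F (t, y t)) (at t within {0..C})" if "t \<in> {0..C}" for t
    using y[OF that] Fy[OF that] by simp
  let ?K = "(\<lambda>t. ((t, y t), 0 :: real^'z)) ` {0..C}"
  have K: "compact ?K"
    by (intro compact_continuous_image continuous_on_Pair continuous_on_id continuous_on_const ycont) auto
  have K\<Omega>: "?K \<subseteq> \<Omega>" using y\<Omega> by auto
  \<comment> \<open>Pairing the two maps yields one radius and one Lipschitz constant for
    both.\<close>
  have "Ck_on (Suc 0) \<Omega> (\<lambda>x. (\<phi> x, \<Psi> x))"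
    by (rule Ck_on_le[OF Ck_on_Pair[OF \<phi> \<Psi>]]) simp
  then obtain d1 L where d1: "d1 > 0" "\<And>x. x \<in> ?K \<Longrightarrow> cball x d1 \<subseteq> \<Omega>" and L: "L \<ge> 0"
    "\<And>x a b. x \<in> ?K \<Longrightarrow> a \<in> cball x d1 \<Longrightarrow> b \<in> cball x d1 \<Longrightarrow>
      norm ((\<phi> a, \<Psi> a) - (\<phi> b, \<Psi> b)) \<le> L * norm (a - b)"
  proof (rule Ck_on_Lipschitz_near_compact[OF \<Omega> _ K K\<Omega>])
    fix d M
    assume "d > 0" "M \<ge> 0" "\<And>x. x \<in> ?K \<Longrightarrow> cball x d \<subseteq> \<Omega>"
    "\<And>x a b. x \<in> ?K \<Longrightarrow> a \<in> cball x d \<Longrightarrow> b \<in> cball x d \<Longrightarrow>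
      norm ((\<phi> a, \<Psi> a) - (\<phi> b, \<Psi> b)) \<le> M * norm (a - b)"
    then show ?thesis by (intro that)
  qed
  have L\<phi>: "norm (\<phi> a - \<phi> b) \<le> L * norm (a - b)" and L\<Psi>: "norm (\<Psi> a - \<Psi> b) \<le> L * norm (a - b)"
    if "t \<in> {0..C}" "a \<in> cball ((t, y t), 0) d1" "b \<in> cball ((t, y t), 0) d1" for t a b
    using L(2)[OF imageI[OF that(1)] that(2,3)] norm_fst_le[of "\<phi> a - \<phi> b" "\<Psi> a - \<Psi> b"]
      norm_snd_le[of "\<Psi> a - \<Psi> b" "\<phi> a - \<phi> b"] by (simp_all del: norm_fst_le norm_snd_le)
  have pair0: "(x, \<epsilon>) \<in> cball ((t, y t), 0) d1" if "x \<in> cball (t, y t) (d1 / 2)" "norm \<epsilon> \<le> d1 / 2"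
    for x t and \<epsilon> :: "real^'z"
  proof -
    have "dist ((t, y t), 0) (x, \<epsilon>) \<le> dist (t, y t) x + dist 0 \<epsilon>"
      by (metis dist_Pair_Pair sqrt_sum_squares_le_sum zero_le_dist)
    then show ?thesis using that by simp
  qed
  have d12: "cball (t, y t) (d1 / 2) \<subseteq> S0" if "t \<in> {0..C}" for t
  proof
    fix x assume "x \<in> cball (t, y t) (d1 / 2)"
    then have "(x, 0) \<in> cball ((t, y t), 0 :: real^'z) d1" using d1(1) by (intro pair0) auto
    then show "x \<in> S0" using d1(2)[OF imageI[OF that]] by (auto simp: S0_def)
  qed
  have LF: "norm (F x - F x') \<le> L * norm (x - x')"
    if "t \<in> {0..C}" "x \<in> cball (t, y t) (d1 / 2)" "x' \<in> cball (t, y t) (d1 / 2)" for t x x'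
  proof -
    have "norm (\<phi> (x, 0) - \<phi> (x', 0)) \<le> L * norm ((x, 0 :: real^'z) - (x', 0))"
      using d1(1) by (intro L\<phi>[OF that(1)] pair0 that) auto
    then show ?thesis by (simp add: F_def norm_Pair)
  qed
  have "continuous_on {0..C} (\<lambda>t. F (t, y t))"
    by (rule continuous_on_compose2[OF Ck_on_continuous[OF F]])
      (use yS0 in \<open>auto intro!: continuous_on_Pair continuous_on_id ycont\<close>)
  then have "bounded ((\<lambda>t. F (t, y t)) ` {0..C})" by (intro compact_imp_bounded compact_continuous_image) auto
  then obtain B0 where B0: "\<And>t. t \<in> {0..C} \<Longrightarrow> norm (F (t, y t)) \<le> B0"
    unfolding bounded_iff by (simp only: ball_simps) blast
  have "\<exists>M0. \<exists>\<epsilon>>0. \<exists>h0>0. \<forall>t h X. 0 < h \<and> h \<le> h0 \<and> 0 \<le> t \<and> t + h \<le> C \<and>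
       (\<forall>i. (t + c $ i * h, X i) \<in> S0 \<and>
          X i = y t + h *\<^sub>R (\<Sum>j\<in>UNIV. A $ i $ j *\<^sub>R F (t + c $ j * h, X j)) \<and> norm (X i - y t) \<le> \<epsilon>) \<longrightarrow>
       norm (y (t + h) - (y t + h *\<^sub>R (\<Sum>i\<in>UNIV. b $ i *\<^sub>R F (t + c $ i * h, X i)))) \<le> M0 * h ^ (p + 1)"
    by (rule k[rule_format]) (use S0 C yS0 yF Ck_on_le[OF F, of k] in simp)
  then obtain M0 \<epsilon>0 h0 where M0: "\<epsilon>0 > 0" "h0 > 0" "\<forall>t h X. 0 < h \<and> h \<le> h0 \<and> 0 \<le> t \<and> t + h \<le> C \<and>
       (\<forall>i. (t + c $ i * h, X i) \<in> S0 \<and>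
          X i = y t + h *\<^sub>R (\<Sum>j\<in>UNIV. A $ i $ j *\<^sub>R F (t + c $ j * h, X j)) \<and> norm (X i - y t) \<le> \<epsilon>0) \<longrightarrow>
       norm (y (t + h) - (y t + h *\<^sub>R (\<Sum>i\<in>UNIV. b $ i *\<^sub>R F (t + c $ i * h, X i)))) \<le> M0 * h ^ (p + 1)"
    by (elim exE conjE) (rule that)
  obtain h2 K2 where h2: "h2 > 0" "K2 \<ge> 0" and step: "\<And>t h v Y \<delta> \<eta>. 0 < h \<Longrightarrow> h \<le> h2 \<Longrightarrow> 0 \<le> t \<Longrightarrow> t + h \<le> C \<Longrightarrow>
      (\<And>i. (t + c $ i * h, Y i) \<in> cball (t, y t) (d1 / 2)) \<Longrightarrow>
      (\<And>i. Y i = v + h *\<^sub>R (\<Sum>j\<in>UNIV. A $ i $ j *\<^sub>R (F (t + c $ j * h, Y j) + \<delta> j))) \<Longrightarrow>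
      (\<And>j. norm (\<delta> j) \<le> \<eta>) \<Longrightarrow>
      norm (v + h *\<^sub>R (\<Sum>i\<in>UNIV. b $ i *\<^sub>R (F (t + c $ i * h, Y i) + \<delta> i)) - y (t + h))
        \<le> (1 + K2 * h) * norm (v - y t) + K2 * (h * \<eta>) + K2 * h ^ (p + 1)"
  proof (rule rk_step_error[OF M0 half_gt_zero[OF d1(1)] d12 L(1) LF B0])
    fix h1 K
    assume "h1 > 0" "K \<ge> 0" "\<And>t h v Y \<delta> \<eta>. 0 < h \<Longrightarrow> h \<le> h1 \<Longrightarrow> 0 \<le> t \<Longrightarrow> t + h \<le> C \<Longrightarrow>
      (\<And>i. (t + c $ i * h, Y i) \<in> cball (t, y t) (d1 / 2)) \<Longrightarrow>
      (\<And>i. Y i = v + h *\<^sub>R (\<Sum>j\<in>UNIV. A $ i $ j *\<^sub>R (F (t + c $ j * h, Y j) + \<delta> j))) \<Longrightarrow>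
      (\<And>j. norm (\<delta> j) \<le> \<eta>) \<Longrightarrow>
      norm (v + h *\<^sub>R (\<Sum>i\<in>UNIV. b $ i *\<^sub>R (F (t + c $ i * h, Y i) + \<delta> i)) - y (t + h))
        \<le> (1 + K * h) * norm (v - y t) + K * (h * \<eta>) + K * h ^ (p + 1)"
    then show ?thesis by (rule that)
  qed assumption+
  have Fq: "Ck_on q S0 F" by (rule Ck_on_le[OF F]) simp
  have \<zeta>q: "Ck_on (Suc q) S0 \<zeta>" by (rule Ck_on_le[OF \<zeta>]) simp
  obtain h3 K3 x where h3: "h3 > 0" "K3 \<ge> 0" and defect: "\<forall>t h. 0 < h \<and> h \<le> h3 \<and> t \<in> {0..C} \<longrightarrow>
    (\<forall>i. (t + c $ i * h, x (t + c $ i * h)) \<in> cball (t, y t) (d1 / 2) \<and>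
       norm (x (t + c $ i * h) - (y t + h *\<^sub>R (\<Sum>j\<in>UNIV. A $ i $ j *\<^sub>R F (t + c $ j * h, x (t + c $ j * h)))))
         \<le> K3 * h ^ Suc q) \<and>
    (t + h \<le> C \<longrightarrow> norm (\<zeta> (t + h, y (t + h)) - rk_update A b (\<zeta> (t, y t)) (\<lambda>j. \<zeta> (t + c $ j * h, x (t + c $ j * h))))
         \<le> K3 * h ^ Suc q)"
    by (rule solution_stage_defects[OF inv B Cc C S0 Fq \<zeta>q yS0 yF half_gt_zero[OF d1(1)], THEN exE],
        assumption, assumption, elim exE conjE, rule that)
  obtain K4 where K4: "K4 \<ge> 0" and num: "\<forall>t h yn Y Z \<theta> M. 0 < h \<and> g *v yn = r t \<and> stage_constraint A c g r \<theta> h t Y \<and>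
    theta_condition b c r \<theta> h t \<and> (\<forall>i. norm (stage_residual A f h yn Y Z i) \<le> M * h ^ (p + 1)) \<and>
    (\<forall>i. norm (\<theta> i) \<le> M * h ^ p) \<and> (\<forall>i. ((t + c $ i * h, Y i), Z i) \<in> S) \<longrightarrow>
    g *v rk_update A b yn Y = r (t + h) \<and>
    (\<exists>\<delta> \<epsilon>. (\<forall>i. Z i = \<Psi> ((t + c $ i * h, Y i), \<epsilon> i) \<and> norm (\<epsilon> i) \<le> K4 * M * h ^ p \<and>
        norm (\<delta> i) \<le> K4 * M * h ^ p \<and>
        Y i = yn + h *\<^sub>R (\<Sum>j\<in>UNIV. A $ i $ j *\<^sub>R (f (Y j) (Z j) + \<delta> j))) \<and>
      rk_update A b yn Y = yn + h *\<^sub>R (\<Sum>i\<in>UNIV. b $ i *\<^sub>R (f (Y i) (Z i) + \<delta> i)))"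
    by (rule numerical_stages[where c = c and b = b and p = p, OF inv diag \<Psi>S, THEN exE], assumption, elim exE conjE, rule that)
  obtain e where e: "e > 0" "(\<Union>x\<in>(\<lambda>t. ((t, y t), z t)) ` {0..C}. cball x e) \<subseteq> S"
  proof (rule compact_subset_open_imp_cball_epsilon_subset[OF _ S])
    show "compact ((\<lambda>t. ((t, y t), z t)) ` {0..C})"
      by (intro compact_continuous_image continuous_on_Pair continuous_on_id z ycont) auto
  qed (use SG in auto)
  \<comment> \<open>Uniform continuity brings \<open>y (t + h)\<close> into the ball around
    \<open>y t\<close>, as needed to compare a stage at the end of the step with the solution
    there.\<close>
  have "uniformly_continuous_on {0..C} y" by (rule compact_uniformly_continuous[OF ycont compact_Icc])
  then obtain h4 where h4: "h4 > 0" "\<And>t t'. t \<in> {0..C} \<Longrightarrow> t' \<in> {0..C} \<Longrightarrow> dist t' t < h4 \<Longrightarrow> dist (y t') (y t) < d1 / 4"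
    using d1(1) unfolding uniformly_continuous_on_def by (metis divide_pos_pos zero_less_numeral)
  define \<alpha> where "\<alpha> = (\<Sum>i\<in>UNIV. \<Sum>j\<in>UNIV. \<bar>A $ i $ j\<bar>)"
  define \<gamma> where "\<gamma> = (\<Sum>i\<in>UNIV. \<bar>c $ i\<bar>)"
  define \<beta> where "\<beta> = (\<Sum>j\<in>UNIV. \<bar>rk_weights A b j\<bar>)"
  have \<alpha>: "\<bar>A $ i $ j\<bar> \<le> \<alpha>" for i j
    unfolding \<alpha>_def by (rule abs_matrix_entry_le_sum)
  have \<gamma>: "\<bar>c $ i\<bar> \<le> \<gamma>" for i
    unfolding \<gamma>_def by (rule member_le_sum[of i UNIV "\<lambda>i. \<bar>c $ i\<bar>"]) auto
  have \<beta>: "\<bar>rk_weights A b j\<bar> \<le> \<beta>" for j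
    unfolding \<beta>_def by (rule member_le_sum[of j UNIV "\<lambda>j. \<bar>rk_weights A b j\<bar>"]) auto
  have nn: "\<alpha> \<ge> 0" "\<gamma> \<ge> 0" "\<beta> \<ge> 0" using \<alpha> \<gamma> \<beta> abs_ge_zero order_trans by blast+
  \<comment> \<open>Covers the drift of the node in time and the displacements of \<open>Y\<close>
    and \<open>Z\<close> from the starting values, all multiples of \<open>h\<close>.\<close>
  define \<mu> where "\<mu> = \<gamma> + 2 * M + 1"
  have \<mu>: "\<mu> \<ge> 1" "\<gamma> \<le> \<mu>" "M \<le> \<mu>" "\<gamma> + M \<le> \<mu>" "\<gamma> + 2 * M \<le> \<mu>" using nn M by (auto simp: \<mu>_def)
  \<comment> \<open>With the bounds on \<open>\<mu>\<close> times \<open>h\<close>, the starting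
    errors leave every stage inside \<open>S\<close> and inside the half ball where the Lipschitz
    bounds hold.\<close>
  define d where "d = min (d1 / 8) (e / 8)"
  have d: "d > 0" "d \<le> d1 / 8" "d \<le> e / 8" using d1(1) e(1) by (auto simp: d_def)
  define h5 where "h5 = h4 / 2"
  have h5: "h5 > 0" "h5 < h4" using h4(1) by (simp_all add: h5_def)
  define h1 where "h1 = min (min 1 (min h2 (min h3 h5))) (min (min (e / (2 * \<mu>)) (d1 / (8 * \<mu>)))
    (min (d1 / (2 * (K4 * M + 1))) (1 / (2 * (?s * \<alpha> * L + 1)))))"
  have pos: "K4 * M + 1 > 0" "?s * \<alpha> * L + 1 > 0" "\<mu> > 0"
    using nn K4 M L(1) \<mu>(1) by (auto intro!: add_nonneg_pos mult_nonneg_nonneg)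
  have "e / (2 * \<mu>) > 0" "d1 / (8 * \<mu>) > 0" "d1 / (2 * (K4 * M + 1)) > 0" "1 / (2 * (?s * \<alpha> * L + 1)) > 0"
    using pos e(1) d1(1) by auto
  then have h1: "h1 > 0" "h1 \<le> 1" "h1 \<le> h2" "h1 \<le> h3" "h1 \<le> h5" "h1 \<le> e / (2 * \<mu>)" "h1 \<le> d1 / (8 * \<mu>)"
    "h1 \<le> d1 / (2 * (K4 * M + 1))" "h1 \<le> 1 / (2 * (?s * \<alpha> * L + 1))"
    unfolding h1_def using h2(1) h3(1) h5(1) by (simp_all add: min_le_iff_disj)
  \<comment> \<open>Size of the total perturbation of \<open>F\<close> at a stage: \<open>L\<close>
    times the constraint defect plus the perturbation of \<open>f\<close> itself.\<close>
  define \<eta> where "\<eta> = (L + 1) * (K4 * M)"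
  have \<eta>: "\<eta> \<ge> 0" using L(1) K4 M by (simp add: \<eta>_def)
  define T where "T = ?s * (?s * \<alpha> * \<eta> + K3)"
  have T: "T \<ge> 0" using nn \<eta> h3(2) by (simp add: T_def)
  define K' where "K' = K2 * (\<eta> + 1) + \<beta> * L * (2 * ?s) + \<beta> * (L * (2 * T + ?s * (K4 * M))) + K3 + L + L * (K4 * M)"
  have prods: "0 \<le> K2 * (\<eta> + 1)" "0 \<le> \<beta> * L * (2 * ?s)" "0 \<le> \<beta> * (L * (2 * T + ?s * (K4 * M)))" "0 \<le> L * (K4 * M)"
    using nn \<eta> h2(2) L(1) T K4 M by auto
  have K'0: "K' \<ge> 0" using prods h3(2) L(1) by (simp add: K'_def)
  have "K2 * 1 \<le> K2 * (\<eta> + 1)" using h2(2) \<eta> by (intro mult_left_mono) auto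
  then have K': "K2 \<le> K'" "K2 * (\<eta> + 1) \<le> K'" "\<beta> * L * (2 * ?s) \<le> K'"
    "\<beta> * (L * (2 * T + ?s * (K4 * M))) + K3 \<le> K'" "L \<le> K'" "L * (K4 * M) \<le> K'"
    using prods h3(2) L(1) unfolding K'_def by linarith+
  show ?thesis
  proof (rule exI[of _ d], rule conjI[OF d(1)], rule exI[of _ h1], rule conjI[OF h1(1)], rule exI[of _ K'],
      rule conjI[OF K'0], intro allI impI, elim conjE, intro conjI allI impI)
    fix t h v w Y Z \<theta>
    assume h: "0 < h" "h \<le> h1" and t: "0 \<le> t" "t + h \<le> C"
      and vd: "norm (v - y t) \<le> d" and wd: "norm (w - z t) \<le> d" and gv: "g *v v = r t"
      and sc: "stage_constraint A c g r \<theta> h t Y" and tc: "theta_condition b c r \<theta> h t"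
      and res: "\<forall>i. norm (stage_residual A f h v Y Z i) \<le> M * h ^ (p + 1)"
      and \<theta>: "\<forall>i. norm (\<theta> i) \<le> M * h ^ p"
      and Yv: "\<forall>i. norm (Y i - v) \<le> M * h" and Zw: "\<forall>i. norm (Z i - w) \<le> M * h"
    have tC: "t \<in> {0..C}" "t + h \<in> {0..C}" using t h(1) by auto
    have hle: "h \<le> 1" "h \<le> h2" "h \<le> h3" "h \<le> h5" using order_trans[OF h(2)] h1 by auto
    have "h * (2 * \<mu>) \<le> e" "h * (8 * \<mu>) \<le> d1" "h * (2 * (K4 * M + 1)) \<le> d1" "h * (2 * (?s * \<alpha> * L + 1)) \<le> 1"
      using order_trans[OF h(2) h1(6)] order_trans[OF h(2) h1(7)] order_trans[OF h(2) h1(8)]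
        order_trans[OF h(2) h1(9)] pos by (simp_all add: pos_le_divide_eq)
    then have \<mu>h: "\<mu> * h \<le> e / 2" "\<mu> * h \<le> d1 / 8" and Kh: "K4 * M * h \<le> d1 / 2"
      and hL: "h * (?s * \<alpha> * L) \<le> 1 / 2"
      using h(1) by (simp_all add: algebra_simps)
    have ch: "\<bar>c $ i * h\<bar> \<le> \<gamma> * h" for i
      using mult_right_mono[OF \<gamma>[of i] less_imp_le[OF h(1)]] h(1) by (simp add: abs_mult)
    have hp: "h ^ p \<le> h" "h ^ p \<le> h ^ (q + 1)" "h ^ (p + 1) \<le> h ^ (q + 1)" "0 \<le> h ^ p" "0 \<le> h ^ (q + 1)" "0 \<le> h ^ (p + 1)"
      using power_decreasing[of 1 p h] power_decreasing[of "q + 1" p h] power_decreasing[of "q + 1" "p + 1" h]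
        h(1) hle(1) pq by simp_all
    have Yy: "norm (Y i - y t) \<le> M * h + d" for i
      using norm_triangle_ineq[of "Y i - v" "v - y t"] Yv[rule_format, of i] vd by simp
    have Zz: "norm (Z i - z t) \<le> M * h + d" for i
      using norm_triangle_ineq[of "Z i - w" "w - z t"] Zw[rule_format, of i] wd by simp
    have dY: "dist (t, y t) (t + c $ i * h, Y i) \<le> \<gamma> * h + (M * h + d)" for i
    proof -
      have "dist (t, y t) (t + c $ i * h, Y i) \<le> dist t (t + c $ i * h) + dist (y t) (Y i)"
        by (simp add: dist_Pair_Pair sqrt_sum_squares_le_sum)
      also have "\<dots> \<le> \<gamma> * h + (M * h + d)"
        using ch[of i] Yy[of i] by (intro add_mono) (auto simp: dist_real_def dist_norm norm_minus_commute)
      finally show ?thesis .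
    qed
    have \<gamma>Mh: "\<gamma> * h + M * h \<le> \<mu> * h" "\<gamma> * h + 2 * (M * h) \<le> \<mu> * h"
      using mult_right_mono[OF \<mu>(4) less_imp_le[OF h(1)]] mult_right_mono[OF \<mu>(5) less_imp_le[OF h(1)]]
      by (simp_all add: algebra_simps)
    have inS: "((t + c $ i * h, Y i), Z i) \<in> S" for i
    proof -
      have "dist ((t, y t), z t) ((t + c $ i * h, Y i), Z i) \<le> dist (t, y t) (t + c $ i * h, Y i) + dist (z t) (Z i)"
        by (metis dist_Pair_Pair sqrt_sum_squares_le_sum zero_le_dist)
      also have "\<dots> \<le> (\<gamma> * h + (M * h + d)) + (M * h + d)"
        using dY[of i] Zz[of i] by (intro add_mono) (auto simp: dist_norm norm_minus_commute)
      also have "\<dots> \<le> e" using \<gamma>Mh(2) \<mu>h(1) d(3) e(1) by linarith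
      finally have "((t + c $ i * h, Y i), Z i) \<in> cball ((t, y t), z t) e" by (simp only: mem_cball)
      then show ?thesis using e(2) tC(1) by blast
    qed
    have Yball: "(t + c $ i * h, Y i) \<in> cball (t, y t) (d1 / 2)" for i
      using dY[of i] \<gamma>Mh(1) \<mu>h(2) d(2) d1(1) by simp
    obtain \<delta> \<epsilon> where gY: "g *v rk_update A b v Y = r (t + h)"
      and Z\<Psi>: "\<And>i. Z i = \<Psi> ((t + c $ i * h, Y i), \<epsilon> i)" and \<epsilon>: "\<And>i. norm (\<epsilon> i) \<le> K4 * M * h ^ p"
      and \<delta>: "\<And>i. norm (\<delta> i) \<le> K4 * M * h ^ p"
      and Y: "\<And>i. Y i = v + h *\<^sub>R (\<Sum>j\<in>UNIV. A $ i $ j *\<^sub>R (f (Y j) (Z j) + \<delta> j))"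
      and upd: "rk_update A b v Y = v + h *\<^sub>R (\<Sum>i\<in>UNIV. b $ i *\<^sub>R (f (Y i) (Z i) + \<delta> i))"
    proof -
      have "g *v rk_update A b v Y = r (t + h) \<and>
        (\<exists>\<delta> \<epsilon>. (\<forall>i. Z i = \<Psi> ((t + c $ i * h, Y i), \<epsilon> i) \<and> norm (\<epsilon> i) \<le> K4 * M * h ^ p \<and>
        norm (\<delta> i) \<le> K4 * M * h ^ p \<and>
        Y i = v + h *\<^sub>R (\<Sum>j\<in>UNIV. A $ i $ j *\<^sub>R (f (Y j) (Z j) + \<delta> j))) \<and>
      rk_update A b v Y = v + h *\<^sub>R (\<Sum>i\<in>UNIV. b $ i *\<^sub>R (f (Y i) (Z i) + \<delta> i)))"
        using h(1) gv sc tc res \<theta> inS by (intro num[rule_format, of h v t \<theta> Y Z M]) blast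
      then show ?thesis by (elim conjE exE) (rule that, assumption, (drule spec, elim conjE, assumption)+)
    qed
    have Kh': "K4 * M * h ^ p \<le> d1 / 2"
      using mult_left_mono[OF hp(1), of "K4 * M"] K4 M Kh by simp
    have \<epsilon>d: "norm (\<epsilon> i) \<le> d1 / 2" for i using \<epsilon>[of i] Kh' by linarith
    \<comment> \<open>Relative to the reduced equation both the error in (1) and the constraint
      defect become one additive perturbation of \<open>F\<close>.\<close>
    define \<delta>' where "\<delta>' = (\<lambda>j. f (Y j) (Z j) + \<delta> j - F (t + c $ j * h, Y j))"
    have f\<delta>': "f (Y j) (Z j) + \<delta> j = F (t + c $ j * h, Y j) + \<delta>' j" for j by (simp add: \<delta>'_def)
    have \<delta>': "norm (\<delta>' j) \<le> \<eta> * h ^ p" for j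
    proof -
      have "f (Y j) (Z j) = \<phi> ((t + c $ j * h, Y j), \<epsilon> j)" using Z\<Psi>[of j] by (simp add: \<phi>_def)
      then have "norm (f (Y j) (Z j) - F (t + c $ j * h, Y j))
          \<le> L * norm (((t + c $ j * h, Y j), \<epsilon> j) - ((t + c $ j * h, Y j), 0))"
        unfolding F_def using d1(1) by (simp only:) (intro L\<phi>[OF tC(1)] pair0 Yball \<epsilon>d, simp)
      also have "\<dots> = L * norm (\<epsilon> j)" by (simp add: norm_Pair)
      also have "\<dots> \<le> L * (K4 * M * h ^ p)" by (intro mult_left_mono \<epsilon> L(1))
      finally have "norm (f (Y j) (Z j) - F (t + c $ j * h, Y j)) + norm (\<delta> j) \<le> L * (K4 * M * h ^ p) + K4 * M * h ^ p"
        using \<delta>[of j] by linarith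
      moreover have "norm (\<delta>' j) \<le> norm (f (Y j) (Z j) - F (t + c $ j * h, Y j)) + norm (\<delta> j)"
        unfolding \<delta>'_def using norm_triangle_ineq[of "f (Y j) (Z j) - F (t + c $ j * h, Y j)" "\<delta> j"]
        by (simp add: algebra_simps)
      ultimately show ?thesis by (simp add: \<eta>_def algebra_simps)
    qed
    have Y': "Y i = v + h *\<^sub>R (\<Sum>j\<in>UNIV. A $ i $ j *\<^sub>R (F (t + c $ j * h, Y j) + \<delta>' j))" for i
      using Y[of i] unfolding f\<delta>' .
    let ?e = "norm (v - y t)"
    have e0: "?e \<ge> 0" by simp
    have concl2: "norm (rk_update A b v Y - y (t + h)) \<le> (1 + K' * h) * ?e + K' * h ^ (p + 1)"
    proof -
      have "norm (rk_update A b v Y - y (t + h)) \<le> (1 + K2 * h) * ?e + K2 * (h * (\<eta> * h ^ p)) + K2 * h ^ (p + 1)"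
        unfolding upd f\<delta>' by (rule step[OF h(1) hle(2) t Yball Y' \<delta>'])
      also have "\<dots> = ?e + K2 * (h * ?e) + (K2 * (\<eta> + 1)) * h ^ (p + 1)" by (simp add: algebra_simps)
      also have "\<dots> \<le> ?e + K' * (h * ?e) + K' * h ^ (p + 1)"
        using h(1) e0 hp(6) by (intro add_mono mult_right_mono order_refl K') auto
      finally show ?thesis by (simp add: algebra_simps)
    qed
    have df: "(t + c $ i * h, x (t + c $ i * h)) \<in> cball (t, y t) (d1 / 2)"
      "norm (x (t + c $ i * h) - (y t + h *\<^sub>R (\<Sum>j\<in>UNIV. A $ i $ j *\<^sub>R F (t + c $ j * h, x (t + c $ j * h)))))
         \<le> K3 * h ^ Suc q"
      "norm (\<zeta> (t + h, y (t + h)) - rk_update A b (\<zeta> (t, y t)) (\<lambda>j. \<zeta> (t + c $ j * h, x (t + c $ j * h))))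
         \<le> K3 * h ^ Suc q" for i
      using defect[rule_format, of h t] h(1) hle(3) tC t by blast+
    let ?H = "\<lambda>i. h *\<^sub>R (\<Sum>j\<in>UNIV. A $ i $ j *\<^sub>R \<delta>' j)"
    \<comment> \<open>The numerical stages and the reference stages \<open>x\<close> satisfy the
      same equations up to \<open>?H\<close> (perturbations, one power of \<open>h\<close> gained)
      and \<open>?D\<close> (defect of the reference), so stage stability compares them.\<close>
    let ?D = "\<lambda>i. x (t + c $ i * h) - (y t + h *\<^sub>R (\<Sum>j\<in>UNIV. A $ i $ j *\<^sub>R F (t + c $ j * h, x (t + c $ j * h))))"
    have Yx: "(\<Sum>i\<in>UNIV. norm (Y i - x (t + c $ i * h))) \<le> 2 * (?s * ?e + T * h ^ (q + 1))"
    proof -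
      have "(\<Sum>i\<in>UNIV. norm (Y i - x (t + c $ i * h))) \<le> 2 * (?s * ?e + (\<Sum>i\<in>UNIV. norm (?H i - ?D i)))"
      proof (rule stage_stability[OF \<alpha> _ _ _ L(1) less_imp_le[OF h(1)] hL])
        show "Y i = v + h *\<^sub>R (\<Sum>j\<in>UNIV. A $ i $ j *\<^sub>R F (t + c $ j * h, Y j)) + ?H i" for i
          by (subst Y') (simp add: scaleR_add_right sum.distrib)
        show "x (t + c $ i * h) = y t + h *\<^sub>R (\<Sum>j\<in>UNIV. A $ i $ j *\<^sub>R F (t + c $ j * h, x (t + c $ j * h))) + ?D i" for i
          by simp
        show "norm (F (t + c $ j * h, Y j) - F (t + c $ j * h, x (t + c $ j * h))) \<le> L * norm (Y j - x (t + c $ j * h))" for j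
          using LF[OF tC(1) Yball[of j] df(1)[of j]] by (simp add: norm_Pair)
      qed
      also have "(\<Sum>i\<in>UNIV. norm (?H i - ?D i)) \<le> (\<Sum>i\<in>(UNIV::'s set). (?s * \<alpha> * \<eta> + K3) * h ^ (q + 1))"
      proof (rule sum_mono)
        fix i
        have "norm (\<Sum>j\<in>UNIV. A $ i $ j *\<^sub>R \<delta>' j) \<le> (\<Sum>j\<in>(UNIV::'s set). \<alpha> * (\<eta> * h ^ p))"
        proof (rule sum_norm_le)
          fix j show "norm (A $ i $ j *\<^sub>R \<delta>' j) \<le> \<alpha> * (\<eta> * h ^ p)"
            using mult_mono[OF \<alpha>[of i j] \<delta>'[of j]] nn by simp
        qed
        from mult_left_mono[OF this less_imp_le[OF h(1)]]
        have "norm (?H i) \<le> (?s * \<alpha> * \<eta>) * h ^ (p + 1)" using h(1) by (simp add: mult_ac)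
        also have "\<dots> \<le> (?s * \<alpha> * \<eta>) * h ^ (q + 1)" using hp(3) nn \<eta> by (intro mult_left_mono) auto
        finally have "norm (?H i) + norm (?D i) \<le> (?s * \<alpha> * \<eta>) * h ^ (q + 1) + K3 * h ^ (q + 1)"
          using df(2)[of i] by simp
        then show "norm (?H i - ?D i) \<le> (?s * \<alpha> * \<eta> + K3) * h ^ (q + 1)"
          using norm_triangle_ineq4[of "?H i" "?D i"] unfolding distrib_right by linarith
      qed
      finally show ?thesis by (simp add: T_def mult.assoc)
    qed
    let ?\<zeta> = "\<lambda>j. \<zeta> (t + c $ j * h, x (t + c $ j * h))"
    have Z\<zeta>: "norm (Z j - ?\<zeta> j) \<le> L * (norm (Y j - x (t + c $ j * h)) + K4 * M * h ^ (q + 1))" for j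
    proof -
      have "norm (Z j - ?\<zeta> j) \<le> L * norm (((t + c $ j * h, Y j), \<epsilon> j) - ((t + c $ j * h, x (t + c $ j * h)), 0))"
        unfolding Z\<Psi>[of j] \<zeta>_def by (intro L\<Psi>[OF tC(1)] pair0 Yball \<epsilon>d df(1)) (use d1(1) in simp)
      also have "\<dots> \<le> L * (norm (Y j - x (t + c $ j * h)) + norm (\<epsilon> j))"
        by (intro mult_left_mono L(1)) (simp add: norm_Pair sqrt_sum_squares_le_sum)
      also have "\<dots> \<le> L * (norm (Y j - x (t + c $ j * h)) + K4 * M * h ^ (q + 1))"
        using \<epsilon>[of j] mult_left_mono[OF hp(2), of "K4 * M"] K4 M L(1) by (intro mult_left_mono add_left_mono) auto
      finally show ?thesis .
    qed
    have concl3: "norm (rk_update A b w Z - z (t + h)) \<le> \<bar>R_inf A b\<bar> * norm (w - z t) + K' * (?e + h ^ (q + 1))"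
    proof -
      have "norm (\<Sum>j\<in>UNIV. rk_weights A b j *\<^sub>R (Z j - ?\<zeta> j))
          \<le> (\<Sum>j\<in>UNIV. \<beta> * (L * (norm (Y j - x (t + c $ j * h)) + K4 * M * h ^ (q + 1))))"
      proof (rule sum_norm_le)
        fix j show "norm (rk_weights A b j *\<^sub>R (Z j - ?\<zeta> j)) \<le> \<beta> * (L * (norm (Y j - x (t + c $ j * h)) + K4 * M * h ^ (q + 1)))"
          using mult_mono[OF \<beta>[of j] Z\<zeta>[of j]] nn by simp
      qed
      also have "\<dots> = \<beta> * (L * ((\<Sum>j\<in>UNIV. norm (Y j - x (t + c $ j * h))) + ?s * (K4 * M * h ^ (q + 1))))"
        by (simp add: sum_distrib_left[symmetric] sum.distrib del: power_Suc)
      also have "\<dots> \<le> \<beta> * (L * (2 * (?s * ?e + T * h ^ (q + 1)) + ?s * (K4 * M * h ^ (q + 1))))"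
        using Yx nn L(1) by (intro mult_left_mono add_right_mono) auto
      also have "\<dots> = (\<beta> * L * (2 * ?s)) * ?e + (\<beta> * (L * (2 * T + ?s * (K4 * M)))) * h ^ (q + 1)"
        by (simp add: algebra_simps)
      finally have sum: "norm (\<Sum>j\<in>UNIV. rk_weights A b j *\<^sub>R (Z j - ?\<zeta> j))
          \<le> (\<beta> * L * (2 * ?s)) * ?e + (\<beta> * (L * (2 * T + ?s * (K4 * M)))) * h ^ (q + 1)" .
      \<comment> \<open>Affinity of the update isolates the factor \<open>R_inf\<close>; the second
        difference is the consistency defect along the reference stages.\<close>
      have "rk_update A b w Z - z (t + h) = (rk_update A b w Z - rk_update A b (z t) ?\<zeta>)
          - (\<zeta> (t + h, y (t + h)) - rk_update A b (\<zeta> (t, y t)) ?\<zeta>)"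
        using \<zeta>y[OF tC(1)] \<zeta>y[OF tC(2)] by simp
      also have "norm \<dots> \<le> (\<bar>R_inf A b\<bar> * norm (w - z t) + ((\<beta> * L * (2 * ?s)) * ?e
          + (\<beta> * (L * (2 * T + ?s * (K4 * M)))) * h ^ (q + 1))) + K3 * h ^ Suc q"
        unfolding rk_update_diff
        by (rule order_trans[OF norm_triangle_ineq4 add_mono[OF norm_triangle_le[OF add_mono[OF _ sum]] df(3)]]) simp
      also have "\<dots> = \<bar>R_inf A b\<bar> * norm (w - z t) + ((\<beta> * L * (2 * ?s)) * ?e
          + (\<beta> * (L * (2 * T + ?s * (K4 * M))) + K3) * h ^ (q + 1))"
        by (simp add: distrib_right)
      also have "\<dots> \<le> \<bar>R_inf A b\<bar> * norm (w - z t) + (K' * ?e + K' * h ^ (q + 1))"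
        using e0 hp(5) by (intro add_left_mono add_mono mult_right_mono K')
      finally show ?thesis by (simp only: distrib_left)
    qed
    \<comment> \<open>At a node with abscissa 1 both z-values are images under \<open>\<Psi>\<close>
      at the same time, so their distance is governed by the y-error and by the O(h^p) constraint
      defect; the stage order does not enter.\<close>
    have concl4: "norm (Z i - z (t + h)) \<le> K' * (norm (Y i - y (t + h)) + h ^ p)" if ci: "c $ i = 1" for i
    proof -
      have "dist (t + h) t < h4" using hle(4) h(1) h5(2) by (simp add: dist_real_def)
      then have "dist (y (t + h)) (y t) < d1 / 4" by (rule h4(2)[OF tC])
      moreover have "h \<le> d1 / 8" using \<mu>h(2) mult_right_mono[OF \<mu>(1) less_imp_le[OF h(1)]] by linarith
      moreover have "dist (t, y t) (t + h, y (t + h)) \<le> dist t (t + h) + dist (y t) (y (t + h))"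
        by (simp add: dist_Pair_Pair sqrt_sum_squares_le_sum)
      ultimately have "(t + h, y (t + h)) \<in> cball (t, y t) (d1 / 2)"
        using h(1) d1(1) by (simp add: dist_real_def dist_commute)
      then have "((t + h, y (t + h)), 0) \<in> cball ((t, y t), 0 :: real^'z) d1" using d1(1) by (intro pair0) auto
      moreover have "((t + h, Y i), \<epsilon> i) \<in> cball ((t, y t), 0) d1" using pair0[OF Yball[of i] \<epsilon>d[of i]] ci by simp
      ultimately have "norm (\<Psi> ((t + h, Y i), \<epsilon> i) - \<Psi> ((t + h, y (t + h)), 0))
          \<le> L * norm (((t + h, Y i), \<epsilon> i) - ((t + h, y (t + h)), 0))" by (intro L\<Psi>[OF tC(1)])
      also have "\<Psi> ((t + h, Y i), \<epsilon> i) = Z i" using Z\<Psi>[of i] ci by simp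
      also have "\<Psi> ((t + h, y (t + h)), 0) = z (t + h)" by (rule \<Psi>y[OF tC(2)])
      also have "L * norm (((t + h, Y i), \<epsilon> i) - ((t + h, y (t + h)), 0)) \<le> L * (norm (Y i - y (t + h)) + norm (\<epsilon> i))"
        by (intro mult_left_mono L(1)) (simp add: norm_Pair sqrt_sum_squares_le_sum)
      also have "\<dots> \<le> L * (norm (Y i - y (t + h)) + K4 * M * h ^ p)"
        by (intro mult_left_mono add_left_mono \<epsilon> L(1))
      also have "\<dots> = L * norm (Y i - y (t + h)) + (L * (K4 * M)) * h ^ p" by (simp add: algebra_simps)
      also have "\<dots> \<le> K' * norm (Y i - y (t + h)) + K' * h ^ p"
        using hp(4) by (intro add_mono mult_right_mono K') auto
      finally show ?thesis by (simp only: distrib_left)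
    qed
    show "g *v rk_update A b v Y = r (t + h)" by (rule gY)
    show "norm (rk_update A b v Y - y (t + h)) \<le> (1 + K' * h) * norm (v - y t) + K' * h ^ (p + 1)" by (rule concl2)
    show "norm (rk_update A b w Z - z (t + h)) \<le> \<bar>R_inf A b\<bar> * norm (w - z t) + K' * (norm (v - y t) + h ^ (q + 1))"
      by (rule concl3)
    show "norm (Z i - z (t + h)) \<le> K' * (norm (Y i - y (t + h)) + h ^ p)" if "c $ i = 1" for i by (rule concl4[OF that])
  qed
qed


section \<open>Convergence\<close>

text \<open>There are finitely many stages, so the stagewise constants can be added and the smallest
  threshold taken. Absolute values are needed since \<open>unif_bigo\<close> admits negative
  constants.\<close>

lemma unif_bigo_finite:
  fixes e :: "real \<Rightarrow> nat \<Rightarrow> 's::finite \<Rightarrow> 'a::real_normed_vector"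
  assumes e: "\<forall>i. unif_bigo S k (\<lambda>h n. e h n i)" and pos: "\<forall>h n. (h, n) \<in> S \<longrightarrow> h > 0"
  shows "\<exists>M\<ge>0. \<exists>h0>0. \<forall>h n i. (h, n) \<in> S \<and> h \<le> h0 \<longrightarrow> norm (e h n i) \<le> M * h ^ k"
proof -
  have "\<forall>i. \<exists>Mh. snd Mh > 0 \<and> (\<forall>(h, n)\<in>S. h \<le> snd Mh \<longrightarrow> norm (e h n i) \<le> fst Mh * h ^ k)"
    using e unfolding unif_bigo_def by simp
  from choice[OF this] obtain Mh where "\<forall>i. snd (Mh i) > 0 \<and>
      (\<forall>(h, n)\<in>S. h \<le> snd (Mh i) \<longrightarrow> norm (e h n i) \<le> fst (Mh i) * h ^ k)" by (rule exE)
  then have Mh: "\<And>i. snd (Mh i) > 0"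
    "\<And>i. \<forall>(h, n)\<in>S. h \<le> snd (Mh i) \<longrightarrow> norm (e h n i) \<le> fst (Mh i) * h ^ k" by simp_all
  define M where "M = (\<Sum>i\<in>UNIV. \<bar>fst (Mh i)\<bar>)"
  define h0 where "h0 = Min (range (\<lambda>i. snd (Mh i)))"
  have M: "M \<ge> 0" unfolding M_def by (intro sum_nonneg) auto
  have h0: "h0 > 0" unfolding h0_def using Mh(1) by simp
  show ?thesis
  proof (rule exI[of _ M], rule conjI[OF M], rule exI[of _ h0], rule conjI[OF h0], intro allI impI, elim conjE)
    fix h n i assume S: "(h, n) \<in> S" and h: "h \<le> h0"
    have "h \<le> snd (Mh i)" using h unfolding h0_def by simp
    then have "norm (e h n i) \<le> fst (Mh i) * h ^ k" using Mh(2)[of i] S by blast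
    also have "\<dots> \<le> M * h ^ k"
    proof (rule mult_right_mono)
      have "\<bar>fst (Mh i)\<bar> \<le> M"
        unfolding M_def by (rule member_le_sum[of i UNIV "\<lambda>i. \<bar>fst (Mh i)\<bar>"]) auto
      then show "fst (Mh i) \<le> M" by linarith
      show "0 \<le> h ^ k" using pos[rule_format, OF S] by simp
    qed
    finally show "norm (e h n i) \<le> M * h ^ k" .
  qed
qed

lemma unif_bigoI:
  assumes "h0 > 0" "\<And>h n. (h, n) \<in> S \<Longrightarrow> h \<le> h0 \<Longrightarrow> norm (e h n) \<le> M * h ^ k"
  shows "unif_bigo S k e"
  unfolding unif_bigo_def by (rule exI[of _ M], rule exI[of _ h0]) (use assms in auto)

text \<open>\<open>N\<close> precedes the problem because sufficient smoothness may depend only on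
  the scheme. The linear order on the index type names the last stage, and the nonzero diagonal
  makes every relation (1) bind its stage. In the last claim the row-sum condition puts the last
  node at the end of the step.\<close>

theorem theorem1:
  fixes A :: "real^('s::{finite,linorder})^('s::{finite,linorder})"
    and b c :: "real^('s::{finite,linorder})" and p q :: nat
  assumes "classical_order A b c p" and "stage_order A b c q" and "p \<ge> q + 1"
    and "invertible A" and "\<And>i. A $ i $ i \<noteq> 0" and "\<bar>R_inf A b\<bar> < 1"
  shows "\<exists>N. \<forall>(f :: real^'y \<Rightarrow> real^'z \<Rightarrow> real^'y) (g :: real^'y^'z) (r :: real \<Rightarrow> real^'z)
      (C :: real) (hmax :: real) (y :: real \<Rightarrow> real^'y) (z :: real \<Rightarrow> real^'z) y0 z0
      (yn :: real \<Rightarrow> nat \<Rightarrow> real^'y) (zn :: real \<Rightarrow> nat \<Rightarrow> real^'z)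
      (Y :: real \<Rightarrow> nat \<Rightarrow> 's \<Rightarrow> real^'y) (Z :: real \<Rightarrow> nat \<Rightarrow> 's \<Rightarrow> real^'z)
      (\<theta> :: real \<Rightarrow> real \<Rightarrow> 's \<Rightarrow> real^'z).
    C_k N (\<lambda>(u, v). f u v) \<longrightarrow> C_k N r \<longrightarrow> C > 0 \<longrightarrow> hmax > 0 \<longrightarrow>
    g *v y0 = r 0 \<longrightarrow> g *v f y0 z0 = vector_derivative r (at 0) \<longrightarrow>
    dae_solution f g r C y z \<longrightarrow> y 0 = y0 \<longrightarrow> z 0 = z0 \<longrightarrow> index2_near f g C y z \<longrightarrow>
    (\<forall>h. yn h 0 = y0 \<and> zn h 0 = z0) \<longrightarrow>
    (\<forall>(h, n)\<in>grid_steps C hmax.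
       yn h (Suc n) = rk_update A b (yn h n) (Y h n) \<and>
       zn h (Suc n) = rk_update A b (zn h n) (Z h n) \<and>
       stage_constraint A c g r (\<theta> (real n * h) h) h (real n * h) (Y h n) \<and>
       theta_condition b c r (\<theta> (real n * h) h) h (real n * h)) \<longrightarrow>
    (\<forall>i. unif_bigo (grid_steps C hmax) (p + 1)
           (\<lambda>h n. stage_residual A f h (yn h n) (Y h n) (Z h n) i)) \<longrightarrow>
    (\<forall>i. unif_bigo (grid_steps C hmax) 1 (\<lambda>h n. Y h n i - yn h n)) \<longrightarrow>
    (\<forall>i. unif_bigo (grid_steps C hmax) 1 (\<lambda>h n. Z h n i - zn h n)) \<longrightarrow>
    (\<forall>i. unif_bigo (grid_steps C hmax) p (\<lambda>h n. \<theta> (real n * h) h i)) \<longrightarrow>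
    unif_bigo (grid_points C hmax) p (\<lambda>h n. yn h n - y (real n * h)) \<and>
    unif_bigo (grid_points C hmax) (q + 1) (\<lambda>h n. zn h n - z (real n * h)) \<and>
    ((\<forall>i. A $ Max UNIV $ i = b $ i) \<and> (\<forall>i. c $ i = (\<Sum>j\<in>UNIV. A $ i $ j)) \<longrightarrow>
       unif_bigo (grid_points C hmax) p (\<lambda>h n. zn h n - z (real n * h)))"
proof -
  have B: "B_cond b c q" and Cc: "C_cond A c q" using assms(2) by (auto simp: stage_order_def)
  obtain k where k: "\<forall>(F :: real \<times> (real^'y) \<Rightarrow> real^'y) S C y. open S \<and> Ck_on k S F \<and> 0 < C \<and>
     (\<forall>t\<in>{0..C}. (t, y t) \<in> S \<and> (y has_vector_derivative F (t, y t)) (at t within {0..C})) \<longrightarrow>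
     (\<exists>M. \<exists>\<epsilon>>0. \<exists>h0>0. \<forall>t h X. 0 < h \<and> h \<le> h0 \<and> 0 \<le> t \<and> t + h \<le> C \<and>
       (\<forall>i. (t + c $ i * h, X i) \<in> S \<and>
          X i = y t + h *\<^sub>R (\<Sum>j\<in>UNIV. A $ i $ j *\<^sub>R F (t + c $ j * h, X j)) \<and> norm (X i - y t) \<le> \<epsilon>) \<longrightarrow>
       norm (y (t + h) - (y t + h *\<^sub>R (\<Sum>i\<in>UNIV. b $ i *\<^sub>R F (t + c $ i * h, X i)))) \<le> M * h ^ (p + 1))"
    using classical_order_local_error[OF assms(1), where 'n = 'y] by (rule exE)
  show ?thesis
  \<comment> \<open>\<open>k\<close> serves the order of the reduced equation and \<open>q\<close>
    the expansions along the solution; adding them makes one count cover both, with room for the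
    derivative spent on \<open>r'\<close>.\<close>
  proof (rule exI[of _ "k + q + 3"], intro allI impI)
    fix f :: "real^'y \<Rightarrow> real^'z \<Rightarrow> real^'y" and g :: "real^'y^'z" and r :: "real \<Rightarrow> real^'z"
      and C hmax :: real and y :: "real \<Rightarrow> real^'y" and z :: "real \<Rightarrow> real^'z" and y0 z0
      and yn :: "real \<Rightarrow> nat \<Rightarrow> real^'y" and zn :: "real \<Rightarrow> nat \<Rightarrow> real^'z"
      and Y :: "real \<Rightarrow> nat \<Rightarrow> 's \<Rightarrow> real^'y" and Z :: "real \<Rightarrow> nat \<Rightarrow> 's \<Rightarrow> real^'z"
      and \<theta> :: "real \<Rightarrow> real \<Rightarrow> 's \<Rightarrow> real^'z"
    assume f: "C_k (k + q + 3) (\<lambda>(u, v). f u v)" and r: "C_k (k + q + 3) r" and C: "C > 0" and "hmax > 0"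
      and gy0: "g *v y0 = r 0" and "g *v f y0 z0 = vector_derivative r (at 0)"
      and sol: "dae_solution f g r C y z" and yz0: "y 0 = y0" "z 0 = z0" and idx: "index2_near f g C y z"
      and init: "\<forall>h. yn h 0 = y0 \<and> zn h 0 = z0"
      and scheme: "\<forall>(h, n)\<in>grid_steps C hmax.
       yn h (Suc n) = rk_update A b (yn h n) (Y h n) \<and>
       zn h (Suc n) = rk_update A b (zn h n) (Z h n) \<and>
       stage_constraint A c g r (\<theta> (real n * h) h) h (real n * h) (Y h n) \<and>
       theta_condition b c r (\<theta> (real n * h) h) h (real n * h)"
      and res: "\<forall>i. unif_bigo (grid_steps C hmax) (p + 1)
           (\<lambda>h n. stage_residual A f h (yn h n) (Y h n) (Z h n) i)"
      and Yy: "\<forall>i. unif_bigo (grid_steps C hmax) 1 (\<lambda>h n. Y h n i - yn h n)"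
      and Zz: "\<forall>i. unif_bigo (grid_steps C hmax) 1 (\<lambda>h n. Z h n i - zn h n)"
      and \<theta>: "\<forall>i. unif_bigo (grid_steps C hmax) p (\<lambda>h n. \<theta> (real n * h) h i)"
    let ?G = "grid_steps C hmax"
    have G: "\<forall>h n. (h, n) \<in> ?G \<longrightarrow> h > 0" by (simp add: grid_steps_def)
    obtain M1 e1 where M1: "M1 \<ge> 0" "e1 > 0" "\<forall>h n i. (h, n) \<in> ?G \<and> h \<le> e1 \<longrightarrow>
        norm (stage_residual A f h (yn h n) (Y h n) (Z h n) i) \<le> M1 * h ^ (p + 1)"
      using unif_bigo_finite[OF res G] by (elim exE conjE) (rule that)
    obtain M2 e2 where M2: "M2 \<ge> 0" "e2 > 0" "\<forall>h n i. (h, n) \<in> ?G \<and> h \<le> e2 \<longrightarrow> norm (Y h n i - yn h n) \<le> M2 * h ^ 1"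
      using unif_bigo_finite[OF Yy G] by (elim exE conjE) (rule that)
    obtain M3 e3 where M3: "M3 \<ge> 0" "e3 > 0" "\<forall>h n i. (h, n) \<in> ?G \<and> h \<le> e3 \<longrightarrow> norm (Z h n i - zn h n) \<le> M3 * h ^ 1"
      using unif_bigo_finite[OF Zz G] by (elim exE conjE) (rule that)
    obtain M4 e4 where M4: "M4 \<ge> 0" "e4 > 0" "\<forall>h n i. (h, n) \<in> ?G \<and> h \<le> e4 \<longrightarrow> norm (\<theta> (real n * h) h i) \<le> M4 * h ^ p"
      using unif_bigo_finite[OF \<theta> G] by (elim exE conjE) (rule that)
    define M where "M = M1 + M2 + M3 + M4"
    have M: "M \<ge> 0" "M1 \<le> M" "M2 \<le> M" "M3 \<le> M" "M4 \<le> M"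
      using M1(1) M2(1) M3(1) M4(1) by (auto simp: M_def)
    obtain d h1 K where d: "d > 0" and h1: "h1 > 0" and K: "K \<ge> 0" and step: "\<forall>t h v w Y Z \<theta>. 0 < h \<and> h \<le> h1 \<and> 0 \<le> t \<and> t + h \<le> C \<and>
      norm (v - y t) \<le> d \<and> norm (w - z t) \<le> d \<and> g *v v = r t \<and>
      stage_constraint A c g r \<theta> h t Y \<and> theta_condition b c r \<theta> h t \<and>
      (\<forall>i. norm (stage_residual A f h v Y Z i) \<le> M * h ^ (p + 1)) \<and> (\<forall>i. norm (\<theta> i) \<le> M * h ^ p) \<and>
      (\<forall>i. norm (Y i - v) \<le> M * h) \<and> (\<forall>i. norm (Z i - w) \<le> M * h) \<longrightarrow>
      g *v rk_update A b v Y = r (t + h) \<and>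
      norm (rk_update A b v Y - y (t + h)) \<le> (1 + K * h) * norm (v - y t) + K * h ^ (p + 1) \<and>
      norm (rk_update A b w Z - z (t + h)) \<le> \<bar>R_inf A b\<bar> * norm (w - z t) + K * (norm (v - y t) + h ^ (q + 1)) \<and>
      (\<forall>i. c $ i = 1 \<longrightarrow> norm (Z i - z (t + h)) \<le> K * (norm (Y i - y (t + h)) + h ^ p))"
      using rk_dae_step[OF k assms(4,5) B Cc assms(3) f r C sol idx M(1)] by (elim exE conjE) (rule that)
    define E where "E = C * K * exp (K * C)"
    define D where "D = K * (E + 1) / (1 - \<bar>R_inf A b\<bar>)"
    have E0: "E \<ge> 0" using C K by (simp add: E_def)
    have D0: "D \<ge> 0" using E0 K assms(6) by (simp add: D_def)
    \<comment> \<open>The last two bounds make the final error estimates at most \<open>d\<close>,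
      so the numerical solution never leaves the region where the one-step estimate applies.\<close>
    define h0 where "h0 = min (min (min e1 e2) (min e3 e4)) (min (min 1 h1) (min (d / (E + 1)) (d / (D + 1))))"
    have "d / (E + 1) > 0" "d / (D + 1) > 0" using d E0 D0 by auto
    then have h0: "h0 > 0" "h0 \<le> e1" "h0 \<le> e2" "h0 \<le> e3" "h0 \<le> e4" "h0 \<le> 1" "h0 \<le> h1"
      "h0 \<le> d / (E + 1)" "h0 \<le> d / (D + 1)"
      unfolding h0_def using M1(2) M2(2) M3(2) M4(2) h1 by (simp_all add: min_le_iff_disj)
    have hb: "E * h \<le> d" "D * h \<le> d" if "h \<le> h0" "0 < h" for h
    proof -
      have "h * (E + 1) \<le> d" "h * (D + 1) \<le> d"
        using order_trans[OF that(1) h0(8)] order_trans[OF that(1) h0(9)] E0 D0 by (simp_all add: pos_le_divide_eq)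
      then show "E * h \<le> d" "D * h \<le> d" using that(2) by (simp_all add: algebra_simps)
    qed
    let ?e = "\<lambda>h n. norm (yn h n - y (real n * h))" and ?\<zeta> = "\<lambda>h n. norm (zn h n - z (real n * h))"
    let ?P = "\<lambda>h n. g *v yn h n = r (real n * h)"
    \<comment> \<open>The last clause, about stages with abscissa 1, is carried along for the
      stiffly accurate case.\<close>
    have one: "?P h (Suc n) \<and> ?e h (Suc n) \<le> (1 + K * h) * ?e h n + K * h ^ (p + 1) \<and>
        ?\<zeta> h (Suc n) \<le> \<bar>R_inf A b\<bar> * ?\<zeta> h n + K * (?e h n + h ^ (q + 1)) \<and>
        (\<forall>i. c $ i = 1 \<longrightarrow> norm (Z h n i - z (real (Suc n) * h)) \<le> K * (norm (Y h n i - y (real (Suc n) * h)) + h ^ p))"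
      if hn: "(h, n) \<in> ?G" and h: "h \<le> h0" and P: "?P h n" and small: "?e h n \<le> d" "?\<zeta> h n \<le> d" for h n
    proof -
      have t: "real n * h + h = real (Suc n) * h" by (simp add: algebra_simps)
      have hpos: "0 < h" and tC: "real (Suc n) * h \<le> C" using hn by (auto simp: grid_steps_def)
      have sch: "yn h (Suc n) = rk_update A b (yn h n) (Y h n)" "zn h (Suc n) = rk_update A b (zn h n) (Z h n)"
        "stage_constraint A c g r (\<theta> (real n * h) h) h (real n * h) (Y h n)"
        "theta_condition b c r (\<theta> (real n * h) h) h (real n * h)" using scheme hn by auto
      have he: "h \<le> e1" "h \<le> e2" "h \<le> e3" "h \<le> e4" "h \<le> h1" using order_trans[OF h] h0 by auto
      have up: "a * h ^ j \<le> M * h ^ j" if "a \<le> M" for a j using that hpos by (intro mult_right_mono) auto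
      show ?thesis
        unfolding sch(1,2) t[symmetric]
      proof (rule step[rule_format], intro conjI allI)
        show "real n * h + h \<le> C" unfolding t by (rule tC)
        show "norm (stage_residual A f h (yn h n) (Y h n) (Z h n) i) \<le> M * h ^ (p + 1)" for i
          using M1(3)[rule_format, OF conjI[OF hn he(1)]] up[OF M(2)] by (rule order_trans)
        show "norm (\<theta> (real n * h) h i) \<le> M * h ^ p" for i
          using M4(3)[rule_format, OF conjI[OF hn he(4)]] up[OF M(5)] by (rule order_trans)
        show "norm (Y h n i - yn h n) \<le> M * h" for i
          using order_trans[OF M2(3)[rule_format, OF conjI[OF hn he(2)]] up[OF M(3)]] by simp
        show "norm (Z h n i - zn h n) \<le> M * h" for i
          using order_trans[OF M3(3)[rule_format, OF conjI[OF hn he(3)]] up[OF M(4)]] by simp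
      qed (use hpos he(5) small P sch(3,4) in auto)
    qed
    \<comment> \<open>If t_n is at most \<open>C\<close>, every earlier step lies completely in
      \<open>{0..C}\<close>, so the scheme is in force there.\<close>
    have grid: "(h, m) \<in> ?G" if "(h, n) \<in> grid_points C hmax" "m < n" for h n m
    proof -
      have "real (Suc m) * h \<le> real n * h" using that by (intro mult_right_mono) (auto simp: grid_points_def)
      from order_trans[OF this] show ?thesis
        using that(1) by (simp add: grid_points_def grid_steps_def del: of_nat_Suc)
    qed
    have bound: "?P h n \<and> ?e h n \<le> E * h ^ p \<and> ?\<zeta> h n \<le> D * h ^ (q + 1)"
      if hn: "(h, n) \<in> grid_points C hmax" and h: "h \<le> h0" for h n
    proof (rule coupled_error_recursion[OF K _ assms(6,3) E_def D_def])
      show "0 < h" "real n * h \<le> C" using hn by (auto simp: grid_points_def)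
      then show "h \<le> 1" "E * h \<le> d" "D * h \<le> d" using hb[OF h] h h0(6) by auto
      show "?e h 0 = 0" "?\<zeta> h 0 = 0" "?P h 0" using init yz0 gy0 by auto
      show "?P h (Suc m) \<and> ?e h (Suc m) \<le> (1 + K * h) * ?e h m + K * h ^ (p + 1) \<and>
        ?\<zeta> h (Suc m) \<le> \<bar>R_inf A b\<bar> * ?\<zeta> h m + K * (?e h m + h ^ (q + 1))"
        if "m < n" "?P h m" "?e h m \<le> d" "?\<zeta> h m \<le> d" for m
        using one[OF grid[OF hn that(1)] h that(2-4)] by blast
    qed auto
    have "unif_bigo (grid_points C hmax) p (\<lambda>h n. yn h n - y (real n * h))"
      by (rule unif_bigoI[OF h0(1)]) (use bound in blast)
    moreover have "unif_bigo (grid_points C hmax) (q + 1) (\<lambda>h n. zn h n - z (real n * h))"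
      by (rule unif_bigoI[OF h0(1)]) (use bound in blast)
    moreover have "unif_bigo (grid_points C hmax) p (\<lambda>h n. zn h n - z (real n * h))"
      if sa: "(\<forall>i. A $ Max UNIV $ i = b $ i) \<and> (\<forall>i. c $ i = (\<Sum>j\<in>UNIV. A $ i $ j))"
    proof (rule unif_bigoI[OF h0(1)])
      fix h n assume hn: "(h, n) \<in> grid_points C hmax" and h: "h \<le> h0"
      have hpos: "0 < h" using hn by (simp add: grid_points_def)
      show "?\<zeta> h n \<le> (K * (E + 1)) * h ^ p"
      proof (cases n)
        case 0
        then show ?thesis using init yz0 K E0 hpos by simp
      next
        case (Suc m)
        let ?m = "Max UNIV :: 's"
        have hm: "(h, m) \<in> ?G" using grid[OF hn] Suc by simp
        then have hm': "(h, m) \<in> grid_points C hmax" using hpos by (auto simp: grid_points_def grid_steps_def algebra_simps)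
        note bd = bound[OF hm' h]
        \<comment> \<open>The error bounds at the preceding point \<open>m\<close> give the
          smallness under which the one-step estimate for its last stage may be used.\<close>
        have "h ^ p \<le> h" "h ^ (q + 1) \<le> h"
          using power_decreasing[of 1 p h] power_decreasing[of 1 "q + 1" h] hpos h h0(6) assms(3) by auto
        then have "?e h m \<le> d" "?\<zeta> h m \<le> d"
          using bd hb[OF h hpos] mult_left_mono[OF _ E0, of "h ^ p" h] mult_left_mono[OF _ D0, of "h ^ (q + 1)" h]
          by linarith+
        moreover have "c $ ?m = 1"
        proof -
          have "c $ ?m = (\<Sum>j\<in>UNIV. b $ j)" using sa by simp
          then show ?thesis using classical_order_consistent[OF assms(1)] assms(3) by simp
        qed
        ultimately have "norm (Z h m ?m - z (real (Suc m) * h)) \<le> K * (norm (Y h m ?m - y (real (Suc m) * h)) + h ^ p)"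
          using one[OF hm h] bd by blast
        \<comment> \<open>The last stage is itself the new value, so no recursion in z is left and
          the z-error inherits the order of the y-error.\<close>
        moreover have "Y h m ?m = yn h (Suc m)" "Z h m ?m = zn h (Suc m)"
          using bspec[OF scheme hm]
          by (simp_all add: rk_update_stiffly_accurate[OF assms(4) sa[THEN conjunct1, rule_format]])
        ultimately have "?\<zeta> h n \<le> K * (?e h n + h ^ p)" using Suc by simp
        also have "\<dots> \<le> K * (E * h ^ p + h ^ p)" using bound[OF hn h] K by (intro mult_left_mono add_right_mono) auto
        finally show ?thesis by (simp add: algebra_simps)
      qed
    qed
    ultimately show "unif_bigo (grid_points C hmax) p (\<lambda>h n. yn h n - y (real n * h)) \<and>
      unif_bigo (grid_points C hmax) (q + 1) (\<lambda>h n. zn h n - z (real n * h)) \<and>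
      ((\<forall>i. A $ Max UNIV $ i = b $ i) \<and> (\<forall>i. c $ i = (\<Sum>j\<in>UNIV. A $ i $ j)) \<longrightarrow>
       unif_bigo (grid_points C hmax) p (\<lambda>h n. zn h n - z (real n * h)))" by blast
  qed
qed

end
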